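(* Let $H$ be the free abelian group of rank $n$. For any $n\ge 2$ and $m\ge 2$, $$\mathrm{gr}^2(\mathfrak{J}_H)\cong(S^2H_{\mathbf{Q}})^{\oplus\frac12m^2(m^2-1)}\oplus(\Lambda^2H_{\mathbf{Q}})^{\oplus\frac12(m^2-1)(m^2-4)}$$ as $\mathrm{GL}(n,\mathbf{Z})$-modules.
   Context: Let $\overline{x_1},\dots,\overline{x_n}$ be a basis of $H$, $H_{\mathbf{Q}}=H\otimes_{\mathbf{Z}}\mathbf{Q}$, and $S^2H_{\mathbf{Q}}$, $\Lambda^2H_{\mathbf{Q}}$ its symmetric and exterior squares. Let $R^m(H)=\mathrm{Hom}(H,\mathrm{SL}(m,\mathbf{C}))$. For $x\in H$ and $1\le i,j\le m$, let $a_{ij}(x):R^m(H)\to\mathbf{C}$ be the function $\rho\mapsto$ the $(i,j)$-component of $\rho(x)$. Let $\mathfrak{R}^m_{\mathbf{Q}}(H)$ be the $\mathbf{Q}$-subalgebra of the algebra of all functions $R^m(H)\to\mathbf{C}$ (pointwise operations) generated by all $a_{ij}(x)$. Put $s_{ij}(x)=a_{ij}(x)-\delta_{ij}$, let $\mathfrak{J}_H$ be the ideal of $\mathfrak{R}^m_{\mathbf{Q}}(H)$ generated by $s_{ij}(\overline{x_l})$ for $1\le i,j\le m$, $1\le l\le n$, and put $\mathrm{gr}^2(\mathfrak{J}_H)=\mathfrak{J}_H^2/\mathfrak{J}_H^3$. The group $\mathrm{Aut}\,H\cong\mathrm{GL}(n,\mathbf{Z})$ acts from the right on $H$, $x\mapsto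 x^\sigma$, and on $\mathfrak{R}^m_{\mathbf{Q}}(H)$ by algebra automorphisms with $a_{ij}(x)^\sigma=a_{ij}(x^\sigma)$; $\mathfrak{J}_H$ and its powers are invariant, so it acts on $\mathrm{gr}^2(\mathfrak{J}_H)$. *)

theory Defs
  imports
    "HOL-Analysis.Determinants"
    "HOL-Library.Function_Algebras"
    "HOL-Library.Poly_Mapping"
begin

section \<open>Free abelian groups\<close>

definition zscale :: "int \<Rightarrow> 'a::ab_group_add \<Rightarrow> 'a" where
  "zscale k x = (\<Sum>_<nat k. x) - (\<Sum>_<nat (- k). x)"

lemma zscale_of_nat_diff: "zscale (int a - int b) x = (\<Sum>_<a. x) - (\<Sum>_<b. x)"
proof -
  have split: "(\<Sum>_<c + d. x) = (\<Sum>_<c. x) + (\<Sum>_<d. x)" for c d :: nat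
    by (induction d) (simp_all add: add.assoc)
  show ?thesis
  proof (cases "b \<le> a")
    case True
    then obtain c where "a = b + c" using le_Suc_ex by blast
    then show ?thesis by (simp add: zscale_def split)
  next
    case False
    then obtain c where "b = a + c" using le_Suc_ex nat_le_linear by blast
    then show ?thesis by (simp add: zscale_def split)
  qed
qed

global_interpretation zmod: module "zscale :: int \<Rightarrow> 'a::ab_group_add \<Rightarrow> 'a"
proof
  have split: "(\<Sum>_<c + d. x) = (\<Sum>_<c. x) + (\<Sum>_<d. x)" for c d :: nat and x :: 'a
    by (induction d) (simp_all add: add.assoc)
  fix a b :: int and x y :: 'a
  obtain a1 a2 where a: "a = int a1 - int a2" using int_diff_cases by blast
  obtain b1 b2 where b: "b = int b1 - int b2" using int_diff_cases by blast
  show "zscale a (x + y) = zscale a x + zscale a y"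
    by (simp add: zscale_def sum.distrib)
  have ab: "a + b = int (a1 + b1) - int (a2 + b2)" using a b by simp
  show add: "zscale (a + b) x = zscale a x + zscale b x"
    unfolding ab unfolding a b zscale_of_nat_diff split by (simp add: algebra_simps)
  show "zscale 1 x = x" by (simp add: zscale_def)
  have iter: "(\<Sum>_<c. \<Sum>_<d. x) = (\<Sum>_<c * d. x)" for c d :: nat
    by (induction c) (simp_all add: split add.commute)
  have ab': "a * b = int (a1 * b1 + a2 * b2) - int (a1 * b2 + a2 * b1)"
    unfolding a b by (simp add: algebra_simps)
  show "zscale a (zscale b x) = zscale (a * b) x"
    unfolding ab' unfolding a b zscale_of_nat_diff split sum_subtractf iter
    by (simp add: algebra_simps)
qed

definition zbasis :: "'h::ab_group_add set \<Rightarrow> bool" where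
  "zbasis B \<longleftrightarrow> \<not> zmod.dependent B \<and> zmod.span B = UNIV"

typedef (overloaded) 'h aut =
  "{\<sigma> :: 'h::ab_group_add \<Rightarrow> 'h. Modules.additive \<sigma> \<and> bij \<sigma>}"
  morphisms apply_aut Aut
  by (rule exI[of _ id]) (simp add: Modules.additive_def)

setup_lifting type_definition_aut

section \<open>Rational vector spaces\<close>

class rat_vector = ab_group_add +
  fixes scaleQ :: "rat \<Rightarrow> 'a \<Rightarrow> 'a"  (infixr \<open>*\<^sub>Q\<close> 75)
  assumes scaleQ_add_right: "q *\<^sub>Q (x + y) = q *\<^sub>Q x + q *\<^sub>Q y"
    and scaleQ_add_left: "(q + r) *\<^sub>Q x = q *\<^sub>Q x + r *\<^sub>Q x"
    and scaleQ_scaleQ: "q *\<^sub>Q r *\<^sub>Q x = (q * r) *\<^sub>Q x"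
    and scaleQ_one: "1 *\<^sub>Q x = x"

global_interpretation ratvec: vector_space "scaleQ :: rat \<Rightarrow> 'a::rat_vector \<Rightarrow> 'a"
  by standard (rule scaleQ_add_right scaleQ_add_left scaleQ_scaleQ scaleQ_one)+

instantiation rat :: rat_vector
begin
definition scaleQ_rat :: "rat \<Rightarrow> rat \<Rightarrow> rat" where "q *\<^sub>Q (r :: rat) = q * r"
instance by standard (simp_all add: scaleQ_rat_def algebra_simps)
end

instantiation complex :: rat_vector
begin
definition scaleQ_complex :: "rat \<Rightarrow> complex \<Rightarrow> complex" where "q *\<^sub>Q (z :: complex) = of_rat q * z"
instance by standard (simp_all add: scaleQ_complex_def algebra_simps of_rat_add of_rat_mult)
end

instantiation "fun" :: (type, rat_vector) rat_vector
begin
definition scaleQ_fun :: "rat \<Rightarrow> ('a \<Rightarrow> 'b) \<Rightarrow> 'a \<Rightarrow> 'b" where "q *\<^sub>Q f = (\<lambda>x. q *\<^sub>Q f x)"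
instance
  by standard (simp_all add: scaleQ_fun_def fun_eq_iff scaleQ_add_right scaleQ_add_left
      scaleQ_scaleQ scaleQ_one)
end

instantiation prod :: (rat_vector, rat_vector) rat_vector
begin
definition scaleQ_prod :: "rat \<Rightarrow> 'a \<times> 'b \<Rightarrow> 'a \<times> 'b"
  where "q *\<^sub>Q p = (q *\<^sub>Q fst p, q *\<^sub>Q snd p)"
instance
  by standard (simp_all add: scaleQ_prod_def prod_eq_iff scaleQ_add_right scaleQ_add_left
      scaleQ_scaleQ scaleQ_one)
end

instantiation poly_mapping :: (type, rat_vector) rat_vector
begin
lift_definition scaleQ_poly_mapping :: "rat \<Rightarrow> ('a \<Rightarrow>\<^sub>0 'b) \<Rightarrow> 'a \<Rightarrow>\<^sub>0 'b" is "\<lambda>q f k. q *\<^sub>Q f k"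
  by (erule rev_finite_subset) auto
instance
  by standard (transfer; simp add: fun_eq_iff scaleQ_add_right scaleQ_add_left
      scaleQ_scaleQ scaleQ_one)+
end

section \<open>Spaces given by generators and relations\<close>

text \<open>The type \<^typ>\<open>'x \<Rightarrow>\<^sub>0 rat\<close> is the free rational vector space on \<^typ>\<open>'x\<close>.\<close>

definition free_map :: "('a \<Rightarrow> 'b) \<Rightarrow> ('a \<Rightarrow>\<^sub>0 rat) \<Rightarrow> 'b \<Rightarrow>\<^sub>0 rat" where
  "free_map f p = (\<Sum>k\<in>Poly_Mapping.keys p. Poly_Mapping.single (f k) (Poly_Mapping.lookup p k))"

lemma free_map_eq:
  assumes "finite S" "Poly_Mapping.keys p \<subseteq> S"
  shows "free_map f p = (\<Sum>k\<in>S. Poly_Mapping.single (f k) (Poly_Mapping.lookup p k))"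
  unfolding free_map_def using assms
  by (intro sum.mono_neutral_left) (auto simp: in_keys_iff)

lemma free_map_add: "free_map f (p + q) = free_map f p + free_map f q"
proof -
  let ?S = "Poly_Mapping.keys p \<union> Poly_Mapping.keys q"
  have "Poly_Mapping.keys (p + q) \<subseteq> ?S" by (rule Poly_Mapping.keys_add)
  then show ?thesis
    by (simp add: free_map_eq[of ?S] lookup_add single_add sum.distrib)
qed

lemma free_map_scale:
  fixes f :: "'a \<Rightarrow> 'b"
  shows "free_map f (c *\<^sub>Q p) = c *\<^sub>Q free_map f p"
proof -
  have k: "Poly_Mapping.keys (c *\<^sub>Q p) \<subseteq> Poly_Mapping.keys p"
    by (auto simp: in_keys_iff scaleQ_poly_mapping.rep_eq scaleQ_rat_def)
  have s: "Poly_Mapping.single a (c * r) = c *\<^sub>Q Poly_Mapping.single a r" for a :: 'b and r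
    by transfer (auto simp: fun_eq_iff scaleQ_rat_def when_def)
  show ?thesis
    by (subst (1 2) free_map_eq[of "Poly_Mapping.keys p"])
      (auto simp: k[THEN subsetD] scaleQ_poly_mapping.rep_eq s scaleQ_rat_def ratvec.scale_sum_right)
qed

lemma free_map_diff: "free_map f (p - q) = free_map f p - free_map f q"
  using free_map_add[of f "p - q" q] by simp

lemma free_map_single [simp]: "free_map f (Poly_Mapping.single a r) = Poly_Mapping.single (f a) r"
  by (cases "r = 0") (simp_all add: free_map_def)

lemma free_map_span:
  assumes "free_map f ` S \<subseteq> T" and "p \<in> ratvec.span S"
  shows "free_map f p \<in> ratvec.span T"
  using assms(2)
proof (induction rule: ratvec.span_induct_alt)
  case base
  show ?case by (simp add: free_map_def ratvec.span_zero)
next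
  case (step c x y)
  then have "free_map f x \<in> ratvec.span T" using assms(1) by (blast intro: ratvec.span_base)
  then show ?case using step by (simp add: free_map_add free_map_scale ratvec.span_add ratvec.span_scale)
qed

abbreviation pt :: "'a \<Rightarrow> 'b \<Rightarrow> ('a \<times> 'b) \<Rightarrow>\<^sub>0 rat" where
  "pt x y \<equiv> Poly_Mapping.single (x, y) 1"

lemma equivp_mod_span: "equivp (\<lambda>p q. p - q \<in> ratvec.span S)"
proof (rule equivpI)
  show "reflp (\<lambda>p q. p - q \<in> ratvec.span S)" by (simp add: reflp_def ratvec.span_zero)
  show "symp (\<lambda>p q. p - q \<in> ratvec.span S)"
    by (metis (no_types, lifting) minus_diff_eq ratvec.span_neg sympI)
  show "transp (\<lambda>p q. p - q \<in> ratvec.span S)"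
    by (rule transpI) (metis (no_types, lifting) diff_add_cancel add_diff_eq ratvec.span_add)
qed

lemma mod_span_add:
  "\<lbrakk>a - b \<in> ratvec.span S; c - d \<in> ratvec.span S\<rbrakk> \<Longrightarrow> a + c - (b + d) \<in> ratvec.span S"
  using ratvec.span_add[of "a - b" S "c - d"] by (simp add: algebra_simps)

lemma mod_span_minus: "a - b \<in> ratvec.span S \<Longrightarrow> - a - - b \<in> ratvec.span S"
  using ratvec.span_neg[of "a - b" S] by simp

lemma mod_span_diff:
  "\<lbrakk>a - b \<in> ratvec.span S; c - d \<in> ratvec.span S\<rbrakk> \<Longrightarrow> a - c - (b - d) \<in> ratvec.span S"
  using ratvec.span_diff[of "a - b" S "c - d"] by (simp add: algebra_simps)

lemma mod_span_scale: "a - b \<in> ratvec.span S \<Longrightarrow> q *\<^sub>Q a - q *\<^sub>Q b \<in> ratvec.span S"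
  using ratvec.span_scale[of "a - b" S q] by (simp add: ratvec.scale_right_diff_distrib)

lemmas mod_span = mod_span_add mod_span_minus mod_span_diff mod_span_scale

subsection \<open>\<open>H \<otimes> \<rat>\<close>\<close>

text \<open>Generators \<open>x \<otimes> q\<close>. The relation \<open>x \<otimes> rq = r(x \<otimes> q)\<close> makes the scalars of the
  free space act through the second factor; additivity over the integers makes the
  tensor product balanced.\<close>

definition hq_rels :: "(('h::ab_group_add \<times> rat) \<Rightarrow>\<^sub>0 rat) set" where
  "hq_rels =
     {pt (x + y) q - pt x q - pt y q | x y q. True} \<union>
     {pt x (q + r) - pt x q - pt x r | x q r. True} \<union>
     {pt x (r * q) - r *\<^sub>Q pt x q | x q r. True}"

quotient_type (overloaded) 'h hq = "('h::ab_group_add \<times> rat) \<Rightarrow>\<^sub>0 rat" /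
  "\<lambda>p q. p - q \<in> ratvec.span hq_rels"
  by (rule equivp_mod_span)

instantiation hq :: (ab_group_add) rat_vector
begin
lift_definition zero_hq :: "'a hq" is 0 .
lift_definition plus_hq :: "'a hq \<Rightarrow> 'a hq \<Rightarrow> 'a hq" is "(+)" by (rule mod_span)
lift_definition uminus_hq :: "'a hq \<Rightarrow> 'a hq" is uminus by (rule mod_span)
lift_definition minus_hq :: "'a hq \<Rightarrow> 'a hq \<Rightarrow> 'a hq" is "(-)" by (rule mod_span)
lift_definition scaleQ_hq :: "rat \<Rightarrow> 'a hq \<Rightarrow> 'a hq" is scaleQ by (rule mod_span)
instance
  by standard
    (transfer; simp add: algebra_simps scaleQ_add_right scaleQ_add_left scaleQ_scaleQ scaleQ_one
      ratvec.span_zero)+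
end

lift_definition tens :: "'h::ab_group_add \<Rightarrow> rat \<Rightarrow> 'h hq" is pt .

lift_definition hq_act :: "'h::ab_group_add hq \<Rightarrow> 'h aut \<Rightarrow> 'h hq" is
  "\<lambda>p \<sigma>. free_map (\<lambda>(x, q). (\<sigma> x, q)) p"
proof -
  fix \<sigma> :: "'h \<Rightarrow> 'h" and p q :: "('h \<times> rat) \<Rightarrow>\<^sub>0 rat"
  assume "Modules.additive \<sigma> \<and> bij \<sigma>" and pq: "p - q \<in> ratvec.span hq_rels"
  then have add: "\<sigma> (x + y) = \<sigma> x + \<sigma> y" for x y by (simp add: Modules.additive_def)
  have "free_map (\<lambda>(x, q). (\<sigma> x, q)) ` hq_rels \<subseteq> hq_rels"
    by (auto simp: hq_rels_def free_map_diff free_map_scale add) blast+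
  from free_map_span[OF this pq]
  show "free_map (\<lambda>(x, q). (\<sigma> x, q)) p - free_map (\<lambda>(x, q). (\<sigma> x, q)) q \<in> ratvec.span hq_rels"
    by (simp add: free_map_diff)
qed

lemma hq_act_tens: "hq_act (tens x q) \<sigma> = tens (apply_aut \<sigma> x) q"
  by transfer (simp add: ratvec.span_zero)

lemma hq_act_add: "hq_act (v + w) \<sigma> = hq_act v \<sigma> + hq_act w \<sigma>"
  by transfer (simp add: free_map_add ratvec.span_zero)

lemma hq_act_scale: "hq_act (q *\<^sub>Q v) \<sigma> = q *\<^sub>Q hq_act v \<sigma>"
  by transfer (simp add: free_map_scale ratvec.span_zero)

subsection \<open>Symmetric and exterior squares\<close>

definition bilin_rels :: "(('v::rat_vector \<times> 'v) \<Rightarrow>\<^sub>0 rat) set" where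
  "bilin_rels =
     {pt (u + v) w - pt u w - pt v w | u v w. True} \<union>
     {pt u (v + w) - pt u v - pt u w | u v w. True} \<union>
     {pt (q *\<^sub>Q u) v - q *\<^sub>Q pt u v | u v q. True} \<union>
     {pt u (q *\<^sub>Q v) - q *\<^sub>Q pt u v | u v q. True}"

definition sym_rels :: "(('v::rat_vector \<times> 'v) \<Rightarrow>\<^sub>0 rat) set" where
  "sym_rels = bilin_rels \<union> {pt u v - pt v u | u v. True}"

definition alt_rels :: "(('v::rat_vector \<times> 'v) \<Rightarrow>\<^sub>0 rat) set" where
  "alt_rels = bilin_rels \<union> {pt v v | v. True}"

quotient_type (overloaded) 'v sym2 = "('v::rat_vector \<times> 'v) \<Rightarrow>\<^sub>0 rat" /
  "\<lambda>p q. p - q \<in> ratvec.span sym_rels"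
  by (rule equivp_mod_span)

quotient_type (overloaded) 'v ext2 = "('v::rat_vector \<times> 'v) \<Rightarrow>\<^sub>0 rat" /
  "\<lambda>p q. p - q \<in> ratvec.span alt_rels"
  by (rule equivp_mod_span)

instantiation sym2 :: (rat_vector) rat_vector
begin
lift_definition zero_sym2 :: "'a sym2" is 0 .
lift_definition plus_sym2 :: "'a sym2 \<Rightarrow> 'a sym2 \<Rightarrow> 'a sym2" is "(+)" by (rule mod_span)
lift_definition uminus_sym2 :: "'a sym2 \<Rightarrow> 'a sym2" is uminus by (rule mod_span)
lift_definition minus_sym2 :: "'a sym2 \<Rightarrow> 'a sym2 \<Rightarrow> 'a sym2" is "(-)" by (rule mod_span)
lift_definition scaleQ_sym2 :: "rat \<Rightarrow> 'a sym2 \<Rightarrow> 'a sym2" is scaleQ by (rule mod_span)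
instance
  by standard
    (transfer; simp add: algebra_simps scaleQ_add_right scaleQ_add_left scaleQ_scaleQ scaleQ_one
      ratvec.span_zero)+
end

instantiation ext2 :: (rat_vector) rat_vector
begin
lift_definition zero_ext2 :: "'a ext2" is 0 .
lift_definition plus_ext2 :: "'a ext2 \<Rightarrow> 'a ext2 \<Rightarrow> 'a ext2" is "(+)" by (rule mod_span)
lift_definition uminus_ext2 :: "'a ext2 \<Rightarrow> 'a ext2" is uminus by (rule mod_span)
lift_definition minus_ext2 :: "'a ext2 \<Rightarrow> 'a ext2 \<Rightarrow> 'a ext2" is "(-)" by (rule mod_span)
lift_definition scaleQ_ext2 :: "rat \<Rightarrow> 'a ext2 \<Rightarrow> 'a ext2" is scaleQ by (rule mod_span)
instance
  by standard
    (transfer; simp add: algebra_simps scaleQ_add_right scaleQ_add_left scaleQ_scaleQ scaleQ_one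
      ratvec.span_zero)+
end

lift_definition symprod :: "'v::rat_vector \<Rightarrow> 'v \<Rightarrow> 'v sym2" is pt .

lift_definition wedge :: "'v::rat_vector \<Rightarrow> 'v \<Rightarrow> 'v ext2" is pt .

lemma free_map_bilin_rels:
  assumes "\<And>v w. f (v + w) = f v + f w" and "\<And>q v. f (q *\<^sub>Q v) = q *\<^sub>Q f v"
  shows "free_map (map_prod f f) ` bilin_rels \<subseteq> bilin_rels"
  by (auto simp: bilin_rels_def free_map_diff free_map_scale assms) blast+

lift_definition sym2_act :: "'h::ab_group_add hq sym2 \<Rightarrow> 'h aut \<Rightarrow> 'h hq sym2" is
  "\<lambda>p \<sigma>. free_map (map_prod (\<lambda>v. hq_act v \<sigma>) (\<lambda>v. hq_act v \<sigma>)) p"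
proof -
  fix \<sigma> :: "'h aut" and p q :: "('h hq \<times> 'h hq) \<Rightarrow>\<^sub>0 rat"
  let ?F = "free_map (map_prod (\<lambda>v. hq_act v \<sigma>) (\<lambda>v. hq_act v \<sigma>))"
  assume pq: "p - q \<in> ratvec.span sym_rels"
  have "?F ` bilin_rels \<subseteq> bilin_rels" by (intro free_map_bilin_rels hq_act_add hq_act_scale)
  then have "?F ` sym_rels \<subseteq> sym_rels" by (auto simp: sym_rels_def free_map_diff) blast+
  from free_map_span[OF this pq] show "?F p - ?F q \<in> ratvec.span sym_rels"
    by (simp add: free_map_diff)
qed

lift_definition ext2_act :: "'h::ab_group_add hq ext2 \<Rightarrow> 'h aut \<Rightarrow> 'h hq ext2" is
  "\<lambda>p \<sigma>. free_map (map_prod (\<lambda>v. hq_act v \<sigma>) (\<lambda>v. hq_act v \<sigma>)) p"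
proof -
  fix \<sigma> :: "'h aut" and p q :: "('h hq \<times> 'h hq) \<Rightarrow>\<^sub>0 rat"
  let ?F = "free_map (map_prod (\<lambda>v. hq_act v \<sigma>) (\<lambda>v. hq_act v \<sigma>))"
  assume pq: "p - q \<in> ratvec.span alt_rels"
  have "?F ` bilin_rels \<subseteq> bilin_rels" by (intro free_map_bilin_rels hq_act_add hq_act_scale)
  then have "?F ` alt_rels \<subseteq> alt_rels" by (auto simp: alt_rels_def free_map_diff)
  from free_map_span[OF this pq] show "?F p - ?F q \<in> ratvec.span alt_rels"
    by (simp add: free_map_diff)
qed

lemma sym2_act_symprod: "sym2_act (symprod v w) \<sigma> = symprod (hq_act v \<sigma>) (hq_act w \<sigma>)"
  by transfer (simp add: ratvec.span_zero)

lemma ext2_act_wedge: "ext2_act (wedge v w) \<sigma> = wedge (hq_act v \<sigma>) (hq_act w \<sigma>)"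
  by transfer (simp add: ratvec.span_zero)

text \<open>\<open>direct_sum k l\<close> is the direct sum of \<open>k\<close> copies of the first and \<open>l\<close> copies of the
  second space, the \<open>i\<close>-th components being the values at \<open>i\<close>.\<close>

definition direct_sum :: "nat \<Rightarrow> nat \<Rightarrow> ((nat \<Rightarrow> 'v::rat_vector) \<times> (nat \<Rightarrow> 'w::rat_vector)) set" where
  "direct_sum k l = {(u, v). (\<forall>i\<ge>k. u i = 0) \<and> (\<forall>i\<ge>l. v i = 0)}"

definition sum_act :: "(nat \<Rightarrow> 'h::ab_group_add hq sym2) \<times> (nat \<Rightarrow> 'h hq ext2) \<Rightarrow> 'h aut \<Rightarrow>
    (nat \<Rightarrow> 'h hq sym2) \<times> (nat \<Rightarrow> 'h hq ext2)" where
  "sum_act p \<sigma> = ((\<lambda>i. sym2_act (fst p i) \<sigma>), (\<lambda>i. ext2_act (snd p i) \<sigma>))"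

section \<open>The algebra of functions on \<open>Hom(H, SL(m, \<complex>))\<close>\<close>

typedef (overloaded) ('h, 'm) slrep =
  "{\<rho> :: 'h::ab_group_add \<Rightarrow> complex^'m^'m::finite.
      (\<forall>x. det (\<rho> x) = 1) \<and> (\<forall>x y. \<rho> (x + y) = \<rho> x ** \<rho> y)}"
  morphisms apply_rep Slrep
  by (rule exI[of _ "\<lambda>_. mat 1"]) simp

setup_lifting type_definition_slrep

definition acoef :: "'m \<Rightarrow> 'm \<Rightarrow> 'h::ab_group_add \<Rightarrow> ('h, 'm::finite) slrep \<Rightarrow> complex" where
  "acoef i j x = (\<lambda>\<rho>. apply_rep \<rho> x $ i $ j)"

definition scoef :: "'m \<Rightarrow> 'm \<Rightarrow> 'h::ab_group_add \<Rightarrow> ('h, 'm::finite) slrep \<Rightarrow> complex" where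
  "scoef i j x = acoef i j x - (if i = j then 1 else 0)"

definition subalgebra :: "('x \<Rightarrow> complex) set \<Rightarrow> bool" where
  "subalgebra A \<longleftrightarrow> ratvec.subspace A \<and> 1 \<in> A \<and> (\<forall>f\<in>A. \<forall>g\<in>A. f * g \<in> A)"

text \<open>Since \<^typ>\<open>('h, 'm) slrep\<close> is a type, the algebra of all functions on \<open>Hom(H, SL(m, \<complex>))\<close> is
  a full function type with the pointwise operations of \<^theory>\<open>HOL-Library.Function_Algebras\<close>,
  and \<open>m\<close> is the cardinality of \<^typ>\<open>'m\<close>.\<close>

definition coord_alg :: "(('h::ab_group_add, 'm::finite) slrep \<Rightarrow> complex) set" where
  "coord_alg = subalgebra hull {acoef i j x | i j x. True}"

definition is_ideal :: "('x \<Rightarrow> complex) set \<Rightarrow> ('x \<Rightarrow> complex) set \<Rightarrow> bool" where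
  "is_ideal A I \<longleftrightarrow> I \<subseteq> A \<and> 0 \<in> I \<and> (\<forall>f\<in>I. \<forall>g\<in>I. f + g \<in> I) \<and> (\<forall>a\<in>A. \<forall>f\<in>I. a * f \<in> I)"

fun ideal_power :: "('x \<Rightarrow> complex) set \<Rightarrow> ('x \<Rightarrow> complex) set \<Rightarrow> nat \<Rightarrow> ('x \<Rightarrow> complex) set" where
  "ideal_power A I 0 = A"
| "ideal_power A I (Suc k) = is_ideal A hull {f * g | f g. f \<in> ideal_power A I k \<and> g \<in> I}"

definition J_ideal :: "'h::ab_group_add set \<Rightarrow> (('h, 'm::finite) slrep \<Rightarrow> complex) set" where
  "J_ideal B = is_ideal coord_alg hull {scoef i j x | i j x. x \<in> B}"

abbreviation J_power :: "'h::ab_group_add set \<Rightarrow> nat \<Rightarrow> (('h, 'm::finite) slrep \<Rightarrow> complex) set" where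
  "J_power B k \<equiv> ideal_power coord_alg (J_ideal B) k"

definition coset :: "('x \<Rightarrow> complex) set \<Rightarrow> ('x \<Rightarrow> complex) \<Rightarrow> ('x \<Rightarrow> complex) set" where
  "coset I f = {f + g | g. g \<in> I}"

definition gr :: "nat \<Rightarrow> 'h::ab_group_add set \<Rightarrow> (('h, 'm::finite) slrep \<Rightarrow> complex) set set" where
  "gr k B = coset (J_power B (Suc k)) ` J_power B k"

lift_definition rep_act :: "('h::ab_group_add, 'm::finite) slrep \<Rightarrow> 'h aut \<Rightarrow> ('h, 'm) slrep" is
  "\<lambda>\<rho> \<sigma>. \<rho> \<circ> \<sigma>"
  by (simp add: Modules.additive_def)

text \<open>The action characterised by \<open>a\<^sub>i\<^sub>j(x)\<^sup>\<sigma> = a\<^sub>i\<^sub>j(x\<^sup>\<sigma>)\<close>; see the two lemmas below.\<close>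

definition fun_act :: "(('h::ab_group_add, 'm::finite) slrep \<Rightarrow> complex) \<Rightarrow> 'h aut \<Rightarrow>
    ('h, 'm) slrep \<Rightarrow> complex" where
  "fun_act f \<sigma> = (\<lambda>\<rho>. f (rep_act \<rho> \<sigma>))"

lemma fun_act_acoef: "fun_act (acoef i j x) \<sigma> = acoef i j (apply_aut \<sigma> x)"
  by (simp add: fun_act_def acoef_def rep_act.rep_eq)

lemma fun_act_algebra_hom:
  "fun_act 1 \<sigma> = 1"
  "fun_act (f + g) \<sigma> = fun_act f \<sigma> + fun_act g \<sigma>"
  "fun_act (f * g) \<sigma> = fun_act f \<sigma> * fun_act g \<sigma>"
  "fun_act (q *\<^sub>Q f) \<sigma> = q *\<^sub>Q fun_act f \<sigma>"
  by (simp_all add: fun_act_def scaleQ_fun_def fun_eq_iff)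

text \<open>Isomorphisms of rational vector spaces with \<open>Aut H\<close>-action from
  \<open>gr k B\<close> onto \<open>W\<close>. The operations of \<open>gr k B\<close> are those induced on cosets by their
  representatives.\<close>

definition gr_iso :: "nat \<Rightarrow> 'h::ab_group_add set \<Rightarrow>
    ((('h, 'm::finite) slrep \<Rightarrow> complex) set \<Rightarrow> 'w::rat_vector) \<Rightarrow>
    'w set \<Rightarrow> ('w \<Rightarrow> 'h aut \<Rightarrow> 'w) \<Rightarrow> bool" where
  "gr_iso k B \<phi> W act \<longleftrightarrow>
     bij_betw \<phi> (gr k B) W \<and>
     (let cl = coset (J_power B (Suc k)) in
       (\<forall>f\<in>J_power B k. \<forall>g\<in>J_power B k. \<phi> (cl (f + g)) = \<phi> (cl f) + \<phi> (cl g)) \<and>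
       (\<forall>q. \<forall>f\<in>J_power B k. \<phi> (cl (q *\<^sub>Q f)) = q *\<^sub>Q \<phi> (cl f)) \<and>
       (\<forall>\<sigma>. \<forall>f\<in>J_power B k. \<phi> (cl (fun_act f \<sigma>)) = act (\<phi> (cl f)) \<sigma>))"

end

theory Submission
  imports Defs
begin

text \<open>
  Write a representation as \<open>\<rho> = 1 + S\<close> and let \<open>J\<close> be the augmentation ideal. Since \<open>\<rho>(x + y) = \<rho>(x) \<rho>(y)\<close>
  and \<open>det \<rho>(x) = 1\<close>, the entries of \<open>S(x)\<close> are modulo \<open>J\<^sup>2\<close> additive in \<open>x\<close> and have trace zero; so to
  first order they form \<open>d = m\<^sup>2 - 1\<close> linear functions of \<open>x\<close> with values in \<open>J/J\<^sup>2\<close>. The quotient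
  \<open>J\<^sup>2/J\<^sup>3\<close> is spanned by products of two of them. Symmetrising and antisymmetrising such a product in
  its two entries gives a symmetric and an alternating bilinear map on \<open>H\<close>, that is, maps on
  \<open>S\<^sup>2H\<close> and \<open>\<Lambda>\<^sup>2H\<close>, one for each unordered pair of entries. Among the symmetric ones there are no
  relations: they yield \<open>d (d + 1) / 2 = m\<^sup>2 (m\<^sup>2 - 1) / 2\<close> copies of \<open>S\<^sup>2H\<close>. The alternating ones satisfy
  the entries of \<open>S(x) S(y) = S(y) S(x)\<close>, which are \<open>d\<close> independent relations, and
  \<open>d (d - 1) / 2 - d = (m\<^sup>2 - 1) (m\<^sup>2 - 4) / 2\<close> copies of \<open>\<Lambda>\<^sup>2H\<close> remain. All maps are natural in \<open>H\<close>, which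
  makes the resulting map \<open>psi\<close> equivariant.

  Surjectivity (\<open>J2_subset_psi_range\<close>) amounts to solving the relations, which is immediate for a
  suitable choice of the pairs to be eliminated.

  Injectivity (\<open>psi_injective\<close>) is the claim that there are no further relations. A quadratic
  expression in \<open>J\<^sup>3\<close> vanishes to third order along every curve through the trivial representation, so
  its coefficients define a quadratic form that vanishes on all commuting families of traceless
  matrices, because every pair of commuting traceless \<open>X, Y\<close> is tangent to a curve of
  representations: scale \<open>1 + t X\<close> and \<open>1 + t Y\<close> to determinant one (\<open>quadratic_in_J3\<close>). The symmetric part
  of the form then vanishes by polarisation. The alternating part vanishes on commuting pairs and is
  therefore a functional of the commutator (\<open>alternating_form_zero\<close>), that is, a combination of the
  commutator relations; the choice of eliminated pairs makes it zero. The copies of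
  \<open>S\<^sup>2H\<close> and \<open>\<Lambda>\<^sup>2H\<close> are handled through coordinates with respect to a spanning family, whose
  independence is inherited from the functions.
\<close>

section \<open>Ideals in algebras of functions\<close>

lemma subalgebraD:
  assumes "subalgebra A"
  shows "ratvec.subspace A" "1 \<in> A" "f \<in> A \<Longrightarrow> g \<in> A \<Longrightarrow> f * g \<in> A"
  using assms by (auto simp: subalgebra_def)

lemma scaleQ_mult_fun: "(q *\<^sub>Q f) * g = q *\<^sub>Q (f * (g :: 'x \<Rightarrow> complex))"
  "f * (q *\<^sub>Q g) = q *\<^sub>Q (f * (g :: 'x \<Rightarrow> complex))"
  by (simp_all add: fun_eq_iff scaleQ_fun_def scaleQ_complex_def)

lemma ideal_subspace:
  fixes I :: "('x \<Rightarrow> complex) set"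
  assumes "subalgebra A" "is_ideal A I"
  shows "ratvec.subspace I"
proof (rule ratvec.subspaceI)
  fix q and f :: "'x \<Rightarrow> complex" assume f: "f \<in> I"
  have "q *\<^sub>Q 1 \<in> A" using subalgebraD[OF assms(1)] ratvec.subspace_scale by blast
  then have "(q *\<^sub>Q 1) * f \<in> I" using assms(2) f by (auto simp: is_ideal_def)
  then show "q *\<^sub>Q f \<in> I" by (simp add: scaleQ_mult_fun)
qed (use assms(2) in \<open>auto simp: is_ideal_def\<close>)

lemma algebra_is_ideal: "subalgebra A \<Longrightarrow> is_ideal A A"
  by (auto simp: is_ideal_def subalgebra_def ratvec.subspace_0 ratvec.subspace_add)

lemma idealD:
  assumes "is_ideal A I"
  shows "I \<subseteq> A" "0 \<in> I" "f \<in> I \<Longrightarrow> g \<in> I \<Longrightarrow> f + g \<in> I"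
    "a \<in> A \<Longrightarrow> f \<in> I \<Longrightarrow> a * f \<in> I" "a \<in> A \<Longrightarrow> f \<in> I \<Longrightarrow> f * a \<in> I"
  using assms by (auto simp: is_ideal_def mult.commute[of f a])

lemma ideal_hull_is_ideal:
  assumes "subalgebra A" "S \<subseteq> A"
  shows "is_ideal A (is_ideal A hull S)"
proof -
  have "is_ideal A hull S \<subseteq> A" using assms by (simp add: hull_minimal algebra_is_ideal)
  then show ?thesis by (auto simp: is_ideal_def hull_def)
qed

lemma ideal_power_is_ideal:
  assumes A: "subalgebra A" and I: "is_ideal A I"
  shows "is_ideal A (ideal_power A I k)"
proof (induction k)
  case 0
  then show ?case using A by (simp add: algebra_is_ideal)
next
  case (Suc k)
  have "{f * g |f g. f \<in> ideal_power A I k \<and> g \<in> I} \<subseteq> A"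
    using idealD(1)[OF Suc] idealD(1)[OF I] subalgebraD(3)[OF A] by blast
  then show ?case unfolding ideal_power.simps by (rule ideal_hull_is_ideal[OF A])
qed

lemma ideal_power_mult:
  "f \<in> ideal_power A I k \<Longrightarrow> g \<in> I \<Longrightarrow> f * g \<in> ideal_power A I (Suc k)"
  unfolding ideal_power.simps by (rule hull_inc) blast

lemma ideal_power_one:
  assumes A: "subalgebra A" and I: "is_ideal A I"
  shows "ideal_power A I (Suc 0) = I"
proof
  show "ideal_power A I (Suc 0) \<subseteq> I"
    unfolding ideal_power.simps by (rule hull_minimal) (use idealD(4)[OF I] I in blast)+
  show "I \<subseteq> ideal_power A I (Suc 0)"
  proof
    fix f assume "f \<in> I"
    then show "f \<in> ideal_power A I (Suc 0)"
      using ideal_power_mult[of 1 A I 0 f] subalgebraD(2)[OF A] by (simp del: ideal_power.simps(2))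
  qed
qed

text \<open>An ideal consists of sums of products \<open>a f\<close> with \<open>f\<close> a generator, so a rational subspace
  that holds these products holds the ideal. Minimality of the hull does not suffice below: the
  subspaces in question (functions vanishing to some order along a curve, the image of a linear
  map) are not known to be ideals of \<open>A\<close>.\<close>

lemma ideal_hull_subset_subspace:
  fixes K :: "('x \<Rightarrow> complex) set"
  assumes A: "subalgebra A" and K: "ratvec.subspace K" and SA: "S \<subseteq> A"
    and S: "\<And>a f. a \<in> A \<Longrightarrow> f \<in> S \<Longrightarrow> a * f \<in> K"
  shows "is_ideal A hull S \<subseteq> K"
proof -
  let ?T = "{f \<in> A. \<forall>a\<in>A. a * f \<in> K}"
  have "is_ideal A ?T"
    unfolding is_ideal_def
  proof (intro conjI ballI)
    show "a * f \<in> ?T" if "a \<in> A" "f \<in> ?T" for a f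
      using that subalgebraD(3)[OF A] by (auto simp flip: mult.assoc)
  qed (use K subalgebraD(1)[OF A] in
      \<open>auto simp: ratvec.subspace_0 ratvec.subspace_add distrib_left\<close>)
  moreover have "S \<subseteq> ?T" using SA S by auto
  ultimately have "is_ideal A hull S \<subseteq> ?T" by (rule hull_minimal[rotated])
  then show ?thesis using subalgebraD(2)[OF A] by fastforce
qed

lemma subalgebra_hull: "subalgebra (subalgebra hull S)"
  by (rule hull_in) (auto simp: subalgebra_def ratvec.subspace_Inter)

section \<open>Determinants near the identity\<close>

text \<open>A permutation other than the identity moves at least two points, hence contributes to
  \<open>det (1 + S)\<close> a product with two off-diagonal factors; the diagonal product gives \<open>1 + tr S\<close> up to
  products of two entries. The three sets stand for a ring, an ideal and an ideal that contains
  its square: with functions on representations this yields that traces are of second order, with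
  germs of functions of \<open>t\<close> it normalises the determinant of \<open>1 + t X\<close>.\<close>

lemma det_one_plus:
  fixes A I I2 :: "'r::comm_ring_1 set" and M S :: "'r^'m^'m::finite"
  assumes A: "1 \<in> A" "\<And>x y. x \<in> A \<Longrightarrow> y \<in> A \<Longrightarrow> x * y \<in> A" "\<And>x y. x \<in> A \<Longrightarrow> y \<in> A \<Longrightarrow> x + y \<in> A"
    and IA: "I \<subseteq> A"
    and I: "0 \<in> I" "\<And>x y. x \<in> I \<Longrightarrow> y \<in> I \<Longrightarrow> x + y \<in> I"
    and I2: "0 \<in> I2" "\<And>x y. x \<in> I2 \<Longrightarrow> y \<in> I2 \<Longrightarrow> x + y \<in> I2" "\<And>x. x \<in> I2 \<Longrightarrow> - x \<in> I2"
      "\<And>x y. x \<in> A \<Longrightarrow> y \<in> I2 \<Longrightarrow> x * y \<in> I2" "\<And>x y. x \<in> I \<Longrightarrow> y \<in> I \<Longrightarrow> x * y \<in> I2"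
    and S: "\<And>i j. S $ i $ j \<in> I"
    and M: "\<And>i j. M $ i $ j = (if i = j then 1 else 0) + S $ i $ j"
  shows "det M - 1 - (\<Sum>i\<in>UNIV. S $ i $ i) \<in> I2"
proof -
  have sumI2: "sum f X \<in> I2" if "\<And>x. x \<in> X \<Longrightarrow> f x \<in> I2" for f :: "'q \<Rightarrow> 'r" and X
    using that by (induction X rule: infinite_finite_induct) (auto simp: I2)
  have prodA: "prod f X \<in> A" if "\<And>x. x \<in> X \<Longrightarrow> f x \<in> A" for f :: "'m \<Rightarrow> 'r" and X
    using that by (induction X rule: infinite_finite_induct) (auto simp: A)
  have MA: "M $ i $ j \<in> A" for i j
    using A(1,3) subsetD[OF IA S] by (auto simp: M)
  have diag: "(\<Prod>i\<in>X. M $ i $ i) - 1 - (\<Sum>i\<in>X. S $ i $ i) \<in> I2" for X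
  proof (induction X rule: infinite_finite_induct)
    case (insert x F)
    let ?s = "\<Sum>i\<in>F. S $ i $ i" and ?p = "\<Prod>i\<in>F. M $ i $ i"
    have "?s \<in> I" by (induction F rule: infinite_finite_induct) (auto simp: I S)
    have "(\<Prod>i\<in>insert x F. M $ i $ i) - 1 - (\<Sum>i\<in>insert x F. S $ i $ i)
        = M $ x $ x * (?p - 1 - ?s) + S $ x $ x * ?s"
      using insert by (simp add: M algebra_simps)
    then show ?case using insert.IH MA[of x x] S[of x x] \<open>?s \<in> I\<close> by (simp add: I2)
  qed (simp_all add: I2)
  have off: "of_int (sign p) * (\<Prod>i\<in>UNIV. M $ i $ p i) \<in> I2" if p: "p permutes UNIV" "p \<noteq> id" for p
  proof -
    obtain i where i: "p i \<noteq> i" using p(2) by (auto simp: fun_eq_iff)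
    define j where "j = p i"
    have j: "p j \<noteq> j" "j \<noteq> i"
      using i permutes_inj[OF p(1)] by (auto simp: j_def dest: injD)
    have "(\<Prod>i\<in>UNIV. M $ i $ p i) = (\<Prod>i\<in>UNIV - {i,j}. M $ i $ p i) * (M $ i $ p i * M $ j $ p j)"
      using j(2) prod.subset_diff[of "{i, j}" UNIV "\<lambda>i. M $ i $ p i"] by simp
    moreover have "M $ i $ p i * M $ j $ p j \<in> I2"
      using i j(1) S by (auto simp: M I2)
    ultimately have "(\<Prod>i\<in>UNIV. M $ i $ p i) \<in> I2" using prodA MA by (simp add: I2)
    then show ?thesis by (cases p rule: sign_cases) (simp_all add: I2)
  qed
  let ?P = "{p. p permutes (UNIV :: 'm set)}"
  have "det M = (\<Prod>i\<in>UNIV. M $ i $ i) + (\<Sum>p\<in>?P - {id}. of_int (sign p) * (\<Prod>i\<in>UNIV. M $ i $ p i))"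
    unfolding det_def by (subst sum.remove[of _ id]) auto
  then have eq: "det M - 1 - (\<Sum>i\<in>UNIV. S $ i $ i) = ((\<Prod>i\<in>UNIV. M $ i $ i) - 1 - (\<Sum>i\<in>UNIV. S $ i $ i))
      + (\<Sum>p\<in>?P - {id}. of_int (sign p) * (\<Prod>i\<in>UNIV. M $ i $ p i))" by simp
  show ?thesis unfolding eq by (rule I2(2)[OF diag sumI2]) (use off in auto)
qed

section \<open>Linear maps out of spaces given by generators and relations\<close>

definition lin_ext :: "('k \<Rightarrow> 'v::rat_vector) \<Rightarrow> ('k \<Rightarrow>\<^sub>0 rat) \<Rightarrow> 'v" where
  "lin_ext g p = (\<Sum>k\<in>Poly_Mapping.keys p. Poly_Mapping.lookup p k *\<^sub>Q g k)"

lemma lin_ext_eq: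
  assumes "finite S" "Poly_Mapping.keys p \<subseteq> S"
  shows "lin_ext g p = (\<Sum>k\<in>S. Poly_Mapping.lookup p k *\<^sub>Q g k)"
  unfolding lin_ext_def using assms
  by (intro sum.mono_neutral_left) (auto simp: in_keys_iff)

lemma lin_ext_add: "lin_ext g (p + q) = lin_ext g p + lin_ext g q"
proof -
  let ?S = "Poly_Mapping.keys p \<union> Poly_Mapping.keys q"
  have "Poly_Mapping.keys (p + q) \<subseteq> ?S" by (rule Poly_Mapping.keys_add)
  then show ?thesis
    by (simp add: lin_ext_eq[of ?S] lookup_add scaleQ_add_left sum.distrib)
qed

lemma lin_ext_scale: "lin_ext g (c *\<^sub>Q p) = c *\<^sub>Q lin_ext g p"
proof -
  have k: "Poly_Mapping.keys (c *\<^sub>Q p) \<subseteq> Poly_Mapping.keys p"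
    by (auto simp: in_keys_iff scaleQ_poly_mapping.rep_eq scaleQ_rat_def)
  show ?thesis
    by (subst (1 2) lin_ext_eq[of "Poly_Mapping.keys p"])
      (auto simp: k[THEN subsetD] scaleQ_poly_mapping.rep_eq scaleQ_rat_def scaleQ_scaleQ
        ratvec.scale_sum_right)
qed

lemma lin_ext_diff: "lin_ext g (p - q) = lin_ext g p - lin_ext g q"
  using lin_ext_add[of g "p - q" q] by simp

lemma lin_ext_single [simp]: "lin_ext g (Poly_Mapping.single a r) = r *\<^sub>Q g a"
  by (cases "r = 0") (simp_all add: lin_ext_def)

lemma lin_ext_span:
  assumes "ratvec.subspace K" "\<And>r. r \<in> S \<Longrightarrow> lin_ext g r \<in> K" "p \<in> ratvec.span S"
  shows "lin_ext g p \<in> K"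
  using assms(3)
proof (induction rule: ratvec.span_induct_alt)
  case base
  show ?case using assms(1) by (simp add: lin_ext_def ratvec.subspace_0)
next
  case (step c x y)
  then show ?case using assms(1,2)
    by (simp add: lin_ext_add lin_ext_scale ratvec.subspace_add ratvec.subspace_scale)
qed

lemma poly_mapping_sum_single:
  "p = (\<Sum>k\<in>Poly_Mapping.keys p. Poly_Mapping.lookup p k *\<^sub>Q Poly_Mapping.single k (1::rat))"
proof (rule poly_mapping_eqI)
  fix x
  have "Poly_Mapping.lookup (\<Sum>k\<in>Poly_Mapping.keys p. Poly_Mapping.lookup p k *\<^sub>Q Poly_Mapping.single k (1::rat)) x
    = (\<Sum>k\<in>Poly_Mapping.keys p. if k = x then Poly_Mapping.lookup p k else 0)"
    by (simp add: lookup_sum scaleQ_poly_mapping.rep_eq lookup_single scaleQ_rat_def when_def if_distrib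
        cong: if_cong)
  then show "Poly_Mapping.lookup p x = Poly_Mapping.lookup (\<Sum>k\<in>Poly_Mapping.keys p.
      Poly_Mapping.lookup p k *\<^sub>Q Poly_Mapping.single k (1::rat)) x"
    by (auto simp: in_keys_iff)
qed

lemma free_induct [case_names zero step]:
  assumes "P 0" "\<And>c k p. P p \<Longrightarrow> P (c *\<^sub>Q Poly_Mapping.single k (1::rat) + p)"
  shows "P p"
proof -
  have "P (\<Sum>k\<in>X. Poly_Mapping.lookup p k *\<^sub>Q Poly_Mapping.single k (1::rat))" if "finite X" for X
    using that by (induction X) (auto simp: assms)
  then show ?thesis by (subst poly_mapping_sum_single) simp
qed

text \<open>Maps out of the quotient spaces are defined below by means of representatives, with honest
  functions as values. They are linear only up to the subspace that will be divided out.\<close>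

definition linear_mod :: "'w::rat_vector set \<Rightarrow> ('v::rat_vector \<Rightarrow> 'w) \<Rightarrow> bool" where
  "linear_mod K F \<longleftrightarrow> (\<forall>u v. F (u + v) - (F u + F v) \<in> K) \<and> (\<forall>q v. F (q *\<^sub>Q v) - q *\<^sub>Q F v \<in> K)"

lemma linear_modD:
  assumes "linear_mod K F"
  shows "F (u + v) - (F u + F v) \<in> K" "F (q *\<^sub>Q v) - q *\<^sub>Q F v \<in> K"
  using assms by (auto simp: linear_mod_def)

lemma linear_mod_zero:
  assumes "ratvec.subspace K" "linear_mod K F"
  shows "F 0 \<in> K"
  using linear_modD(2)[OF assms(2), of 0 0] by simp

lemma linear_mod_sum:
  assumes K: "ratvec.subspace K" and F: "linear_mod K F"
  shows "F (\<Sum>i\<in>X. c i *\<^sub>Q v i) - (\<Sum>i\<in>X. c i *\<^sub>Q F (v i)) \<in> K"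
proof (induction X rule: infinite_finite_induct)
  case (insert x X)
  let ?s = "\<Sum>i\<in>X. c i *\<^sub>Q v i"
  have "(F (c x *\<^sub>Q v x + ?s) - (F (c x *\<^sub>Q v x) + F ?s)) + (F (c x *\<^sub>Q v x) - c x *\<^sub>Q F (v x))
      + (F ?s - (\<Sum>i\<in>X. c i *\<^sub>Q F (v i))) \<in> K"
    using insert.IH linear_modD[OF F] K by (intro ratvec.subspace_add) auto
  then show ?case using insert by (simp add: algebra_simps)
qed (use linear_mod_zero[OF K F] in auto)

lemma subspace_cong_add:
  assumes "ratvec.subspace K" "a - b \<in> K" "c - d \<in> K"
  shows "a + c - (b + d) \<in> K"
  using ratvec.subspace_add[OF assms] by (simp add: algebra_simps)

lemma subspace_cong_scale:
  assumes "ratvec.subspace K" "a - b \<in> K"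
  shows "q *\<^sub>Q a - q *\<^sub>Q b \<in> K"
  using ratvec.subspace_scale[OF assms] by (simp add: ratvec.scale_right_diff_distrib)

lemma subspace_cong_trans:
  assumes "ratvec.subspace K" "a - b \<in> K" "b - c \<in> K"
  shows "a - c \<in> K"
  using ratvec.subspace_add[OF assms] by simp

lemma subspace_cong_sym:
  assumes "ratvec.subspace K" "a - b \<in> K"
  shows "b - a \<in> K"
  using ratvec.subspace_neg[OF assms] by simp

lemma linear_mod_add:
  assumes "ratvec.subspace K" "linear_mod K F" "linear_mod K G"
  shows "linear_mod K (\<lambda>v. F v + G v)"
  unfolding linear_mod_def
  using subspace_cong_add[OF assms(1) linear_modD(1)[OF assms(2)] linear_modD(1)[OF assms(3)]]
   subspace_cong_add[OF assms(1) linear_modD(2)[OF assms(2)] linear_modD(2)[OF assms(3)]]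
  by (simp add: algebra_simps scaleQ_add_right)

lemma linear_mod_sum_fun:
  assumes "ratvec.subspace K" "\<And>i. i \<in> X \<Longrightarrow> linear_mod K (F i)"
  shows "linear_mod K (\<lambda>v. \<Sum>i\<in>X. F i v)"
  using assms(2)
proof (induction X rule: infinite_finite_induct)
  case (insert x X)
  then show ?case using linear_mod_add[OF assms(1), of "F x" "\<lambda>v. \<Sum>i\<in>X. F i v"] by simp
qed (use assms(1) in \<open>simp_all add: linear_mod_def ratvec.subspace_0\<close>)

lemma linear_mod_cong_span:
  assumes K: "ratvec.subspace K" and F: "linear_mod K F" and G: "linear_mod K G"
    and eq: "\<And>v. v \<in> S \<Longrightarrow> F v - G v \<in> K" and v: "v \<in> ratvec.span S"
  shows "F v - G v \<in> K"
  using v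
proof (induction rule: ratvec.span_induct_alt)
  case base
  show ?case using linear_mod_zero[OF K F] linear_mod_zero[OF K G] K ratvec.subspace_diff by blast
next
  case (step c x y)
  have *: "F' (c *\<^sub>Q x + y) - (c *\<^sub>Q F' x + F' y) \<in> K" if "linear_mod K F'" for F'
    using ratvec.subspace_add[OF K linear_modD(1)[OF that, of "c *\<^sub>Q x" y] linear_modD(2)[OF that, of c x]]
    by (simp add: algebra_simps)
  have "c *\<^sub>Q F x + F y - (c *\<^sub>Q G x + G y) \<in> K"
    using step eq K by (intro subspace_cong_add subspace_cong_scale) auto
  then show ?case using *[OF F] *[OF G] K
    by (meson subspace_cong_trans subspace_cong_sym)
qed

subsection \<open>Generators of \<open>H \<otimes> \<rat>\<close> and of its squares\<close>

lemma tens_add: "tens (x + y) q = tens x q + tens y q"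
proof (transfer, goal_cases)
  case (1 x y q)
  have "pt (x + y) q - pt x q - pt y q \<in> hq_rels" unfolding hq_rels_def by (rule UnI1)+ blast
  then show ?case by (metis diff_diff_add ratvec.span_base)
qed

lemma tens_scale: "tens x (r * q) = r *\<^sub>Q tens x q"
proof (transfer, goal_cases)
  case (1 x r q)
  have "pt x (r * q) - r *\<^sub>Q pt x q \<in> hq_rels" unfolding hq_rels_def by (rule UnI2) blast
  then show ?case by (rule ratvec.span_base)
qed

lemma hq_span_tens: "(v :: 'h::ab_group_add hq) \<in> ratvec.span (range (\<lambda>x. tens x 1))"
proof -
  have "abs_hq p \<in> ratvec.span (range (\<lambda>x. tens x 1))" for p :: "('h \<times> rat) \<Rightarrow>\<^sub>0 rat"
  proof (induction p rule: free_induct)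
    case zero
    show ?case by (simp add: ratvec.span_zero flip: zero_hq.abs_eq)
  next
    case (step c k p)
    obtain x q where k: "k = (x, q)" by fastforce
    have "tens x q = q *\<^sub>Q tens x 1" using tens_scale[of x q 1] by simp
    moreover have "abs_hq (c *\<^sub>Q pt x q + p) = c *\<^sub>Q tens x q + abs_hq p"
      by (simp add: plus_hq.abs_eq scaleQ_hq.abs_eq tens.abs_eq)
    ultimately have "abs_hq (c *\<^sub>Q pt x q + p) = c *\<^sub>Q q *\<^sub>Q tens x 1 + abs_hq p" by (simp only:)
    then show ?case using step
      by (simp add: k ratvec.span_add ratvec.span_scale ratvec.span_base)
  qed
  from this[of "rep_hq v"] show ?thesis unfolding Quotient3_abs_rep[OF Quotient3_hq] .
qed

text \<open>Integer multiples are iterated sums, so a property of group elements that is stable under the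
  group operations spreads from a set to its integral span.\<close>

lemma zspan_induct_additive:
  fixes P :: "'h::ab_group_add \<Rightarrow> bool"
  assumes "x \<in> zmod.span S" "P 0" "\<And>x y. P x \<Longrightarrow> P y \<Longrightarrow> P (x + y)" "\<And>x. P x \<Longrightarrow> P (- x)"
    "\<And>x. x \<in> S \<Longrightarrow> P x"
  shows "P x"
proof -
  have s: "P (\<Sum>_<(k::nat). x)" if "P x" for x k
    using that assms(2,3) by (induction k) auto
  have "P (zscale k x)" if "P x" for k x
    unfolding zscale_def using s[OF that] assms(3,4) by (metis uminus_add_conv_diff)
  then have "zmod.subspace (Collect P)"
    using assms(2,3) by (auto intro!: zmod.subspaceI)
  then have "zmod.span S \<subseteq> Collect P" using assms(5) by (intro zmod.span_minimal) auto
  then show ?thesis using assms(1) by blast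
qed

lemma hq_span_basis:
  assumes "zbasis B"
  shows "(v :: 'h::ab_group_add hq) \<in> ratvec.span ((\<lambda>x. tens x 1) ` B)"
proof -
  let ?S = "ratvec.span ((\<lambda>x. tens x (1::rat)) ` B)"
  have zero: "tens 0 q = 0" for q using tens_add[of 0 0 q] by simp
  have "tens x 1 \<in> ?S" for x
  proof (rule zspan_induct_additive[of x B])
    show "x \<in> zmod.span B" using assms by (simp add: zbasis_def)
    show "tens (- y) 1 \<in> ?S" if "tens y 1 \<in> ?S" for y
      using that ratvec.span_neg tens_add[of y "- y" 1] zero
      by (metis add.right_inverse add_eq_0_iff)
  qed (auto simp: zero tens_add ratvec.span_zero ratvec.span_add ratvec.span_base)
  then have "ratvec.span (range (\<lambda>x. tens x 1)) \<subseteq> ?S"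
    by (intro ratvec.span_minimal) auto
  then show ?thesis using hq_span_tens by blast
qed

lemma sym2_bilin:
  "symprod (u + v) w = symprod u w + symprod v w" "symprod u (v + w) = symprod u v + symprod u w"
  "symprod (q *\<^sub>Q u) w = q *\<^sub>Q symprod u w" "symprod u (q *\<^sub>Q w) = q *\<^sub>Q symprod u w"
  "symprod u w = symprod w u"
proof -
  have "pt (u + v) w - pt u w - pt v w \<in> sym_rels"
    unfolding sym_rels_def bilin_rels_def by ((rule UnI1)+, rule CollectI, rule exI[of _ u], rule exI[of _ v], rule exI[of _ w]) (rule conjI[OF refl TrueI])
  from ratvec.span_base[OF this] show "symprod (u + v) w = symprod u w + symprod v w"
    by (simp add: symprod.abs_eq plus_sym2.abs_eq scaleQ_sym2.abs_eq sym2.abs_eq_iff diff_diff_add)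
  have "pt u (v + w) - pt u v - pt u w \<in> sym_rels" unfolding sym_rels_def bilin_rels_def by blast
  from ratvec.span_base[OF this] show "symprod u (v + w) = symprod u v + symprod u w"
    by (simp add: symprod.abs_eq plus_sym2.abs_eq scaleQ_sym2.abs_eq sym2.abs_eq_iff diff_diff_add)
  have "pt (q *\<^sub>Q u) w - q *\<^sub>Q pt u w \<in> sym_rels" unfolding sym_rels_def bilin_rels_def by blast
  from ratvec.span_base[OF this] show "symprod (q *\<^sub>Q u) w = q *\<^sub>Q symprod u w" by (simp add: symprod.abs_eq plus_sym2.abs_eq scaleQ_sym2.abs_eq sym2.abs_eq_iff diff_diff_add)
  have "pt u (q *\<^sub>Q w) - q *\<^sub>Q pt u w \<in> sym_rels" unfolding sym_rels_def bilin_rels_def by blast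
  from ratvec.span_base[OF this] show "symprod u (q *\<^sub>Q w) = q *\<^sub>Q symprod u w" by (simp add: symprod.abs_eq plus_sym2.abs_eq scaleQ_sym2.abs_eq sym2.abs_eq_iff diff_diff_add)
  have "pt u w - pt w u \<in> sym_rels" unfolding sym_rels_def by blast
  from ratvec.span_base[OF this] show "symprod u w = symprod w u" by (simp add: symprod.abs_eq plus_sym2.abs_eq scaleQ_sym2.abs_eq sym2.abs_eq_iff diff_diff_add)
qed

lemma ext2_bilin:
  "wedge (u + v) w = wedge u w + wedge v w" "wedge u (v + w) = wedge u v + wedge u w"
  "wedge (q *\<^sub>Q u) w = q *\<^sub>Q wedge u w" "wedge u (q *\<^sub>Q w) = q *\<^sub>Q wedge u w"
  "wedge u u = 0"
proof -
  have "pt (u + v) w - pt u w - pt v w \<in> alt_rels"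
    unfolding alt_rels_def bilin_rels_def by ((rule UnI1)+, rule CollectI, rule exI[of _ u], rule exI[of _ v], rule exI[of _ w]) (rule conjI[OF refl TrueI])
  from ratvec.span_base[OF this] show "wedge (u + v) w = wedge u w + wedge v w"
    by (simp add: wedge.abs_eq plus_ext2.abs_eq scaleQ_ext2.abs_eq zero_ext2.abs_eq ext2.abs_eq_iff diff_diff_add)
  have "pt u (v + w) - pt u v - pt u w \<in> alt_rels" unfolding alt_rels_def bilin_rels_def by blast
  from ratvec.span_base[OF this] show "wedge u (v + w) = wedge u v + wedge u w"
    by (simp add: wedge.abs_eq plus_ext2.abs_eq scaleQ_ext2.abs_eq zero_ext2.abs_eq ext2.abs_eq_iff diff_diff_add)
  have "pt (q *\<^sub>Q u) w - q *\<^sub>Q pt u w \<in> alt_rels" unfolding alt_rels_def bilin_rels_def by blast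
  from ratvec.span_base[OF this] show "wedge (q *\<^sub>Q u) w = q *\<^sub>Q wedge u w" by (simp add: wedge.abs_eq plus_ext2.abs_eq scaleQ_ext2.abs_eq zero_ext2.abs_eq ext2.abs_eq_iff diff_diff_add)
  have "pt u (q *\<^sub>Q w) - q *\<^sub>Q pt u w \<in> alt_rels" unfolding alt_rels_def bilin_rels_def by blast
  from ratvec.span_base[OF this] show "wedge u (q *\<^sub>Q w) = q *\<^sub>Q wedge u w" by (simp add: wedge.abs_eq plus_ext2.abs_eq scaleQ_ext2.abs_eq zero_ext2.abs_eq ext2.abs_eq_iff diff_diff_add)
  have "pt u u \<in> alt_rels" unfolding alt_rels_def by blast
  from ratvec.span_base[OF this] show "wedge u u = 0" by (simp add: wedge.abs_eq plus_ext2.abs_eq scaleQ_ext2.abs_eq zero_ext2.abs_eq ext2.abs_eq_iff diff_diff_add)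
qed

lemma wedge_anticomm: "wedge u v = - wedge v u"
proof -
  have "wedge (u + v) (u + v) = wedge u v + wedge v u"
    unfolding ext2_bilin(1,2) by (simp add: ext2_bilin(5))
  then show ?thesis by (simp add: ext2_bilin(5) eq_neg_iff_add_eq_0)
qed

lemma bilin_sum_expand:
  fixes f :: "'v::rat_vector \<Rightarrow> 'v \<Rightarrow> 'w::rat_vector"
  assumes add: "\<And>u v w. f (u + v) w = f u w + f v w" "\<And>u v w. f u (v + w) = f u v + f u w"
    and scale: "\<And>q u w. f (q *\<^sub>Q u) w = q *\<^sub>Q f u w" "\<And>q u w. f u (q *\<^sub>Q w) = q *\<^sub>Q f u w"
  shows "f (\<Sum>i\<in>I. a i *\<^sub>Q x i) (\<Sum>j\<in>J. b j *\<^sub>Q y j) = (\<Sum>i\<in>I. \<Sum>j\<in>J. (a i * b j) *\<^sub>Q f (x i) (y j))"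
proof -
  have z: "f 0 w = 0" "f w 0 = 0" for w using scale(1)[of 0 0 w] scale(2)[of w 0 0] by simp_all
  have r: "f u (\<Sum>j\<in>J. b j *\<^sub>Q y j) = (\<Sum>j\<in>J. b j *\<^sub>Q f u (y j))" for u
    by (induction J rule: infinite_finite_induct) (simp_all add: z add scale)
  have l: "f (\<Sum>i\<in>I. a i *\<^sub>Q x i) w = (\<Sum>i\<in>I. a i *\<^sub>Q f (x i) w)" for w
    by (induction I rule: infinite_finite_induct) (simp_all add: z add scale)
  show ?thesis unfolding l by (simp add: r ratvec.scale_sum_right scaleQ_scaleQ)
qed

lemma sym2_span: "(u :: 'v::rat_vector sym2) \<in> ratvec.span {symprod v w | v w. True}"
proof -
  have "abs_sym2 p \<in> ratvec.span {symprod v w | v w. True}" for p :: "('v \<times> 'v) \<Rightarrow>\<^sub>0 rat"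
  proof (induction p rule: free_induct)
    case zero
    show ?case by (simp add: ratvec.span_zero flip: zero_sym2.abs_eq)
  next
    case (step c k p)
    have "abs_sym2 (c *\<^sub>Q pt (fst k) (snd k) + p) = c *\<^sub>Q symprod (fst k) (snd k) + abs_sym2 p"
      by (simp add: plus_sym2.abs_eq scaleQ_sym2.abs_eq symprod.abs_eq)
    moreover have "symprod (fst k) (snd k) \<in> {symprod v w | v w. True}" by blast
    ultimately show ?case using step
      by (simp add: ratvec.span_add ratvec.span_scale ratvec.span_base)
  qed
  from this[of "rep_sym2 u"] show ?thesis unfolding Quotient3_abs_rep[OF Quotient3_sym2] .
qed

lemma ext2_span: "(u :: 'v::rat_vector ext2) \<in> ratvec.span {wedge v w | v w. True}"
proof -
  have "abs_ext2 p \<in> ratvec.span {wedge v w | v w. True}" for p :: "('v \<times> 'v) \<Rightarrow>\<^sub>0 rat"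
  proof (induction p rule: free_induct)
    case zero
    show ?case by (simp add: ratvec.span_zero flip: zero_ext2.abs_eq)
  next
    case (step c k p)
    have "abs_ext2 (c *\<^sub>Q pt (fst k) (snd k) + p) = c *\<^sub>Q wedge (fst k) (snd k) + abs_ext2 p"
      by (simp add: plus_ext2.abs_eq scaleQ_ext2.abs_eq wedge.abs_eq)
    moreover have "wedge (fst k) (snd k) \<in> {wedge v w | v w. True}" by blast
    ultimately show ?case using step
      by (simp add: ratvec.span_add ratvec.span_scale ratvec.span_base)
  qed
  from this[of "rep_ext2 u"] show ?thesis unfolding Quotient3_abs_rep[OF Quotient3_ext2] .
qed

lemma hq_coords:
  assumes B: "zbasis B" "finite B"
  obtains c where "(v :: 'h::ab_group_add hq) = (\<Sum>b\<in>B. c b *\<^sub>Q tens b 1)"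
proof -
  have "ratvec.span ((\<lambda>x. tens x 1) ` B) \<subseteq> {\<Sum>b\<in>B. c b *\<^sub>Q tens b 1 | c. True}" (is "_ \<subseteq> ?T")
  proof (rule ratvec.span_minimal)
    show "(\<lambda>x. tens x 1) ` B \<subseteq> ?T"
    proof clarify
      fix x assume "x \<in> B"
      then have "tens x 1 = (\<Sum>b\<in>B. (if b = x then 1 else 0) *\<^sub>Q tens b 1)"
        using B(2) by (simp add: if_distrib[of "\<lambda>q. q *\<^sub>Q _"] cong: if_cong)
      then show "\<exists>c. tens x 1 = (\<Sum>b\<in>B. c b *\<^sub>Q tens b 1) \<and> True"
        by (intro exI[of _ "\<lambda>b. if b = x then 1 else 0"]) simp
    qed
    show "ratvec.subspace ?T"
    proof (rule ratvec.subspaceI)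
      show "0 \<in> ?T" by (auto intro!: exI[of _ "\<lambda>_. 0"])
    next
      fix x y assume "x \<in> ?T" "y \<in> ?T"
      then obtain c d where "x = (\<Sum>b\<in>B. c b *\<^sub>Q tens b 1)" "y = (\<Sum>b\<in>B. d b *\<^sub>Q tens b 1)" by auto
      then show "x + y \<in> ?T"
        by (auto intro!: exI[of _ "\<lambda>b. c b + d b"] simp: scaleQ_add_left sum.distrib)
    next
      fix q x assume "x \<in> ?T"
      then obtain c where "x = (\<Sum>b\<in>B. c b *\<^sub>Q tens b 1)" by auto
      then show "q *\<^sub>Q x \<in> ?T"
        by (auto intro!: exI[of _ "\<lambda>b. q * c b"] simp: scaleQ_scaleQ ratvec.scale_sum_right)
    qed
  qed
  then show ?thesis using hq_span_basis[OF B(1), of v] that by auto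
qed

text \<open>Expanding in the basis gives some coefficient matrix; averaging it with \<open>\<epsilon>\<close> times its
  transpose does not change the element. With \<open>\<epsilon> = 1\<close> this is used for the symmetric square, with
  \<open>\<epsilon> = -1\<close> for the exterior square.\<close>

lemma square_coords:
  fixes f :: "'h::ab_group_add hq \<Rightarrow> 'h hq \<Rightarrow> 'w::rat_vector"
  assumes B: "zbasis B" "finite B"
    and bil: "\<And>u v w. f (u + v) w = f u w + f v w" "\<And>u v w. f u (v + w) = f u v + f u w"
      "\<And>q u w. f (q *\<^sub>Q u) w = q *\<^sub>Q f u w" "\<And>q u w. f u (q *\<^sub>Q w) = q *\<^sub>Q f u w"
    and sym: "\<And>u v. f u v = \<epsilon> *\<^sub>Q f v u" and \<epsilon>: "\<epsilon> * \<epsilon> = 1"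
    and u: "u \<in> ratvec.span {f v w | v w. True}"
  obtains c where "u = (\<Sum>p\<in>B. \<Sum>q\<in>B. c p q *\<^sub>Q f (tens p 1) (tens q 1))" "\<And>p q. c p q = \<epsilon> * c q p"
proof -
  let ?e = "\<lambda>c. \<Sum>p\<in>B. \<Sum>q\<in>B. c p q *\<^sub>Q f (tens p 1) (tens q 1)"
  let ?T = "{?e c | c. \<forall>p q. c p q = \<epsilon> * c q p}"
  have swap: "?e (\<lambda>p q. \<epsilon> * c q p) = ?e c" for c
  proof -
    have "?e (\<lambda>p q. \<epsilon> * c q p) = (\<Sum>p\<in>B. \<Sum>q\<in>B. c q p *\<^sub>Q f (tens q 1) (tens p 1))"
      by (intro sum.cong refl, subst sym) (simp add: scaleQ_scaleQ algebra_simps \<epsilon>)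
    also have "\<dots> = ?e c" by (rule sum.swap)
    finally show ?thesis .
  qed
  have "ratvec.span {f v w | v w. True} \<subseteq> ?T"
  proof (rule ratvec.span_minimal)
    show "{f v w | v w. True} \<subseteq> ?T"
    proof clarify
      fix v w
      obtain a b where a: "v = (\<Sum>b\<in>B. a b *\<^sub>Q tens b 1)" and b: "w = (\<Sum>p\<in>B. b p *\<^sub>Q tens p 1)"
        using hq_coords[OF B] by metis
      let ?c = "\<lambda>p q. a p * b q"
      let ?d = "\<lambda>p q. (1/2) * (?c p q + \<epsilon> * ?c q p)"
      have "?e ?d = (1/2) *\<^sub>Q (?e ?c + ?e (\<lambda>p q. \<epsilon> * ?c q p))"
        by (simp add: ratvec.scale_sum_right scaleQ_scaleQ scaleQ_add_left sum.distrib distrib_left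
            scaleQ_add_right)
      also have "\<dots> = ?e ?c"
        unfolding swap scaleQ_add_right by (simp flip: scaleQ_add_left add: scaleQ_one)
      also have "\<dots> = f v w" unfolding a b by (rule bilin_sum_expand[symmetric]) (fact bil)+
      finally have eq: "f v w = ?e ?d" ..
      have "\<epsilon> * (\<epsilon> * x) = x" for x using \<epsilon> by (simp flip: mult.assoc)
      then have "(1/2) * (x + \<epsilon> * y) = \<epsilon> * ((1/2) * (y + \<epsilon> * x))" for x y
        by (simp add: distrib_left)
      then have "\<forall>p q. ?d p q = \<epsilon> * ?d q p" by blast
      from eq this show "\<exists>c. f v w = ?e c \<and> (\<forall>p q. c p q = \<epsilon> * c q p)"
        by (rule exI[of _ ?d, OF conjI])
    qed
    show "ratvec.subspace ?T"
    proof (rule ratvec.subspaceI)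
      show "0 \<in> ?T" by (auto intro!: exI[of _ "\<lambda>_ _. 0"])
    next
      fix x y assume "x \<in> ?T" "y \<in> ?T"
      then obtain c d where e: "x = ?e c" "y = ?e d"
        and c: "\<forall>p q. c p q = \<epsilon> * c q p" and d: "\<forall>p q. d p q = \<epsilon> * d q p"
        unfolding mem_Collect_eq by (elim exE conjE)
      have "x + y = ?e (\<lambda>p q. c p q + d p q)"
        unfolding e by (simp add: scaleQ_add_left sum.distrib)
      moreover have "\<forall>p q. c p q + d p q = \<epsilon> * (c q p + d q p)"
        using c d by (metis distrib_left)
      ultimately show "x + y \<in> ?T" by (intro CollectI exI[of _ "\<lambda>p q. c p q + d p q"] conjI)
    next
      fix q x assume "x \<in> ?T"
      then obtain c where e: "x = ?e c" and c: "\<forall>p q. c p q = \<epsilon> * c q p"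
        unfolding mem_Collect_eq by (elim exE conjE)
      have "q *\<^sub>Q x = ?e (\<lambda>p r. q * c p r)"
        unfolding e by (simp add: scaleQ_scaleQ ratvec.scale_sum_right)
      moreover have "\<forall>p r. q * c p r = \<epsilon> * (q * c r p)"
        using c by (metis mult.left_commute)
      ultimately show "q *\<^sub>Q x \<in> ?T" by (intro CollectI exI[of _ "\<lambda>p r. q * c p r"] conjI)
    qed
  qed
  then have "u \<in> ?T" using u by (rule subsetD)
  then obtain c where "u = ?e c" "\<forall>p q. c p q = \<epsilon> * c q p" unfolding mem_Collect_eq by (elim exE conjE)
  then show ?thesis by (intro that[of c]) blast+
qed

subsection \<open>Descent of linear extensions\<close>

text \<open>A map on generators that respects the relations modulo \<open>K\<close> is extended to the quotient by
  means of a choice of representatives; the choice matters only modulo \<open>K\<close>.\<close>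

lemma lin_ext_descends_hq:
  fixes g :: "'h::ab_group_add \<times> rat \<Rightarrow> 'w::rat_vector"
  assumes K: "ratvec.subspace K" and rels: "\<And>r. r \<in> hq_rels \<Longrightarrow> lin_ext g r \<in> K"
  shows "linear_mod K (\<lambda>v. lin_ext g (rep_hq v))" "lin_ext g (rep_hq (tens x q)) - g (x, q) \<in> K"
proof -
  have abs_rep: "abs_hq (rep_hq v) = v" for v :: "'h hq" by (rule Quotient3_abs_rep[OF Quotient3_hq])
  have *: "lin_ext g (rep_hq v) - lin_ext g p \<in> K" if "v = abs_hq p" for v :: "'h hq" and p
  proof -
    have "rep_hq v - p \<in> ratvec.span hq_rels"
      using that abs_rep[of v] by (simp flip: hq.abs_eq_iff)
    then show ?thesis using lin_ext_span[OF K rels] by (simp flip: lin_ext_diff)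
  qed
  show "linear_mod K (\<lambda>v. lin_ext g (rep_hq v))"
    unfolding linear_mod_def
  proof (intro conjI allI)
    fix u v :: "'h hq"
    have "u + v = abs_hq (rep_hq u + rep_hq v)" by (simp add: abs_rep flip: plus_hq.abs_eq)
    from *[OF this] show "lin_ext g (rep_hq (u + v)) - (lin_ext g (rep_hq u) + lin_ext g (rep_hq v)) \<in> K"
      by (simp add: lin_ext_add)
  next
    fix r and v :: "'h hq"
    have "r *\<^sub>Q v = abs_hq (r *\<^sub>Q rep_hq v)" by (simp add: abs_rep flip: scaleQ_hq.abs_eq)
    from *[OF this] show "lin_ext g (rep_hq (r *\<^sub>Q v)) - r *\<^sub>Q lin_ext g (rep_hq v) \<in> K"
      by (simp add: lin_ext_scale)
  qed
  from *[OF tens.abs_eq] show "lin_ext g (rep_hq (tens x q)) - g (x, q) \<in> K" by (simp add: scaleQ_one)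
qed

lemma lin_ext_descends_sym2:
  fixes g :: "'v::rat_vector \<times> 'v \<Rightarrow> 'w::rat_vector"
  assumes K: "ratvec.subspace K" and rels: "\<And>r. r \<in> sym_rels \<Longrightarrow> lin_ext g r \<in> K"
  shows "linear_mod K (\<lambda>v. lin_ext g (rep_sym2 v))" "lin_ext g (rep_sym2 (symprod x q)) - g (x, q) \<in> K"
proof -
  have abs_rep: "abs_sym2 (rep_sym2 v) = v" for v :: "'v sym2" by (rule Quotient3_abs_rep[OF Quotient3_sym2])
  have *: "lin_ext g (rep_sym2 v) - lin_ext g p \<in> K" if "v = abs_sym2 p" for v :: "'v sym2" and p
  proof -
    have "rep_sym2 v - p \<in> ratvec.span sym_rels"
      using that abs_rep[of v] by (simp flip: sym2.abs_eq_iff)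
    then show ?thesis using lin_ext_span[OF K rels] by (simp flip: lin_ext_diff)
  qed
  show "linear_mod K (\<lambda>v. lin_ext g (rep_sym2 v))"
    unfolding linear_mod_def
  proof (intro conjI allI)
    fix u v :: "'v sym2"
    have "u + v = abs_sym2 (rep_sym2 u + rep_sym2 v)" by (simp add: abs_rep flip: plus_sym2.abs_eq)
    from *[OF this] show "lin_ext g (rep_sym2 (u + v)) - (lin_ext g (rep_sym2 u) + lin_ext g (rep_sym2 v)) \<in> K"
      by (simp add: lin_ext_add)
  next
    fix r and v :: "'v sym2"
    have "r *\<^sub>Q v = abs_sym2 (r *\<^sub>Q rep_sym2 v)" by (simp add: abs_rep flip: scaleQ_sym2.abs_eq)
    from *[OF this] show "lin_ext g (rep_sym2 (r *\<^sub>Q v)) - r *\<^sub>Q lin_ext g (rep_sym2 v) \<in> K"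
      by (simp add: lin_ext_scale)
  qed
  from *[OF symprod.abs_eq] show "lin_ext g (rep_sym2 (symprod x q)) - g (x, q) \<in> K" by (simp add: scaleQ_one)
qed

lemma lin_ext_descends_ext2:
  fixes g :: "'v::rat_vector \<times> 'v \<Rightarrow> 'w::rat_vector"
  assumes K: "ratvec.subspace K" and rels: "\<And>r. r \<in> alt_rels \<Longrightarrow> lin_ext g r \<in> K"
  shows "linear_mod K (\<lambda>v. lin_ext g (rep_ext2 v))" "lin_ext g (rep_ext2 (wedge x q)) - g (x, q) \<in> K"
proof -
  have abs_rep: "abs_ext2 (rep_ext2 v) = v" for v :: "'v ext2" by (rule Quotient3_abs_rep[OF Quotient3_ext2])
  have *: "lin_ext g (rep_ext2 v) - lin_ext g p \<in> K" if "v = abs_ext2 p" for v :: "'v ext2" and p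
  proof -
    have "rep_ext2 v - p \<in> ratvec.span alt_rels"
      using that abs_rep[of v] by (simp flip: ext2.abs_eq_iff)
    then show ?thesis using lin_ext_span[OF K rels] by (simp flip: lin_ext_diff)
  qed
  show "linear_mod K (\<lambda>v. lin_ext g (rep_ext2 v))"
    unfolding linear_mod_def
  proof (intro conjI allI)
    fix u v :: "'v ext2"
    have "u + v = abs_ext2 (rep_ext2 u + rep_ext2 v)" by (simp add: abs_rep flip: plus_ext2.abs_eq)
    from *[OF this] show "lin_ext g (rep_ext2 (u + v)) - (lin_ext g (rep_ext2 u) + lin_ext g (rep_ext2 v)) \<in> K"
      by (simp add: lin_ext_add)
  next
    fix r and v :: "'v ext2"
    have "r *\<^sub>Q v = abs_ext2 (r *\<^sub>Q rep_ext2 v)" by (simp add: abs_rep flip: scaleQ_ext2.abs_eq)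
    from *[OF this] show "lin_ext g (rep_ext2 (r *\<^sub>Q v)) - r *\<^sub>Q lin_ext g (rep_ext2 v) \<in> K"
      by (simp add: lin_ext_scale)
  qed
  from *[OF wedge.abs_eq] show "lin_ext g (rep_ext2 (wedge x q)) - g (x, q) \<in> K" by (simp add: scaleQ_one)
qed

lemma lin_ext_in_subspace:
  assumes "ratvec.subspace K" "\<And>k. g k \<in> K"
  shows "lin_ext g p \<in> K"
  unfolding lin_ext_def using assms by (intro ratvec.subspace_sum ratvec.subspace_scale) auto

lemma square_act_linear:
  "sym2_act (u + v) \<sigma> = sym2_act u \<sigma> + sym2_act v \<sigma>" "sym2_act (q *\<^sub>Q u) \<sigma> = q *\<^sub>Q sym2_act u \<sigma>"
  "ext2_act (u' + v') \<sigma> = ext2_act u' \<sigma> + ext2_act v' \<sigma>" "ext2_act (q *\<^sub>Q u') \<sigma> = q *\<^sub>Q ext2_act u' \<sigma>"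
  by (transfer; simp add: free_map_add free_map_scale ratvec.span_zero)+

section \<open>The coordinate algebra and its augmentation ideal\<close>

lemma coord_alg_subalgebra: "subalgebra coord_alg"
  unfolding coord_alg_def by (rule subalgebra_hull)

lemma acoef_in_coord_alg: "acoef i j x \<in> coord_alg"
  unfolding coord_alg_def by (rule hull_inc) blast

lemma scoef_in_coord_alg: "scoef i j x \<in> coord_alg"
proof -
  note R = subalgebraD[OF coord_alg_subalgebra]
  have "(if i = j then 1 else 0) \<in> (coord_alg :: (('a, 'b) slrep \<Rightarrow> complex) set)"
    using R(2) ratvec.subspace_0[OF R(1)] by auto
  then show ?thesis unfolding scoef_def
    by (rule ratvec.subspace_diff[OF R(1) acoef_in_coord_alg])
qed

lemma J_ideal_is_ideal: "is_ideal coord_alg (J_ideal B)"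
  unfolding J_ideal_def
  by (rule ideal_hull_is_ideal[OF coord_alg_subalgebra]) (use scoef_in_coord_alg in blast)

lemma apply_rep_add: "apply_rep \<rho> (x + y) = apply_rep \<rho> x ** apply_rep \<rho> y"
  using apply_rep[of \<rho>] by simp

lemma apply_rep_det: "det (apply_rep \<rho> x) = 1"
  using apply_rep[of \<rho>] by simp

lemma apply_rep_zero: "apply_rep \<rho> 0 = mat 1"
proof -
  have "invertible (apply_rep \<rho> 0)" by (simp add: invertible_det_nz apply_rep_det)
  moreover have "apply_rep \<rho> 0 ** apply_rep \<rho> 0 = apply_rep \<rho> 0 ** mat 1"
    using apply_rep_add[of \<rho> 0 0] by simp
  ultimately show ?thesis by (metis invertible_def matrix_mul_assoc matrix_mul_lid)
qed

lemma apply_rep_scoef: "apply_rep \<rho> x $ i $ j = (if i = j then 1 else 0) + scoef i j x \<rho>"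
  by (simp add: scoef_def acoef_def)

lemma scoef_zero: "scoef i j 0 = 0"
  by (rule ext) (simp add: scoef_def acoef_def apply_rep_zero mat_def)

lemma sum_fun_apply: "sum f X x = (\<Sum>k\<in>X. f k x)" for f :: "'k \<Rightarrow> 'x \<Rightarrow> 'r::comm_monoid_add"
  by (induction X rule: infinite_finite_induct) simp_all

lemma prod_fun_apply: "prod f X x = (\<Prod>k\<in>X. f k x)" for f :: "'k \<Rightarrow> 'x \<Rightarrow> 'r::comm_monoid_mult"
  by (induction X rule: infinite_finite_induct) simp_all

text \<open>Writing \<open>\<rho> = 1 + S\<close>, multiplicativity of \<open>\<rho>\<close> becomes \<open>S(x + y) = S(x) + S(y) + S(x) S(y)\<close>. So
  the entries of \<open>S\<close> are additive to first order, and \<open>S(x)\<close>, \<open>S(y)\<close> commute.\<close>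

lemma scoef_add:
  "scoef i j (x + y) = scoef i j x + scoef i j y + (\<Sum>k\<in>UNIV. scoef i k x * scoef k j y)"
proof
  fix \<rho> :: "('a, 'b) slrep"
  let ?d = "\<lambda>i j. if i = j then 1 else (0::complex)"
  have "apply_rep \<rho> (x + y) $ i $ j = (\<Sum>k\<in>UNIV. (?d i k + scoef i k x \<rho>) * (?d k j + scoef k j y \<rho>))"
    by (simp only: apply_rep_add matrix_matrix_mult_def vec_lambda_beta apply_rep_scoef)
  also have "\<dots> = (\<Sum>k\<in>UNIV. ?d i k * ?d k j) + (\<Sum>k\<in>UNIV. ?d i k * scoef k j y \<rho>)
      + (\<Sum>k\<in>UNIV. scoef i k x \<rho> * ?d k j) + (\<Sum>k\<in>UNIV. scoef i k x \<rho> * scoef k j y \<rho>)"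
    by (simp only: distrib_left distrib_right sum.distrib add_ac)
  also have "\<dots> = ?d i j + scoef i j y \<rho> + scoef i j x \<rho> + (\<Sum>k\<in>UNIV. scoef i k x \<rho> * scoef k j y \<rho>)"
    by (simp add: if_distrib[of "\<lambda>c. c * _"] if_distrib[of "\<lambda>c. _ * c"] cong: if_cong)
  finally show "scoef i j (x + y) \<rho>
      = (scoef i j x + scoef i j y + (\<Sum>k\<in>UNIV. scoef i k x * scoef k j y)) \<rho>"
    by (simp add: apply_rep_scoef sum_fun_apply)
qed

lemma scoef_commutator:
  "(\<Sum>k\<in>UNIV. scoef i k x * scoef k j y) = (\<Sum>k\<in>UNIV. scoef i k y * scoef k j x)"
  using scoef_add[of i j x y] scoef_add[of i j y x] by (simp add: add.commute[of x y] add.commute[of "scoef i j x"])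

definition entry :: "'m \<times> 'm \<Rightarrow> 'h::ab_group_add \<Rightarrow> ('h, 'm::finite) slrep \<Rightarrow> complex" where
  "entry a x = scoef (fst a) (snd a) x"

lemma fun_act_scoef: "fun_act (scoef i j x) \<sigma> = scoef i j (apply_aut \<sigma> x)"
  by (rule ext) (simp add: scoef_def fun_act_def acoef_def rep_act.rep_eq)

text \<open>The index \<open>z\<close> is an arbitrary choice. It marks the diagonal entry that is expressed by the others
  by means of the trace.\<close>

locale free_abelian =
  fixes B :: "'h::ab_group_add set" and z :: "'m::finite"
  assumes basis: "zbasis B" and finite_basis: "finite B"
begin

abbreviation R :: "(('h, 'm) slrep \<Rightarrow> complex) set" where "R \<equiv> coord_alg"
abbreviation J :: "nat \<Rightarrow> (('h, 'm) slrep \<Rightarrow> complex) set" where "J \<equiv> J_power B"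
abbreviation "J1 \<equiv> J (Suc 0)"
abbreviation "J2 \<equiv> J (Suc (Suc 0))"
abbreviation "J3 \<equiv> J (Suc (Suc (Suc 0)))"

lemma J_is_ideal: "is_ideal R (J k)"
  by (rule ideal_power_is_ideal[OF coord_alg_subalgebra J_ideal_is_ideal])

lemma J_subspace: "ratvec.subspace (J k)"
  by (rule ideal_subspace[OF coord_alg_subalgebra J_is_ideal])

lemma J_one: "J1 = J_ideal B"
  by (rule ideal_power_one[OF coord_alg_subalgebra J_ideal_is_ideal])

lemma J_mult: "f \<in> J k \<Longrightarrow> g \<in> J1 \<Longrightarrow> f * g \<in> J (Suc k)"
  unfolding J_one by (rule ideal_power_mult)

lemma J_mult': "f \<in> J1 \<Longrightarrow> g \<in> J k \<Longrightarrow> f * g \<in> J (Suc k)"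
  using J_mult[of g k f] by (simp add: mult.commute)

declare ideal_power.simps(2) [simp del]

text \<open>The generators of the ideal involve the basis only, but the ideal contains all \<open>s\<^sub>i\<^sub>j(x)\<close>; hence it
  depends on \<open>H\<close> alone and is stable under automorphisms.\<close>

lemma scoef_in_J: "scoef i j x \<in> J1"
proof -
  note Rs = subalgebraD(1)[OF coord_alg_subalgebra]
  have "\<forall>i j. scoef i j x \<in> J1"
  proof (rule zspan_induct_additive[of x B])
    show "x \<in> zmod.span B" using basis by (simp add: zbasis_def)
    show "\<forall>i j. scoef i j b \<in> J1" if "b \<in> B" for b
    proof -
      have "scoef i j b \<in> J_ideal B" for i j :: 'm
        unfolding J_ideal_def using that by (intro hull_inc) blast
      then show ?thesis by (simp add: J_one)
    qed
    show "\<forall>i j. scoef i j (y + z) \<in> J1"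
      if "\<forall>i j. scoef i j y \<in> J1" "\<forall>i j. scoef i j z \<in> J1" for y z
      unfolding scoef_add using that
      by (intro allI ratvec.subspace_add[OF J_subspace] ratvec.subspace_sum[OF J_subspace]
          idealD(4)[OF J_is_ideal] scoef_in_coord_alg) auto
    show "\<forall>i j. scoef i j (- y) \<in> J1" if y: "\<forall>i j. scoef i j y \<in> J1" for y
    proof (intro allI)
      fix i j :: 'm
      have eq: "scoef i j (- y) = - (scoef i j y + (\<Sum>k\<in>UNIV. scoef i k y * scoef k j (- y)))"
        using scoef_add[of i j y "- y"] by (simp add: scoef_zero eq_neg_iff_add_eq_0 algebra_simps)
      show "scoef i j (- y) \<in> J1"
        unfolding eq using y
        by (intro ratvec.subspace_neg[OF J_subspace] ratvec.subspace_add[OF J_subspace]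
            ratvec.subspace_sum[OF J_subspace] idealD(5)[OF J_is_ideal] scoef_in_coord_alg) auto
    qed
    show "\<forall>i j. scoef i j 0 \<in> J1"
      unfolding scoef_zero using ratvec.subspace_0[OF J_subspace] by blast
  qed
  then show ?thesis by blast
qed

lemma entry_in_J: "entry a x \<in> J1"
  by (simp add: entry_def scoef_in_J)

text \<open>The condition \<open>det (1 + S) = 1\<close>, to first order.\<close>

lemma trace_in_J2: "(\<Sum>i\<in>UNIV. entry (i, i) x) \<in> J2"
proof -
  note R = subalgebraD[OF coord_alg_subalgebra]
  let ?M = "(\<chi> i j. (if i = j then 1 else 0) + scoef i j x) :: (('h, 'm) slrep \<Rightarrow> complex)^'m^'m"
  have "det ?M = 1"
  proof
    fix \<rho>
    have "(of_int (sign p) :: ('h, 'm) slrep \<Rightarrow> complex) \<rho> = of_int (sign p)" for p :: "'m \<Rightarrow> 'm"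
      by (cases p rule: sign_cases) simp_all
    then have "det ?M \<rho> = det (apply_rep \<rho> x)"
      by (simp add: det_def sum_fun_apply prod_fun_apply apply_rep_scoef if_distrib[of "\<lambda>f. f _"] cong: if_cong)
    then show "det ?M \<rho> = 1 \<rho>" by (simp add: apply_rep_det)
  qed
  moreover have "det ?M - 1 - (\<Sum>i\<in>UNIV. (\<chi> i j. scoef i j x) $ i $ i) \<in> J2"
  proof (rule det_one_plus[where A = R and I = "J1"])
    show "J1 \<subseteq> R" by (rule idealD(1)[OF J_is_ideal])
    show "(\<chi> i j. scoef i j x) $ i $ j \<in> J1" for i j by (simp add: scoef_in_J)
    show "f * g \<in> J2" if "f \<in> J1" "g \<in> J1" for f g
      using that by (rule J_mult)
    show "f * g \<in> J2" if "f \<in> R" "g \<in> J2" for f g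
      using that by (rule idealD(4)[OF J_is_ideal])
  qed (use ratvec.subspace_0[OF J_subspace] ratvec.subspace_add[OF J_subspace]
      ratvec.subspace_neg[OF J_subspace] ratvec.subspace_add[OF R(1)] R(2,3) in simp_all)
  ultimately have "- (\<Sum>i\<in>UNIV. entry (i, i) x) \<in> J2" by (simp add: entry_def)
  from ratvec.subspace_neg[OF J_subspace this] show ?thesis by simp
qed

lemma entry_add: "entry a (x + y) - (entry a x + entry a y) \<in> J2"
proof -
  have "(\<Sum>k\<in>UNIV. scoef (fst a) k x * scoef k (snd a) y) \<in> J2"
    by (intro ratvec.subspace_sum[OF J_subspace] J_mult scoef_in_J)
  then show ?thesis by (simp add: entry_def scoef_add)
qed

lemma fun_act_J: "f \<in> J k \<Longrightarrow> fun_act f \<sigma> \<in> J k"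
proof -
  have 0: "fun_act 0 \<sigma> = 0" for \<sigma> :: "'h aut" by (simp add: fun_act_def fun_eq_iff)
  note [simp] = fun_act_algebra_hom 0
  note R = subalgebraD[OF coord_alg_subalgebra]
  have act_R: "fun_act f \<sigma> \<in> R" if "f \<in> R" for f
  proof -
    have "subalgebra {f. fun_act f \<sigma> \<in> R}"
      unfolding subalgebra_def
      by (auto intro!: ratvec.subspaceI simp: R ratvec.subspace_0 ratvec.subspace_add ratvec.subspace_scale)
    then have "subalgebra hull {acoef i j x | i j x. True} \<subseteq> {f. fun_act f \<sigma> \<in> R}"
      by (intro hull_minimal) (auto simp: fun_act_acoef acoef_in_coord_alg)
    then show ?thesis using that unfolding coord_alg_def by blast
  qed
  have ideal: "is_ideal R {f \<in> R. fun_act f \<sigma> \<in> J k}" for k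
    using idealD[OF J_is_ideal[of k]] act_R R
    by (auto simp: is_ideal_def ratvec.subspace_0 ratvec.subspace_add[OF R(1)])
  have act_J1: "fun_act f \<sigma> \<in> J1" if "f \<in> J1" for f
  proof -
    have "is_ideal R hull {scoef i j x | i j x. x \<in> B} \<subseteq> {f \<in> R. fun_act f \<sigma> \<in> J1}"
      by (intro hull_minimal ideal) (auto simp: fun_act_scoef scoef_in_J scoef_in_coord_alg)
    then have "J_ideal B \<subseteq> {f \<in> R. fun_act f \<sigma> \<in> J1}" by (simp only: J_ideal_def)
    then show ?thesis using that unfolding J_one by blast
  qed
  show "f \<in> J k \<Longrightarrow> fun_act f \<sigma> \<in> J k"
  proof (induction k arbitrary: f)
    case 0
    then show ?case using act_R by simp
  next
    case (Suc k)
    have "fun_act (f * g) \<sigma> \<in> J (Suc k)" "f * g \<in> R" if "f \<in> J k" "g \<in> J_ideal B" for f g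
      using that J_mult[OF Suc.IH act_J1]
        R(3)[OF subsetD[OF idealD(1)[OF J_is_ideal]] subsetD[OF idealD(1)[OF J_ideal_is_ideal]]]
      by (auto simp: J_one)
    then have "is_ideal R hull {f * g |f g. f \<in> J k \<and> g \<in> J_ideal B}
        \<subseteq> {f \<in> R. fun_act f \<sigma> \<in> J (Suc k)}"
      by (intro hull_minimal ideal) blast
    then show ?case using Suc.prems by (auto simp: ideal_power.simps(2)[of _ _ k])
  qed
qed

end

section \<open>Products of two entries as maps on the symmetric and exterior square\<close>

text \<open>A product of two entries, symmetrised or antisymmetrised, depends bilinearly on the two
  elements of \<open>H\<close> modulo \<open>J\<^sup>3\<close>, and so is a function on the symmetric or exterior square. The
  values rely on the choice of representatives; what they are modulo \<open>J\<^sup>2\<close> (for \<open>entry_hq\<close>) and \<open>J\<^sup>3\<close>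
  (for the other two) does not.\<close>

definition entry_hq :: "'m \<times> 'm \<Rightarrow> 'h::ab_group_add hq \<Rightarrow> ('h, 'm::finite) slrep \<Rightarrow> complex" where
  "entry_hq a v = lin_ext (\<lambda>(x, q). q *\<^sub>Q entry a x) (rep_hq v)"

definition sym_entries :: "'m \<times> 'm \<Rightarrow> 'm \<times> 'm \<Rightarrow> 'h::ab_group_add hq sym2 \<Rightarrow>
    ('h, 'm::finite) slrep \<Rightarrow> complex" where
  "sym_entries a b u = lin_ext (\<lambda>(v, w). entry_hq a v * entry_hq b w + entry_hq b v * entry_hq a w) (rep_sym2 u)"

definition alt_entries :: "'m \<times> 'm \<Rightarrow> 'm \<times> 'm \<Rightarrow> 'h::ab_group_add hq ext2 \<Rightarrow>
    ('h, 'm::finite) slrep \<Rightarrow> complex" where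
  "alt_entries a b u = lin_ext (\<lambda>(v, w). entry_hq a v * entry_hq b w - entry_hq b v * entry_hq a w) (rep_ext2 u)"

context free_abelian
begin

lemmas J_cong_add = subspace_cong_add[OF J_subspace]
lemmas J_cong_scale = subspace_cong_scale[OF J_subspace]
lemmas J_cong_trans = subspace_cong_trans[OF J_subspace]
lemmas J_cong_sym = subspace_cong_sym[OF J_subspace]

lemma J_cong_diff: "a - b \<in> J k \<Longrightarrow> c - d \<in> J k \<Longrightarrow> a - c - (b - d) \<in> J k"
  using ratvec.subspace_diff[OF J_subspace, of "a - b" k "c - d"] by (simp add: algebra_simps)

lemma J_cong_mult:
  assumes "f - f' \<in> J2" "g - g' \<in> J2" "f \<in> J1" "g' \<in> J1"
  shows "f * g - f' * g' \<in> J3"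
proof -
  have "f * (g - g') + (f - f') * g' \<in> J3"
    using assms by (intro ratvec.subspace_add[OF J_subspace] J_mult J_mult')
  then show ?thesis by (simp add: algebra_simps)
qed

lemma entry_hq_rels: "r \<in> hq_rels \<Longrightarrow> lin_ext (\<lambda>(x, q). q *\<^sub>Q entry a x) r \<in> J2"
proof -
  have "q *\<^sub>Q entry a (x + y) - q *\<^sub>Q entry a x - q *\<^sub>Q entry a y \<in> J2" for q x y
    using ratvec.subspace_scale[OF J_subspace entry_add, of q a x y]
    by (simp add: ratvec.scale_right_diff_distrib scaleQ_add_right algebra_simps)
  then show "r \<in> hq_rels \<Longrightarrow> lin_ext (\<lambda>(x, q). q *\<^sub>Q entry a x) r \<in> J2"
    by (auto simp: hq_rels_def lin_ext_diff lin_ext_scale scaleQ_scaleQ scaleQ_add_left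
        ratvec.subspace_0[OF J_subspace])
qed

lemma entry_hq_linear: "linear_mod J2 (entry_hq a)"
  unfolding entry_hq_def[abs_def] by (rule lin_ext_descends_hq(1)[OF J_subspace entry_hq_rels])

lemma entry_hq_tens: "entry_hq a (tens x 1) - entry a x \<in> J2"
  using lin_ext_descends_hq(2)[OF J_subspace entry_hq_rels[where a = a], of x 1]
  by (simp add: entry_hq_def)

lemma entry_hq_in_J: "entry_hq a v \<in> J1"
  unfolding entry_hq_def
  by (rule lin_ext_in_subspace[OF J_subspace])
    (auto simp: entry_in_J ratvec.subspace_scale[OF J_subspace])

lemma entry_hq_prod_linear:
  "entry_hq a (u + v) * entry_hq b w - (entry_hq a u * entry_hq b w + entry_hq a v * entry_hq b w) \<in> J3"
  "entry_hq b w * entry_hq a (u + v) - (entry_hq b w * entry_hq a u + entry_hq b w * entry_hq a v) \<in> J3"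
  "entry_hq a (q *\<^sub>Q u) * entry_hq b w - q *\<^sub>Q (entry_hq a u * entry_hq b w) \<in> J3"
  "entry_hq b w * entry_hq a (q *\<^sub>Q u) - q *\<^sub>Q (entry_hq b w * entry_hq a u) \<in> J3"
  using J_mult[OF linear_modD(1)[OF entry_hq_linear, of a u v] entry_hq_in_J[of b w]]
    J_mult[OF linear_modD(2)[OF entry_hq_linear, of a q u] entry_hq_in_J[of b w]]
  by (simp_all add: algebra_simps scaleQ_mult_fun)

lemma bilin_rels_descend:
  fixes g :: "'h hq \<times> 'h hq \<Rightarrow> ('h, 'm) slrep \<Rightarrow> complex"
  assumes K: "ratvec.subspace K"
    and g: "\<And>u v w. g (u + v, w) - (g (u, w) + g (v, w)) \<in> K" "\<And>u v w. g (u, v + w) - (g (u, v) + g (u, w)) \<in> K"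
      "\<And>q u v. g (q *\<^sub>Q u, v) - q *\<^sub>Q g (u, v) \<in> K" "\<And>q u v. g (u, q *\<^sub>Q v) - q *\<^sub>Q g (u, v) \<in> K"
    and r: "r \<in> bilin_rels"
  shows "lin_ext g r \<in> K"
  using r g by (auto simp: bilin_rels_def lin_ext_diff lin_ext_add lin_ext_scale diff_diff_add)

lemma sym_entries_rels:
  "r \<in> sym_rels \<Longrightarrow> lin_ext (\<lambda>(v, w). entry_hq a v * entry_hq b w + entry_hq b v * entry_hq a w) r \<in> J3"
proof -
  let ?g = "\<lambda>(v, w). entry_hq a v * entry_hq b w + entry_hq b v * entry_hq a w"
  have "lin_ext ?g r \<in> J3" if "r \<in> bilin_rels"
  proof (rule bilin_rels_descend[OF J_subspace _ _ _ _ that])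
    show "?g (u + v, w) - (?g (u, w) + ?g (v, w)) \<in> J3" for u v w
      using J_cong_add[OF entry_hq_prod_linear(1)[of a u v b w] entry_hq_prod_linear(1)[of b u v a w]]
      by (simp add: algebra_simps)
    show "?g (u, v + w) - (?g (u, v) + ?g (u, w)) \<in> J3" for u v w
      using J_cong_add[OF entry_hq_prod_linear(2)[of b u a v w] entry_hq_prod_linear(2)[of a u b v w]]
      by (simp add: algebra_simps)
    show "?g (q *\<^sub>Q u, v) - q *\<^sub>Q ?g (u, v) \<in> J3" for q u v
      using J_cong_add[OF entry_hq_prod_linear(3)[of a q u b v] entry_hq_prod_linear(3)[of b q u a v]]
      by (simp add: scaleQ_add_right)
    show "?g (u, q *\<^sub>Q v) - q *\<^sub>Q ?g (u, v) \<in> J3" for q u v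
      using J_cong_add[OF entry_hq_prod_linear(4)[of b u a q v] entry_hq_prod_linear(4)[of a u b q v]]
      by (simp add: scaleQ_add_right add.commute)
  qed
  moreover have "lin_ext ?g (pt u v - pt v u) \<in> J3" for u v
    by (simp add: lin_ext_diff mult.commute add.commute ratvec.subspace_0[OF J_subspace])
  ultimately show "r \<in> sym_rels \<Longrightarrow> lin_ext ?g r \<in> J3"
    unfolding sym_rels_def by blast
qed

lemma alt_entries_rels:
  "r \<in> alt_rels \<Longrightarrow> lin_ext (\<lambda>(v, w). entry_hq a v * entry_hq b w - entry_hq b v * entry_hq a w) r \<in> J3"
proof -
  let ?g = "\<lambda>(v, w). entry_hq a v * entry_hq b w - entry_hq b v * entry_hq a w"
  have "lin_ext ?g r \<in> J3" if "r \<in> bilin_rels"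
  proof (rule bilin_rels_descend[OF J_subspace _ _ _ _ that])
    show "?g (u + v, w) - (?g (u, w) + ?g (v, w)) \<in> J3" for u v w
      using J_cong_diff[OF entry_hq_prod_linear(1)[of a u v b w] entry_hq_prod_linear(1)[of b u v a w]]
      by (simp add: algebra_simps)
    show "?g (u, v + w) - (?g (u, v) + ?g (u, w)) \<in> J3" for u v w
      using J_cong_diff[OF entry_hq_prod_linear(2)[of a u b v w] entry_hq_prod_linear(2)[of b u a v w]]
      by (simp add: algebra_simps)
    show "?g (q *\<^sub>Q u, v) - q *\<^sub>Q ?g (u, v) \<in> J3" for q u v
      using J_cong_diff[OF entry_hq_prod_linear(3)[of a q u b v] entry_hq_prod_linear(3)[of b q u a v]]
      by (simp add: ratvec.scale_right_diff_distrib)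
    show "?g (u, q *\<^sub>Q v) - q *\<^sub>Q ?g (u, v) \<in> J3" for q u v
      using J_cong_diff[OF entry_hq_prod_linear(4)[of a u b q v] entry_hq_prod_linear(4)[of b u a q v]]
      by (simp add: ratvec.scale_right_diff_distrib)
  qed
  moreover have "lin_ext ?g (pt v v) \<in> J3" for v
    by (simp add: mult.commute ratvec.subspace_0[OF J_subspace])
  ultimately show "r \<in> alt_rels \<Longrightarrow> lin_ext ?g r \<in> J3"
    unfolding alt_rels_def by blast
qed

lemma sym_entries_linear: "linear_mod J3 (sym_entries a b)"
  unfolding sym_entries_def[abs_def] by (rule lin_ext_descends_sym2(1)[OF J_subspace sym_entries_rels])

lemma alt_entries_linear: "linear_mod J3 (alt_entries a b)"
  unfolding alt_entries_def[abs_def] by (rule lin_ext_descends_ext2(1)[OF J_subspace alt_entries_rels])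

lemma sym_entries_symprod:
  "sym_entries a b (symprod v w) - (entry_hq a v * entry_hq b w + entry_hq b v * entry_hq a w) \<in> J3"
  using lin_ext_descends_sym2(2)[OF J_subspace sym_entries_rels[where a = a and b = b], of v w]
  by (simp add: sym_entries_def)

lemma alt_entries_wedge:
  "alt_entries a b (wedge v w) - (entry_hq a v * entry_hq b w - entry_hq b v * entry_hq a w) \<in> J3"
  using lin_ext_descends_ext2(2)[OF J_subspace alt_entries_rels[where a = a and b = b], of v w]
  by (simp add: alt_entries_def)

lemma entry_hq_prod_tens:
  "entry_hq a (tens x 1) * entry_hq b (tens y 1) - entry a x * entry b y \<in> J3"
  by (rule J_cong_mult[OF entry_hq_tens entry_hq_tens entry_hq_in_J entry_in_J])

lemma sym_entries_tens:
  "sym_entries a b (symprod (tens x 1) (tens y 1)) - (entry a x * entry b y + entry b x * entry a y)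
    \<in> J3"
  by (rule J_cong_trans[OF sym_entries_symprod J_cong_add[OF entry_hq_prod_tens entry_hq_prod_tens]])

lemma alt_entries_tens:
  "alt_entries a b (wedge (tens x 1) (tens y 1)) - (entry a x * entry b y - entry b x * entry a y)
    \<in> J3"
  by (rule J_cong_trans[OF alt_entries_wedge J_cong_diff[OF entry_hq_prod_tens entry_hq_prod_tens]])

lemma sym_entries_in_J2: "sym_entries a b u \<in> J2"
  unfolding sym_entries_def
  by (rule lin_ext_in_subspace[OF J_subspace])
    (auto intro: ratvec.subspace_add[OF J_subspace] J_mult entry_hq_in_J)

lemma alt_entries_in_J2: "alt_entries a b u \<in> J2"
  unfolding alt_entries_def
  by (rule lin_ext_in_subspace[OF J_subspace])
    (auto intro: ratvec.subspace_diff[OF J_subspace] J_mult entry_hq_in_J)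

subsection \<open>Equivariance\<close>

lemma fun_act_diff: "fun_act (f - g) \<sigma> = fun_act f \<sigma> - fun_act g \<sigma>"
  by (simp add: fun_act_def fun_eq_iff)

lemma fun_act_linear_mod:
  assumes "linear_mod (J k) F"
  shows "linear_mod (J k) (\<lambda>v. fun_act (F v) \<sigma>)"
  unfolding linear_mod_def
  using fun_act_J[OF linear_modD(1)[OF assms], of _ _ \<sigma>] fun_act_J[OF linear_modD(2)[OF assms], of _ _ \<sigma>]
  by (simp add: fun_act_diff fun_act_algebra_hom)

lemma linear_mod_compose:
  assumes "linear_mod K F" "\<And>u v. L (u + v) = L u + L v" "\<And>q v. L (q *\<^sub>Q v) = q *\<^sub>Q L v"
  shows "linear_mod K (\<lambda>v. F (L v))"
  using assms by (simp add: linear_mod_def)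

text \<open>On generators both sides are the entry at the image of the generator, and both are linear up
  to the relevant power. The squares inherit equivariance from \<open>H \<otimes> \<rat>\<close> in the same way.\<close>

lemma fun_act_entry_hq: "fun_act (entry_hq a v) \<sigma> - entry_hq a (hq_act v \<sigma>) \<in> J2"
proof (rule linear_mod_cong_span[OF J_subspace _ _ _ hq_span_tens[of v]])
  show "linear_mod J2 (\<lambda>v. fun_act (entry_hq a v) \<sigma>)"
    by (rule fun_act_linear_mod[OF entry_hq_linear])
  show "linear_mod J2 (\<lambda>v. entry_hq a (hq_act v \<sigma>))"
    by (rule linear_mod_compose[OF entry_hq_linear hq_act_add hq_act_scale])
  fix w :: "'h hq" assume "w \<in> range (\<lambda>x. tens x 1)"
  then obtain x where w: "w = tens x 1" by blast
  have "fun_act (entry_hq a w) \<sigma> - entry a (apply_aut \<sigma> x) \<in> J2"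
    using fun_act_J[OF entry_hq_tens[of a x], of \<sigma>] by (simp add: w fun_act_diff entry_def fun_act_scoef)
  moreover have "entry a (apply_aut \<sigma> x) - entry_hq a (hq_act w \<sigma>) \<in> J2"
    unfolding w hq_act_tens by (rule J_cong_sym[OF entry_hq_tens])
  ultimately show "fun_act (entry_hq a w) \<sigma> - entry_hq a (hq_act w \<sigma>) \<in> J2" by (rule J_cong_trans)
qed

lemma fun_act_entry_hq_prod:
  "fun_act (entry_hq a v * entry_hq b w) \<sigma> - entry_hq a (hq_act v \<sigma>) * entry_hq b (hq_act w \<sigma>) \<in> J3"
  unfolding fun_act_algebra_hom
  by (rule J_cong_mult[OF fun_act_entry_hq fun_act_entry_hq fun_act_J[OF entry_hq_in_J] entry_hq_in_J])

lemma fun_act_sym_entries: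
  "fun_act (sym_entries a b u) \<sigma> - sym_entries a b (sym2_act u \<sigma>) \<in> J3"
proof (rule linear_mod_cong_span[OF J_subspace _ _ _ sym2_span[of u]])
  show "linear_mod J3 (\<lambda>u. fun_act (sym_entries a b u) \<sigma>)"
    by (rule fun_act_linear_mod[OF sym_entries_linear])
  show "linear_mod J3 (\<lambda>u. sym_entries a b (sym2_act u \<sigma>))"
    by (rule linear_mod_compose[OF sym_entries_linear square_act_linear(1,2)])
  fix s :: "'h hq sym2" assume "s \<in> {symprod v w | v w. True}"
  then obtain v w where s: "s = symprod v w" by blast
  have "fun_act (sym_entries a b s) \<sigma> - fun_act (entry_hq a v * entry_hq b w + entry_hq b v * entry_hq a w) \<sigma> \<in> J3"
    unfolding s fun_act_diff[symmetric] by (rule fun_act_J[OF sym_entries_symprod])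
  moreover have "fun_act (entry_hq a v * entry_hq b w + entry_hq b v * entry_hq a w) \<sigma> -
      (entry_hq a (hq_act v \<sigma>) * entry_hq b (hq_act w \<sigma>) + entry_hq b (hq_act v \<sigma>) * entry_hq a (hq_act w \<sigma>)) \<in> J3"
    unfolding fun_act_algebra_hom(2) by (rule J_cong_add[OF fun_act_entry_hq_prod fun_act_entry_hq_prod])
  moreover have "(entry_hq a (hq_act v \<sigma>) * entry_hq b (hq_act w \<sigma>) + entry_hq b (hq_act v \<sigma>) * entry_hq a (hq_act w \<sigma>))
      - sym_entries a b (sym2_act s \<sigma>) \<in> J3"
    unfolding s sym2_act_symprod by (rule J_cong_sym[OF sym_entries_symprod])
  ultimately show "fun_act (sym_entries a b s) \<sigma> - sym_entries a b (sym2_act s \<sigma>) \<in> J3"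
    by (blast intro: J_cong_trans)
qed

lemma fun_act_alt_entries:
  "fun_act (alt_entries a b u) \<sigma> - alt_entries a b (ext2_act u \<sigma>) \<in> J3"
proof (rule linear_mod_cong_span[OF J_subspace _ _ _ ext2_span[of u]])
  show "linear_mod J3 (\<lambda>u. fun_act (alt_entries a b u) \<sigma>)"
    by (rule fun_act_linear_mod[OF alt_entries_linear])
  show "linear_mod J3 (\<lambda>u. alt_entries a b (ext2_act u \<sigma>))"
    by (rule linear_mod_compose[OF alt_entries_linear square_act_linear(3,4)])
  fix s :: "'h hq ext2" assume "s \<in> {wedge v w | v w. True}"
  then obtain v w where s: "s = wedge v w" by blast
  have "fun_act (alt_entries a b s) \<sigma> - fun_act (entry_hq a v * entry_hq b w - entry_hq b v * entry_hq a w) \<sigma> \<in> J3"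
    unfolding s fun_act_diff[symmetric] by (rule fun_act_J[OF alt_entries_wedge])
  moreover have "fun_act (entry_hq a v * entry_hq b w - entry_hq b v * entry_hq a w) \<sigma> -
      (entry_hq a (hq_act v \<sigma>) * entry_hq b (hq_act w \<sigma>) - entry_hq b (hq_act v \<sigma>) * entry_hq a (hq_act w \<sigma>)) \<in> J3"
    unfolding fun_act_diff by (rule J_cong_diff[OF fun_act_entry_hq_prod fun_act_entry_hq_prod])
  moreover have "(entry_hq a (hq_act v \<sigma>) * entry_hq b (hq_act w \<sigma>) - entry_hq b (hq_act v \<sigma>) * entry_hq a (hq_act w \<sigma>))
      - alt_entries a b (ext2_act s \<sigma>) \<in> J3"
    unfolding s ext2_act_wedge by (rule J_cong_sym[OF alt_entries_wedge])
  ultimately show "fun_act (alt_entries a b s) \<sigma> - alt_entries a b (ext2_act s \<sigma>) \<in> J3"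
    by (blast intro: J_cong_trans)
qed

end

section \<open>Alternating forms that vanish on commuting matrices\<close>

definition bform :: "('m \<times> 'm \<Rightarrow> 'm \<times> 'm \<Rightarrow> real) \<Rightarrow> real^'m^'m \<Rightarrow> real^'m^'m::finite \<Rightarrow> real" where
  "bform C X Y = (\<Sum>a\<in>UNIV. \<Sum>b\<in>UNIV. C a b * X $ fst a $ snd a * Y $ fst b $ snd b)"

lemma matrix_mult_bilinear:
  fixes A B C :: "real^'m^'m::finite"
  shows "A ** (B + C) = A ** B + A ** C" "(B + C) ** A = B ** A + C ** A"
    "A ** (B - C) = A ** B - A ** C" "(B - C) ** A = B ** A - C ** A"
    "(c *\<^sub>R A) ** B = c *\<^sub>R (A ** B)" "A ** (c *\<^sub>R B) = c *\<^sub>R (A ** B)"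
    "0 ** A = 0" "A ** 0 = 0"
  by (simp_all add: matrix_matrix_mult_def vec_eq_iff algebra_simps sum.distrib sum_subtractf
      sum_distrib_left)

lemma bform_add: "bform C (X + X') Y = bform C X Y + bform C X' Y"
  "bform C X (Y + Y') = bform C X Y + bform C X Y'"
  by (simp_all add: bform_def sum.distrib algebra_simps)

lemma bform_diff: "bform C (X - X') Y = bform C X Y - bform C X' Y"
  "bform C X (Y - Y') = bform C X Y - bform C X Y'"
  by (simp_all add: bform_def sum_subtractf algebra_simps)

lemma bform_zero: "bform C 0 Y = 0" "bform C X 0 = 0"
  by (simp_all add: bform_def)

definition munit :: "'m \<Rightarrow> 'm \<Rightarrow> real^'m^'m::finite" where
  "munit i j = (\<chi> k l. if k = i \<and> l = j then 1 else 0)"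

lemma munit_mult: "munit i j ** munit k l = (if j = k then munit i l else 0)"
proof -
  have "(\<Sum>r\<in>UNIV. (if s = i \<and> r = j then 1 else 0) * (if r = k \<and> t = l then 1 else (0::real)))
      = (\<Sum>r\<in>UNIV. if r = j then (if s = i \<and> j = k \<and> t = l then 1 else 0) else 0)" for s t
    by (rule sum.cong) auto
  then show ?thesis by (simp add: munit_def matrix_matrix_mult_def vec_eq_iff)
qed

lemma bform_munit: "bform C (munit i j) (munit k l) = C (i, j) (k, l)"
proof -
  have "bform C (munit i j) (munit k l) =
      (\<Sum>a\<in>UNIV. \<Sum>b\<in>UNIV. if b = (k, l) then (if a = (i, j) then C a b else 0) else 0)"
    unfolding bform_def munit_def by (intro sum.cong refl) auto
  then show ?thesis by simp
qed

lemma trace_munit: "trace (munit i j) = (if i = j then 1 else 0)"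
proof -
  have "trace (munit i j) = (\<Sum>k\<in>UNIV. if k = i then (if i = j then 1 else 0) else 0)"
    unfolding trace_def munit_def by (intro sum.cong refl) auto
  then show ?thesis by simp
qed

text \<open>For \<open>a \<noteq> (z, z)\<close> these form the basis of the traceless matrices dual to the coordinates other
  than the one at \<open>(z, z)\<close>.\<close>

definition tunit :: "'m \<Rightarrow> 'm \<times> 'm \<Rightarrow> real^'m^'m::finite" where
  "tunit z a = munit (fst a) (snd a) - (if fst a = snd a then munit z z else 0)"

lemma trace_tunit: "trace (tunit z a) = 0"
  by (simp add: tunit_def trace_sub trace_munit trace_def[of 0])

lemma bform_tunit:
  assumes "\<And>b. C (z, z) b = 0" "\<And>a. C a (z, z) = 0"
  shows "bform C (tunit z a) (tunit z b) = C a b"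
  using assms by (cases a; cases b) (simp add: tunit_def bform_diff bform_munit bform_zero)

lemma symmetric_part_zero:
  assumes C0: "\<And>b. C (z, z) b = 0" "\<And>a. C a (z, z) = 0"
    and van: "\<And>X. trace X = 0 \<Longrightarrow> bform C X X = 0"
  shows "C a b + C b a = 0"
proof -
  have "bform C (tunit z a + tunit z b) (tunit z a + tunit z b) = 0"
    by (rule van) (simp add: trace_add trace_tunit)
  moreover have "bform C (tunit z c) (tunit z c) = 0" for c by (rule van[OF trace_tunit])
  ultimately show ?thesis by (simp add: bform_add bform_tunit[of C z, OF C0])
qed

text \<open>An alternating form that vanishes on commuting pairs is a linear functional of the commutator.
  To see this, the form is extended to a form \<open>\<omega>\<close> on all matrices by means of the projection along the
  scalar matrices, which respects commutation. Three families of commuting pairs are enough: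
  different matrix units with zero products in both orders give \<open>\<omega> = 0\<close>; the pair \<open>E\<^sub>i\<^sub>j + E\<^sub>i\<^sub>k\<close>,
  \<open>E\<^sub>j\<^sub>l - E\<^sub>k\<^sub>l\<close> shows that \<open>\<omega>(E\<^sub>i\<^sub>j, E\<^sub>j\<^sub>l)\<close> does not depend on \<open>j\<close> when \<open>i \<noteq> l\<close>; the permutation matrix
  of a 3-cycle and its inverse show that \<open>\<omega>(E\<^sub>i\<^sub>j, E\<^sub>j\<^sub>i)\<close> is a cocycle in \<open>i, j\<close>. The assumptions \<open>elim\<close>
  evaluate the functional at every matrix unit (and difference of diagonal units), and so it
  vanishes.\<close>

lemma alternating_form_zero:
  fixes C :: "'m::finite \<times> 'm \<Rightarrow> 'm \<times> 'm \<Rightarrow> real" and z :: 'm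
  assumes alt: "\<And>a b. C a b = - C b a" and C0: "\<And>b. C (z, z) b = 0"
    and elim: "\<And>i l. i \<noteq> z \<Longrightarrow> l \<noteq> z \<Longrightarrow> C (i, z) (z, l) = 0"
      "\<And>l. l \<noteq> z \<Longrightarrow> C (l, l) (z, l) = 0" "\<And>l. l \<noteq> z \<Longrightarrow> C (l, l) (l, z) = 0"
    and van: "\<And>X Y. trace X = 0 \<Longrightarrow> trace Y = 0 \<Longrightarrow> X ** Y = Y ** X \<Longrightarrow> bform C X Y = 0"
  shows "C a b = 0"
proof -
  have C0': "C a (z, z) = 0" for a using alt[of a "(z, z)"] C0 by simp
  define P :: "real^'m^'m \<Rightarrow> real^'m^'m" where "P X = X - (trace X / real CARD('m)) *\<^sub>R mat 1" for X
  define \<omega> where "\<omega> X Y = bform C (P X) (P Y)" for X Y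
  have trP: "trace (P X) = 0" for X
    by (simp add: P_def trace_def mat_def sum_subtractf)
  have P_add: "P (X + Y) = P X + P Y" and P_diff: "P (X - Y) = P X - P Y" for X Y
    by (simp_all add: P_def trace_add trace_sub add_divide_distrib diff_divide_distrib algebra_simps)
  have P_id: "P X = X" if "trace X = 0" for X using that by (simp add: P_def)
  have P_zero: "P 0 = 0" by (rule P_id) (simp add: trace_def)
  have P_comm: "P X ** P Y = P Y ** P X" if "X ** Y = Y ** X" for X Y
    using that by (simp add: P_def matrix_mult_bilinear scaleR_diff_right mult.commute)
  have \<omega>0: "\<omega> X Y = 0" if "X ** Y = Y ** X" for X Y
    unfolding \<omega>_def by (rule van[OF trP trP P_comm[OF that]])
  note bil = bform_add bform_diff P_add P_diff
  define w where "w i j k l = \<omega> (munit i j) (munit k l)" for i j k l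
  have w_alt: "w i j k l = - w k l i j" for i j k l
  proof -
    have "bform C X Y = - bform C Y X" for X Y
    proof -
      have "bform C X Y = (\<Sum>b\<in>UNIV. \<Sum>a\<in>UNIV. C a b * X $ fst a $ snd a * Y $ fst b $ snd b)"
        unfolding bform_def by (rule sum.swap)
      also have "\<dots> = (\<Sum>b\<in>UNIV. \<Sum>a\<in>UNIV. - (C b a * Y $ fst b $ snd b * X $ fst a $ snd a))"
        by (intro sum.cong refl, subst alt) simp
      finally show ?thesis by (simp add: sum_negf bform_def)
    qed
    then show ?thesis unfolding w_def \<omega>_def .
  qed
  have w_comm: "w i j k l = 0" if "j \<noteq> k" "i \<noteq> l" for i j k l
    unfolding w_def by (rule \<omega>0) (use that in \<open>simp add: munit_mult\<close>)
  have w_same: "w i j i j = 0" for i j unfolding w_def by (rule \<omega>0) simp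
  have w_indep: "w i j j l = w i k k l" if "i \<noteq> l" for i j k l
  proof (cases "j = k")
    case False
    have "\<omega> (munit i j + munit i k) (munit j l - munit k l) = 0"
      by (rule \<omega>0) (use that False in \<open>simp add: matrix_mult_bilinear munit_mult\<close>)
    then have "w i j j l - w i j k l + w i k j l - w i k k l = 0"
      by (simp add: \<omega>_def w_def bil)
    then show ?thesis using w_comm[of j k i l] w_comm[of k j i l] that False by simp
  qed simp
  have w_cyc: "w i j j i + w j k k j + w k i i k = 0" if "i \<noteq> j" "j \<noteq> k" "k \<noteq> i" for i j k
  proof -
    have "\<omega> (munit i j + munit j k + munit k i) (munit j i + munit k j + munit i k) = 0"
      by (rule \<omega>0) (use that in \<open>simp add: matrix_mult_bilinear munit_mult add_ac\<close>)
    then have "w i j j i + w i j k j + w i j i k + (w j k j i + w j k k j + w j k i k)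
        + (w k i j i + w k i k j + w k i i k) = 0"
      by (simp add: \<omega>_def w_def bil add_ac)
    then show ?thesis using that by (simp add: w_comm)
  qed
  \<comment> \<open>\<open>\<omega>\<close> agrees with the given form on traceless matrices, so its values at
    \<open>E\<^sub>i\<^sub>i - E\<^sub>z\<^sub>z\<close> give the coefficients at diagonal entries.\<close>
  have C_w: "C (i, j) (k, l) = w i j k l - (if i = j then w z z k l else 0)
      - (if k = l then w i j z z else 0)" for i j k l
  proof -
    have "C (i, j) (k, l) = \<omega> (tunit z (i, j)) (tunit z (k, l))"
      by (simp add: \<omega>_def P_id trace_tunit bform_tunit C0 C0')
    also have "\<dots> = w i j k l - (if i = j then w z z k l else 0)
      - (if k = l then w i j z z else 0) + (if i = j \<and> k = l then w z z z z else 0)"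
      by (simp add: tunit_def w_def \<omega>_def bil bform_zero P_zero)
    finally show ?thesis by (simp add: w_same)
  qed
  \<comment> \<open>The bracket of \<open>E\<^sub>l\<^sub>l - E\<^sub>z\<^sub>z\<close> with \<open>E\<^sub>z\<^sub>l\<close> is twice \<open>- E\<^sub>z\<^sub>l\<close>, whence the coefficient at
    this pair is twice a value of the functional.\<close>
  have ol: "w z l l l = 0" if "l \<noteq> z" for l
    using C_w[of l l z l] elim(2)[OF that] w_alt[of l l z l] w_indep[of z l z l] that by simp
  have lo: "w l l l z = 0" if "l \<noteq> z" for l
    using C_w[of l l l z] elim(3)[OF that] w_alt[of z z l z] w_indep[of l z z l] that by simp
  have il: "w i j j l = 0" if ne: "i \<noteq> l" for i j l
  proof -
    consider "i = z" "l \<noteq> z" | "l = z" "i \<noteq> z" | "i \<noteq> z" "l \<noteq> z" using ne by blast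
    then show ?thesis
    proof cases
      case 1 then show ?thesis using ol[of l] w_indep[of z l j l] by simp
    next
      case 2 then show ?thesis using lo[of i] w_indep[of i z j i] by simp
    next
      case 3
      then show ?thesis using C_w[of i z z l] elim(1)[of i l] w_indep[of i l j z] that by simp
    qed
  qed
  have io: "w i z z i = 0" if "i \<noteq> z" for i using C_w[of i z z i] elim(1)[of i i] that by simp
  have ij: "w i j j i = 0" for i j
  proof -
    consider "i = j" | "i = z" "j \<noteq> z" | "j = z" "i \<noteq> z" | "i \<noteq> j" "i \<noteq> z" "j \<noteq> z" by blast
    then show ?thesis
    proof cases
      case 2 then show ?thesis using io[of j] w_alt[of z j j z] by simp
    next
      case 4
      then show ?thesis using w_cyc[of i j z] io[of i] io[of j] w_alt[of z i i z] by simp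
    qed (use io w_same in auto)
  qed
  have "w i j k l = 0" for i j k l
  proof -
    consider "j = k" "i = l" | "j = k" "i \<noteq> l" | "j \<noteq> k" "i = l" | "j \<noteq> k" "i \<noteq> l" by blast
    then show ?thesis
    proof cases
      case 3 then show ?thesis using il[of k j i] w_alt[of i j k l] by simp
    qed (use ij il w_comm in auto)
  qed
  then show ?thesis by (cases a; cases b) (simp add: C_w)
qed

section \<open>Indexing the copies\<close>

text \<open>Of the \<open>m\<^sup>2\<close> entries the one at \<open>(z, z)\<close> is redundant, as the trace vanishes to first order.
  For symmetrised products all unordered pairs of the remaining entries are needed. For
  antisymmetrised products, the commutator relation at each \<open>(i, l) \<noteq> (z, z)\<close> makes one pair of
  different entries redundant. The pair \<open>elim_pair z (i, l)\<close> is chosen such that, after the entry at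
  \<open>(z, z)\<close> has been eliminated, it occurs in this one of the relations and in no other; so the
  relations are already in solved form.\<close>

definition elim_pair :: "'m \<Rightarrow> 'm \<times> 'm \<Rightarrow> ('m \<times> 'm) set" where
  "elim_pair z = (\<lambda>(i, l). if i = z then {(l, l), (z, l)} else if l = z then {(i, i), (i, z)}
     else {(i, z), (z, l)})"

definition elim_pairs :: "'m \<Rightarrow> ('m \<times> 'm) set set" where
  "elim_pairs z = elim_pair z ` (- {(z, z)})"

text \<open>Pairs are ordered by an arbitrary numbering of the entries, so that each unordered pair is
  listed once.\<close>

definition sym_index :: "'m::finite \<Rightarrow> (('m \<times> 'm) \<times> ('m \<times> 'm)) set" where
  "sym_index z = {(a, b). a \<noteq> (z, z) \<and> b \<noteq> (z, z) \<and> to_nat a \<le> to_nat b}"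

definition alt_index :: "'m::finite \<Rightarrow> (('m \<times> 'm) \<times> ('m \<times> 'm)) set" where
  "alt_index z = {(a, b). a \<noteq> (z, z) \<and> b \<noteq> (z, z) \<and> to_nat a < to_nat b \<and> {a, b} \<notin> elim_pairs z}"

lemma elim_pairs_iff:
  "{a, b} \<in> elim_pairs z \<longleftrightarrow> (\<exists>i l. (i, l) \<noteq> (z, z) \<and> {a, b} = elim_pair z (i, l))"
  by (auto simp: elim_pairs_def)

lemma inj_elim_pair: "inj_on (elim_pair z) (- {(z, z)})"
  by (rule inj_onI) (auto simp: elim_pair_def doubleton_eq_iff split: prod.splits if_splits)

lemma elim_pairs_subset: "elim_pairs z \<subseteq> {A. A \<subseteq> - {(z, z)} \<and> card A = 2}"
  by (auto simp: elim_pairs_def elim_pair_def split: if_splits)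

lemma ordered_pairs_image:
  "(\<lambda>(a, b). {a, b}) ` {(a, b). a \<in> D \<and> b \<in> D \<and> to_nat a < to_nat b} = {A. A \<subseteq> D \<and> card A = 2}"
  (is "?f ` ?P = ?T")
proof
  show "?f ` ?P \<subseteq> ?T" by (auto simp: card_2_iff)
  show "?T \<subseteq> ?f ` ?P"
  proof clarify
    fix A assume A: "A \<subseteq> D" "card A = 2"
    then obtain a b where ab: "A = {a, b}" "a \<noteq> b" by (auto simp: card_2_iff)
    then have "to_nat a \<noteq> to_nat b" by simp
    then consider "to_nat a < to_nat b" | "to_nat b < to_nat a" by linarith
    then show "A \<in> ?f ` ?P"
    proof cases
      case 1 then show ?thesis using A ab by (intro image_eqI[of _ _ "(a, b)"]) auto
    next
      case 2 then show ?thesis using A ab by (intro image_eqI[of _ _ "(b, a)"]) auto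
    qed
  qed
qed

lemma inj_ordered_pairs: "inj_on (\<lambda>(a, b). {a, b}) {(a, b). P a b \<and> to_nat a < to_nat b}"
  by (rule inj_onI) (auto simp: doubleton_eq_iff)

lemma card_ordered_pairs:
  assumes "finite D"
  shows "card {(a, b). a \<in> D \<and> b \<in> D \<and> to_nat a < to_nat b} = card D choose 2"
proof -
  have "card ((\<lambda>(a, b). {a, b}) ` {(a, b). a \<in> D \<and> b \<in> D \<and> to_nat a < to_nat b}) = card D choose 2"
    unfolding ordered_pairs_image by (rule n_subsets[OF assms])
  then show ?thesis
    using card_image[OF inj_ordered_pairs[of "\<lambda>a b. a \<in> D \<and> b \<in> D"]] by (simp add: conj_assoc)
qed

lemma card_nondiagonal: "card (- {(z, z :: 'm::finite)}) = CARD('m)\<^sup>2 - 1"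
  by (simp add: card_Diff_singleton power2_eq_square Compl_eq_Diff_UNIV)

lemma card_sym_index: "card (sym_index (z :: 'm::finite)) = CARD('m)\<^sup>2 * (CARD('m)\<^sup>2 - 1) div 2"
proof -
  let ?D = "- {(z, z)}"
  let ?P = "{(a, b). a \<in> ?D \<and> b \<in> ?D \<and> to_nat a < to_nat b}"
  define d where "d = card ?D"
  have m: "CARD('m)\<^sup>2 = Suc d" by (simp add: d_def card_nondiagonal)
  have "sym_index z = ?P \<union> (\<lambda>a. (a, a)) ` ?D"
    by (auto simp: sym_index_def image_iff le_less)
  moreover have "card ((\<lambda>a. (a, a)) ` ?D) = d" unfolding d_def by (intro card_image) (auto simp: inj_on_def)
  moreover have "?P \<inter> (\<lambda>a. (a, a)) ` ?D = {}" by auto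
  ultimately have "card (sym_index z) = (d choose 2) + d"
    using card_ordered_pairs[of ?D] by (simp add: card_Un_disjoint d_def)
  also have "\<dots> = Suc d choose 2" by (simp add: numeral_2_eq_2)
  finally show ?thesis by (simp add: m choose_two)
qed

lemma card_alt_index:
  assumes "CARD('m::finite) \<ge> 2"
  shows "card (alt_index (z :: 'm)) = (CARD('m)\<^sup>2 - 1) * (CARD('m)\<^sup>2 - 4) div 2"
proof -
  let ?D = "- {(z, z)}"
  let ?T = "{A. A \<subseteq> ?D \<and> card A = 2}"
  let ?f = "\<lambda>(a, b). {a, b}"
  define d where "d = card ?D"
  have m: "CARD('m)\<^sup>2 = Suc d" by (simp add: d_def card_nondiagonal)
  have "2\<^sup>2 \<le> CARD('m)\<^sup>2" using assms by (rule power_mono) simp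
  then have "3 \<le> d" using m by simp
  then obtain k where k: "d = k + 3" using le_Suc_ex by (metis add.commute)
  have "?f ` alt_index z = ?f ` {(a, b). a \<in> ?D \<and> b \<in> ?D \<and> to_nat a < to_nat b} - elim_pairs z"
    by (auto simp: alt_index_def image_iff)
  then have "?f ` alt_index z = ?T - elim_pairs z" unfolding ordered_pairs_image .
  moreover have "card (?f ` alt_index z) = card (alt_index z)"
    using inj_ordered_pairs[of "\<lambda>a b. True"] by (intro card_image) (auto simp: alt_index_def elim: inj_on_subset)
  moreover have "card (elim_pairs z) = d"
    unfolding elim_pairs_def d_def by (rule card_image[OF inj_elim_pair])
  moreover have "card ?T = d choose 2" unfolding d_def by (rule n_subsets) simp
  ultimately have "card (alt_index z) = (d choose 2) - d"
    using elim_pairs_subset[of z] by (simp add: card_Diff_subset)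
  also have "d choose 2 = d * k div 2 + d"
    unfolding choose_two k by simp
  finally show ?thesis by (simp add: m k mult.commute[of k] add.commute[of k])
qed

section \<open>Spanning\<close>

context free_abelian
begin

text \<open>The inverse of the isomorphism, up to the numbering of the copies and as a map to functions
  instead of cosets.\<close>

definition psi :: "(('m \<times> 'm) \<times> ('m \<times> 'm) \<Rightarrow> 'h hq sym2) \<times> (('m \<times> 'm) \<times> ('m \<times> 'm) \<Rightarrow> 'h hq ext2) \<Rightarrow>
    ('h, 'm) slrep \<Rightarrow> complex" where
  "psi w = (\<Sum>c\<in>sym_index z. sym_entries (fst c) (snd c) (fst w c)) +
     (\<Sum>c\<in>alt_index z. alt_entries (fst c) (snd c) (snd w c))"

lemma psi_linear: "linear_mod J3 psi"
proof -
  have "linear_mod J3 (\<lambda>w :: (('m \<times> 'm) \<times> ('m \<times> 'm) \<Rightarrow> 'h hq sym2) \<times>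
      (('m \<times> 'm) \<times> ('m \<times> 'm) \<Rightarrow> 'h hq ext2). sym_entries (fst c) (snd c) (fst w c))" for c
    by (rule linear_mod_compose[OF sym_entries_linear]) (simp_all add: scaleQ_prod_def scaleQ_fun_def)
  moreover have "linear_mod J3 (\<lambda>w :: (('m \<times> 'm) \<times> ('m \<times> 'm) \<Rightarrow> 'h hq sym2) \<times>
      (('m \<times> 'm) \<times> ('m \<times> 'm) \<Rightarrow> 'h hq ext2). alt_entries (fst c) (snd c) (snd w c))" for c
    by (rule linear_mod_compose[OF alt_entries_linear]) (simp_all add: scaleQ_prod_def scaleQ_fun_def)
  ultimately show ?thesis
    unfolding psi_def[abs_def] by (intro linear_mod_add linear_mod_sum_fun J_subspace)
qed

lemma psi_in_J2: "psi w \<in> J2"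
  unfolding psi_def
  by (intro ratvec.subspace_add[OF J_subspace] ratvec.subspace_sum[OF J_subspace]
      sym_entries_in_J2 alt_entries_in_J2)

definition psi_range :: "(('h, 'm) slrep \<Rightarrow> complex) set" where
  "psi_range = {f. \<exists>w. f - psi w \<in> J3}"

lemma psi_range_subspace: "ratvec.subspace psi_range"
proof (rule ratvec.subspaceI)
  show "0 \<in> psi_range"
    unfolding psi_range_def using ratvec.subspace_neg[OF J_subspace linear_mod_zero[OF J_subspace psi_linear]]
    by (intro CollectI exI[of _ 0]) simp
next
  fix f g assume "f \<in> psi_range" "g \<in> psi_range"
  then obtain v w where v: "f - psi v \<in> J3" and w: "g - psi w \<in> J3"
    by (auto simp: psi_range_def)
  have "f + g - psi (v + w) \<in> J3"
    by (rule J_cong_trans[OF J_cong_add[OF v w] J_cong_sym[OF linear_modD(1)[OF psi_linear]]])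
  then show "f + g \<in> psi_range" unfolding psi_range_def by blast
next
  fix q f assume "f \<in> psi_range"
  then obtain v where v: "f - psi v \<in> J3" by (auto simp: psi_range_def)
  have "q *\<^sub>Q f - psi (q *\<^sub>Q v) \<in> J3"
    by (rule J_cong_trans[OF J_cong_scale[OF v] J_cong_sym[OF linear_modD(2)[OF psi_linear]]])
  then show "q *\<^sub>Q f \<in> psi_range" unfolding psi_range_def by blast
qed

lemmas psi_range_add = ratvec.subspace_add[OF psi_range_subspace]
lemmas psi_range_diff = ratvec.subspace_diff[OF psi_range_subspace]
lemmas psi_range_neg = ratvec.subspace_neg[OF psi_range_subspace]
lemmas psi_range_sum = ratvec.subspace_sum[OF psi_range_subspace]
lemmas psi_range_scale = ratvec.subspace_scale[OF psi_range_subspace]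
lemmas psi_range_zero = ratvec.subspace_0[OF psi_range_subspace]

lemma J3_subset_psi_range: "J3 \<subseteq> psi_range"
proof
  fix f assume "f \<in> J3"
  then have "f - psi 0 \<in> J3"
    using linear_mod_zero[OF J_subspace psi_linear] ratvec.subspace_diff[OF J_subspace] by blast
  then show "f \<in> psi_range" unfolding psi_range_def by blast
qed

lemma psi_range_cong: "f - g \<in> J3 \<Longrightarrow> g \<in> psi_range \<Longrightarrow> f \<in> psi_range"
  using psi_range_add[of "f - g" g] J3_subset_psi_range by auto

lemma psi_single:
  shows "c \<in> sym_index z \<Longrightarrow> sym_entries (fst c) (snd c) u \<in> psi_range"
    and "c \<in> alt_index z \<Longrightarrow> alt_entries (fst c) (snd c) v \<in> psi_range"
proof -
  have sz: "sym_entries a b 0 \<in> J3" for a b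
    by (rule linear_mod_zero[OF J_subspace sym_entries_linear])
  have az: "alt_entries a b 0 \<in> J3" for a b
    by (rule linear_mod_zero[OF J_subspace alt_entries_linear])
  show "sym_entries (fst c) (snd c) u \<in> psi_range" if c: "c \<in> sym_index z"
  proof -
    let ?w = "((\<lambda>d. if d = c then u else 0), 0) :: (_ \<Rightarrow> 'h hq sym2) \<times> (_ \<Rightarrow> 'h hq ext2)"
    have "psi ?w - sym_entries (fst c) (snd c) u
      = (\<Sum>d\<in>sym_index z - {c}. sym_entries (fst d) (snd d) 0) + (\<Sum>d\<in>alt_index z. alt_entries (fst d) (snd d) 0)"
      unfolding psi_def by (simp add: sum.remove[OF _ c])
    also have "\<dots> \<in> J3"
      by (intro ratvec.subspace_add[OF J_subspace] ratvec.subspace_sum[OF J_subspace] sz az)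
    finally show ?thesis unfolding psi_range_def using J_cong_sym by blast
  qed
  show "alt_entries (fst c) (snd c) v \<in> psi_range" if c: "c \<in> alt_index z"
  proof -
    let ?w = "(0, (\<lambda>d. if d = c then v else 0)) :: (_ \<Rightarrow> 'h hq sym2) \<times> (_ \<Rightarrow> 'h hq ext2)"
    have "psi ?w - alt_entries (fst c) (snd c) v
      = (\<Sum>d\<in>sym_index z. sym_entries (fst d) (snd d) 0) + (\<Sum>d\<in>alt_index z - {c}. alt_entries (fst d) (snd d) 0)"
      unfolding psi_def by (simp add: sum.remove[OF _ c])
    also have "\<dots> \<in> J3"
      by (intro ratvec.subspace_add[OF J_subspace] ratvec.subspace_sum[OF J_subspace] sz az)
    finally show ?thesis unfolding psi_range_def using J_cong_sym by blast
  qed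
qed

text \<open>A product of two entries is half the sum of its symmetrisation \<open>S\<close> and its antisymmetrisation
  \<open>L\<close>. The trace relation reduces both to entries other than \<open>(z, z)\<close>. This finishes \<open>S\<close>; for \<open>L\<close> the
  commutator relations express the eliminated pairs by the listed ones. When \<open>i = z\<close> or \<open>l = z\<close>, the
  eliminated pair appears once in the commutator relation itself and once more through the trace,
  with the same sign, so that one has to divide by two.\<close>

lemma entry_mult_in_psi_range: "entry a x * entry b y \<in> psi_range"
proof -
  define S where "S a b = entry a x * entry b y + entry b x * entry a y" for a b :: "'m \<times> 'm"
  define L where "L a b = entry a x * entry b y - entry b x * entry a y" for a b :: "'m \<times> 'm"
  have S_comm: "S a b = S b a" for a b by (simp add: S_def add.commute)
  have L_anti: "L a b = - L b a" and L_self: "L a a = 0" for a b by (simp_all add: L_def)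
  note R = psi_range_add psi_range_diff psi_range_sum psi_range_neg
  have trS: "(\<Sum>i\<in>UNIV. S (i, i) b) \<in> psi_range" and trL: "(\<Sum>i\<in>UNIV. L (i, i) b) \<in> psi_range" for b
  proof -
    have "(\<Sum>i\<in>UNIV. entry (i, i) x) * entry b y \<in> J3"
      "entry b x * (\<Sum>i\<in>UNIV. entry (i, i) y) \<in> J3"
      by (intro J_mult J_mult' trace_in_J2 entry_in_J)+
    then have 1: "(\<Sum>i\<in>UNIV. entry (i, i) x) * entry b y \<in> psi_range" "entry b x * (\<Sum>i\<in>UNIV. entry (i, i) y) \<in> psi_range"
      using J3_subset_psi_range by blast+
    show "(\<Sum>i\<in>UNIV. S (i, i) b) \<in> psi_range"
      using psi_range_add[OF 1] by (simp add: S_def sum.distrib sum_distrib_left sum_distrib_right)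
    show "(\<Sum>i\<in>UNIV. L (i, i) b) \<in> psi_range"
      using psi_range_diff[OF 1] by (simp add: L_def sum_subtractf sum_distrib_left sum_distrib_right)
  qed
  have rel: "(\<Sum>j\<in>UNIV. L (i, j) (j, l)) = 0" for i l
    using scoef_commutator[of i x l y] by (simp add: L_def entry_def sum_subtractf mult.commute)
  have split1: "sum f UNIV = f z + sum f (- {z})" for f :: "'m \<Rightarrow> ('h, 'm) slrep \<Rightarrow> complex"
    by (simp add: sum.remove[of UNIV z] Compl_eq_Diff_UNIV)
  have split2: "sum f UNIV = f z + f l + sum f (- {z, l})" if "l \<noteq> z"
    for f :: "'m \<Rightarrow> ('h, 'm) slrep \<Rightarrow> complex" and l
  proof -
    have "- {z} - {l} = - {z, l}" by auto
    then show ?thesis using that by (simp add: split1 sum.remove[of "- {z}" l] add.assoc)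
  qed
  have S1: "S a b \<in> psi_range" if "a \<noteq> (z, z)" "b \<noteq> (z, z)" for a b
  proof -
    have *: "S a b \<in> psi_range" if "(a, b) \<in> sym_index z" for a b
      using psi_range_cong[OF J_cong_sym[OF sym_entries_tens] psi_single(1)[OF that, simplified]]
      by (simp add: S_def)
    show ?thesis using *[of a b] *[of b a] that S_comm[of a b] linear[of "to_nat a" "to_nat b"]
      by (auto simp: sym_index_def)
  qed
  have S2: "S (z, z) b \<in> psi_range" if "\<And>i. i \<noteq> z \<Longrightarrow> S (i, i) b \<in> psi_range" for b
  proof -
    have "S (z, z) b = (\<Sum>i\<in>UNIV. S (i, i) b) - (\<Sum>i\<in>- {z}. S (i, i) b)" by (simp add: split1)
    then show ?thesis using that trS[of b] by (auto intro!: R)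
  qed
  have S3: "S (z, z) b \<in> psi_range" if "b \<noteq> (z, z)" for b using S1 that by (intro S2) auto
  have S4: "S a b \<in> psi_range" for a b
  proof -
    have "S (z, z) (z, z) \<in> psi_range" using S3 by (intro S2) (simp add: S_comm[of _ "(z, z)"])
    then show ?thesis using S1[of a b] S3[of a] S3[of b] S_comm[of a b]
      by (cases "a = (z, z)"; cases "b = (z, z)") auto
  qed
  have L1: "L a b \<in> psi_range" if "a \<noteq> (z, z)" "b \<noteq> (z, z)" "{a, b} \<notin> elim_pairs z" for a b
  proof -
    have *: "L a b \<in> psi_range" if "(a, b) \<in> alt_index z" for a b
      using psi_range_cong[OF J_cong_sym[OF alt_entries_tens] psi_single(2)[OF that, simplified]]
      by (simp add: L_def)
    consider "a = b" | "to_nat a < to_nat b" | "to_nat b < to_nat a"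
      using to_nat_split[of a] linorder_less_linear[of "to_nat a" "to_nat b"] by auto
    then show ?thesis
    proof cases
      case 1 then show ?thesis by (simp add: L_self psi_range_zero)
    next
      case 2 then show ?thesis using that by (intro *) (auto simp: alt_index_def)
    next
      case 3
      then have "L b a \<in> psi_range" using that by (intro *) (auto simp: alt_index_def insert_commute)
      then show ?thesis unfolding L_anti[of a b] by (rule psi_range_neg)
    qed
  qed
  note el = elim_pairs_iff elim_pair_def doubleton_eq_iff
  have E1: "L (i, z) (z, l) \<in> psi_range" if "i \<noteq> z" "l \<noteq> z" for i l
  proof -
    have "L (i, j) (j, l) \<in> psi_range" if "j \<noteq> z" for j
      by (rule L1) (use that \<open>i \<noteq> z\<close> \<open>l \<noteq> z\<close> in \<open>auto simp: el split: if_splits\<close>)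
    then have "(\<Sum>j\<in>- {z}. L (i, j) (j, l)) \<in> psi_range" by (intro R) auto
    moreover have "L (i, z) (z, l) = - (\<Sum>j\<in>- {z}. L (i, j) (j, l))"
      using rel[of i l] by (simp add: split1 eq_neg_iff_add_eq_0)
    ultimately show ?thesis using psi_range_neg by simp
  qed
  have half: "f \<in> psi_range" if "f + f \<in> psi_range" for f
  proof -
    have "(1/2) *\<^sub>Q (f + f) = (1/2 + 1/2) *\<^sub>Q f" unfolding scaleQ_add_right scaleQ_add_left ..
    then have "(1/2) *\<^sub>Q (f + f) = f" by (simp only: field_sum_of_halves scaleQ_one)
    then show ?thesis using psi_range_scale[OF that, of "1/2"] by (simp only:)
  qed
  have E2: "L (l, l) (z, l) \<in> psi_range" if l: "l \<noteq> z" for l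
  proof -
    have "L (z, j) (j, l) \<in> psi_range" "L (j, j) (z, l) \<in> psi_range" if "j \<noteq> z" "j \<noteq> l" for j
      by (rule L1; use that l in \<open>auto simp: el split: if_splits\<close>)+
    then have 1: "(\<Sum>j\<in>- {z, l}. L (z, j) (j, l)) \<in> psi_range" "(\<Sum>j\<in>- {z, l}. L (j, j) (z, l)) \<in> psi_range"
      by (auto intro!: psi_range_sum)
    have "L (l, l) (z, l) + L (l, l) (z, l) = (\<Sum>i\<in>UNIV. L (i, i) (z, l))
        - (\<Sum>j\<in>- {z, l}. L (j, j) (z, l)) + (\<Sum>j\<in>- {z, l}. L (z, j) (j, l))"
      using rel[of z l] L_anti[of "(z, l)" "(l, l)"]
      by (simp add: split2[OF l] algebra_simps eq_neg_iff_add_eq_0)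
    then have "L (l, l) (z, l) + L (l, l) (z, l) \<in> psi_range"
      using 1 trL by (auto intro!: psi_range_add psi_range_diff)
    then show ?thesis by (rule half)
  qed
  have E3: "L (l, l) (l, z) \<in> psi_range" if l: "l \<noteq> z" for l
  proof -
    have "L (l, j) (j, z) \<in> psi_range" "L (j, j) (l, z) \<in> psi_range" if "j \<noteq> z" "j \<noteq> l" for j
      by (rule L1; use that l in \<open>auto simp: el split: if_splits\<close>)+
    then have 1: "(\<Sum>j\<in>- {z, l}. L (l, j) (j, z)) \<in> psi_range" "(\<Sum>j\<in>- {z, l}. L (j, j) (l, z)) \<in> psi_range"
      by (auto intro!: psi_range_sum)
    have "L (l, l) (l, z) + L (l, l) (l, z) = (\<Sum>i\<in>UNIV. L (i, i) (l, z))
        - (\<Sum>j\<in>- {z, l}. L (j, j) (l, z)) - (\<Sum>j\<in>- {z, l}. L (l, j) (j, z))"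
      using rel[of l z] L_anti[of "(l, z)" "(z, z)"]
      by (simp add: split2[OF l] algebra_simps eq_neg_iff_add_eq_0)
    then have "L (l, l) (l, z) + L (l, l) (l, z) \<in> psi_range"
      using 1 trL by (auto intro!: psi_range_diff)
    then show ?thesis by (rule half)
  qed
  have L2: "L a b \<in> psi_range" if "a \<noteq> (z, z)" "b \<noteq> (z, z)" for a b
  proof (cases "{a, b} \<in> elim_pairs z")
    case True
    then obtain i l where "(i, l) \<noteq> (z, z)" "{a, b} = elim_pair z (i, l)" by (auto simp: elim_pairs_iff)
    then obtain a' b' where "{a, b} = {a', b'}" and L': "L a' b' \<in> psi_range"
      using E1 E2 E3 by (cases "i = z"; cases "l = z") (auto simp: elim_pair_def)
    then show ?thesis
      using psi_range_neg[OF L'] L_anti[of a' b'] by (auto simp: doubleton_eq_iff)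
  qed (use L1 that in blast)
  have L3: "L (z, z) b \<in> psi_range" if "\<And>i. i \<noteq> z \<Longrightarrow> L (i, i) b \<in> psi_range" for b
  proof -
    have "L (z, z) b = (\<Sum>i\<in>UNIV. L (i, i) b) - (\<Sum>i\<in>- {z}. L (i, i) b)" by (simp add: split1)
    then show ?thesis using that trL[of b] by (auto intro!: R)
  qed
  have L4: "L (z, z) b \<in> psi_range" if "b \<noteq> (z, z)" for b using L2 that by (intro L3) auto
  have L5: "L a b \<in> psi_range"
  proof (cases "a = (z, z)"; cases "b = (z, z)")
    assume "a \<noteq> (z, z)" "b = (z, z)"
    then show ?thesis unfolding L_anti[of a b] using L4[of a] by (auto intro: psi_range_neg)
  qed (use L2 L4 L_self psi_range_zero in auto)
  have "entry a x * entry b y + entry a x * entry b y = S a b + L a b" by (simp add: S_def L_def)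
  then show ?thesis using half S4 L5 psi_range_add by metis
qed

lemma coord_alg_const_plus_J: "a \<in> R \<Longrightarrow> \<exists>q. a - q *\<^sub>Q 1 \<in> J1"
proof -
  let ?T = "{a \<in> R. \<exists>q. a - q *\<^sub>Q 1 \<in> J1}"
  note Rs = subalgebraD[OF coord_alg_subalgebra]
  have "subalgebra ?T"
    unfolding subalgebra_def
  proof (intro conjI ballI)
    show "ratvec.subspace ?T"
    proof (rule ratvec.subspaceI)
      show "0 \<in> ?T" using ratvec.subspace_0[OF J_subspace] ratvec.subspace_0[OF Rs(1)]
        by (auto intro!: exI[of _ 0])
    next
      fix a b assume "a \<in> ?T" "b \<in> ?T"
      then obtain q r where "a \<in> R" "b \<in> R" "a - q *\<^sub>Q 1 \<in> J1" "b - r *\<^sub>Q 1 \<in> J1" by blast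
      moreover from this have "a + b - (q + r) *\<^sub>Q 1 \<in> J1"
        unfolding scaleQ_add_left by (intro J_cong_add)
      ultimately show "a + b \<in> ?T" using ratvec.subspace_add[OF Rs(1)] by blast
    next
      fix r a assume "a \<in> ?T"
      then obtain q where "a \<in> R" "a - q *\<^sub>Q 1 \<in> J1" by blast
      moreover from this have "r *\<^sub>Q a - (r * q) *\<^sub>Q 1 \<in> J1"
        unfolding scaleQ_scaleQ[symmetric] by (intro J_cong_scale)
      ultimately show "r *\<^sub>Q a \<in> ?T" using ratvec.subspace_scale[OF Rs(1)] by blast
    qed
    show "1 \<in> ?T" using Rs(2) ratvec.subspace_0[OF J_subspace] by (auto intro!: exI[of _ 1])
  next
    fix a b assume "a \<in> ?T" "b \<in> ?T"
    then obtain q r where ab: "a \<in> R" "b \<in> R" "a - q *\<^sub>Q 1 \<in> J1" "b - r *\<^sub>Q 1 \<in> J1" by blast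
    have "a * (b - r *\<^sub>Q 1) + r *\<^sub>Q (a - q *\<^sub>Q 1) \<in> J1"
      using ab by (intro ratvec.subspace_add[OF J_subspace] ratvec.subspace_scale[OF J_subspace] idealD(4)[OF J_is_ideal])
    then have "a * b - (r * q) *\<^sub>Q 1 \<in> J1"
      by (simp add: right_diff_distrib scaleQ_mult_fun ratvec.scale_right_diff_distrib)
    then show "a * b \<in> ?T" using Rs(3) ab by blast
  qed
  moreover have "acoef i j x \<in> ?T" for i j x
  proof -
    have "(if i = j then 1 else 0) *\<^sub>Q 1 = (if i = j then 1 else 0 :: ('h, 'm) slrep \<Rightarrow> complex)" by simp
    then have "acoef i j x - (if i = j then 1 else 0) *\<^sub>Q 1 = scoef i j x" by (simp only: scoef_def)
    then have "acoef i j x - (if i = j then 1 else 0) *\<^sub>Q 1 \<in> J1" using scoef_in_J by simp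
    then show ?thesis using acoef_in_coord_alg by blast
  qed
  ultimately have "subalgebra hull {acoef i j x | i j x. True} \<subseteq> ?T" by (intro hull_minimal) blast
  then show "a \<in> R \<Longrightarrow> \<exists>q. a - q *\<^sub>Q 1 \<in> J1" unfolding coord_alg_def by blast
qed

text \<open>Since the coordinate algebra is \<open>\<rat> + J\<close>, multiples of an entry are rational multiples up to
  \<open>J\<^sup>2\<close>.\<close>

lemma J1_span_entries:
  assumes "f \<in> J1"
  obtains g where "g \<in> ratvec.span {entry a x | a x. True}" "f - g \<in> J2"
proof -
  let ?E = "{entry a x | a x. True} :: (('h, 'm) slrep \<Rightarrow> complex) set"
  let ?T = "{f. \<exists>g\<in>ratvec.span ?E. f - g \<in> J2}"
  have T: "ratvec.subspace ?T"
  proof (rule ratvec.subspaceI)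
    show "0 \<in> ?T" by (intro CollectI bexI[of _ 0]) (simp_all add: ratvec.span_zero ratvec.subspace_0[OF J_subspace])
  next
    fix f f' assume "f \<in> ?T" "f' \<in> ?T"
    then obtain g g' where "g \<in> ratvec.span ?E" "g' \<in> ratvec.span ?E"
      and fg: "f - g \<in> J2" "f' - g' \<in> J2" by blast
    then show "f + f' \<in> ?T" using J_cong_add[OF fg] ratvec.span_add by blast
  next
    fix q f assume "f \<in> ?T"
    then obtain g where "g \<in> ratvec.span ?E" and fg: "f - g \<in> J2" by blast
    then show "q *\<^sub>Q f \<in> ?T" using J_cong_scale[OF fg] ratvec.span_scale by blast
  qed
  have "is_ideal R hull {scoef i j x | i j x. x \<in> B} \<subseteq> ?T"
  proof (rule ideal_hull_subset_subspace[OF coord_alg_subalgebra T])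
    fix a f :: "('h, 'm) slrep \<Rightarrow> complex"
    assume a: "a \<in> R" and "f \<in> {scoef i j x |i j x. x \<in> B}"
    then obtain i j x where f: "f = entry (i, j) x" by (auto simp: entry_def)
    obtain q where "a - q *\<^sub>Q 1 \<in> J1" using coord_alg_const_plus_J[OF a] by blast
    then have "(a - q *\<^sub>Q 1) * f \<in> J2" unfolding f by (intro J_mult entry_in_J)
    then have "a * f - q *\<^sub>Q f \<in> J2" by (simp add: left_diff_distrib scaleQ_mult_fun)
    moreover have "q *\<^sub>Q f \<in> ratvec.span ?E" unfolding f by (intro ratvec.span_scale ratvec.span_base) blast
    ultimately show "a * f \<in> ?T" by blast
  qed (use scoef_in_coord_alg in blast)
  then have "J1 \<subseteq> ?T" unfolding J_one by (simp only: J_ideal_def)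
  then show ?thesis using assms that by blast
qed

lemma span_mult_in_psi_range:
  assumes "f \<in> ratvec.span {entry a x | a x. True}" "g \<in> ratvec.span {entry a x | a x. True}"
  shows "f * g \<in> psi_range"
  using assms(1)
proof (induction rule: ratvec.span_induct_alt)
  case (step c f f')
  from assms(2) have "f * g \<in> psi_range"
  proof (induction rule: ratvec.span_induct_alt)
    case (step r g g')
    then have "f * g \<in> psi_range" using \<open>f \<in> {entry a x |a x. True}\<close> entry_mult_in_psi_range by blast
    then show ?case
      unfolding distrib_left scaleQ_mult_fun using step by (intro psi_range_add psi_range_scale)
  qed (simp only: mult_zero_right psi_range_zero)
  then show ?case
    unfolding distrib_right scaleQ_mult_fun using step by (intro psi_range_add psi_range_scale)
qed (simp only: mult_zero_left psi_range_zero)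

lemma J2_subset_psi_range: "J2 \<subseteq> psi_range"
proof -
  have prod: "f * g \<in> psi_range" if "f \<in> J1" "g \<in> J1" for f g
  proof -
    let ?E = "{entry a x | a x. True} :: (('h, 'm) slrep \<Rightarrow> complex) set"
    obtain f' where f': "f' \<in> ratvec.span ?E" "f - f' \<in> J2" using J1_span_entries[OF \<open>f \<in> J1\<close>] .
    obtain g' where g': "g' \<in> ratvec.span ?E" "g - g' \<in> J2" using J1_span_entries[OF \<open>g \<in> J1\<close>] .
    have "ratvec.span ?E \<subseteq> J1" using entry_in_J by (intro ratvec.span_minimal J_subspace) blast
    then have "f * g - f' * g' \<in> J3" using f' g' that by (intro J_cong_mult) auto
    then show ?thesis using span_mult_in_psi_range[OF f'(1) g'(1)] by (rule psi_range_cong)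
  qed
  show ?thesis
    unfolding ideal_power.simps(2)[of R "J_ideal B" "Suc 0"]
  proof (rule ideal_hull_subset_subspace[OF coord_alg_subalgebra psi_range_subspace])
    show "{f * g |f g. f \<in> J1 \<and> g \<in> J_ideal B} \<subseteq> R"
      using subalgebraD(3)[OF coord_alg_subalgebra] idealD(1)[OF J_is_ideal[of "Suc 0"]]
        idealD(1)[OF J_ideal_is_ideal[of B]] by blast
    fix a h :: "('h, 'm) slrep \<Rightarrow> complex"
    assume a: "a \<in> R" and "h \<in> {f * g |f g. f \<in> J1 \<and> g \<in> J_ideal B}"
    then obtain f g where h: "h = f * g" "f \<in> J1" "g \<in> J_ideal B" by blast
    have "(a * f) * g \<in> psi_range"
      using h a by (intro prod idealD(4)[OF J_is_ideal]) (auto simp: J_one)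
    then show "a * h \<in> psi_range" by (simp add: h mult.assoc)
  qed
qed

end

section \<open>Curves of representations through the trivial one\<close>

subsection \<open>Integer powers of a matrix\<close>

definition mpow :: "complex^'m^'m::finite \<Rightarrow> int \<Rightarrow> complex^'m^'m" where
  "mpow M k = (if 0 \<le> k then ((**) M ^^ nat k) (mat 1) else ((**) (matrix_inv M) ^^ nat (- k)) (mat 1))"

lemma mpow_zero [simp]: "mpow M 0 = mat 1"
  by (simp add: mpow_def)

lemma matrix_inv_mult:
  fixes M :: "'a::semiring_1^'m^'m::finite"
  assumes "invertible M"
  shows "M ** matrix_inv M = mat 1" "matrix_inv M ** M = mat 1"
  using someI_ex[OF assms[unfolded invertible_def]] by (auto simp: matrix_inv_def)

lemma invertible_cancel_left:
  fixes M :: "'a::semiring_1^'m^'m::finite" and A A' :: "'a^'m^'m"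
  assumes "invertible M"
  shows "M ** A = M ** A' \<longleftrightarrow> A = A'"
  by (metis matrix_inv_mult(2)[OF assms] matrix_mul_assoc matrix_mul_lid)

lemma mpow_succ:
  assumes "invertible M"
  shows "mpow M (k + 1) = M ** mpow M k"
proof (cases "0 \<le> k")
  case True
  then have "nat (k + 1) = Suc (nat k)" by simp
  then show ?thesis using True by (simp add: mpow_def)
next
  case False
  then have "nat (- k) = Suc (nat (- (k + 1)))" by simp
  then have "mpow M k = matrix_inv M ** ((**) (matrix_inv M) ^^ nat (- (k + 1))) (mat 1)"
    using False by (simp only: mpow_def if_False funpow.simps o_apply)
  also have "((**) (matrix_inv M) ^^ nat (- (k + 1))) (mat 1) = mpow M (k + 1)"
    using False by (cases "k = -1") (auto simp: mpow_def)
  finally show ?thesis using assms by (simp add: matrix_mul_assoc matrix_inv_mult)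
qed

lemma mpow_one [simp]: "mpow M 1 = M"
  by (simp add: mpow_def)

lemma int_step_induct:
  assumes "P 0" "\<And>k::int. P (k + 1) \<longleftrightarrow> P k"
  shows "P k"
proof (induction k rule: int_induct[of _ 0])
  case (step2 i)
  then show ?case using assms(2)[of "i - 1"] by simp
qed (use assms in auto)

lemma mpow_add:
  assumes "invertible M"
  shows "mpow M (j + k) = mpow M j ** mpow M k"
proof -
  show ?thesis
  proof (induction j rule: int_step_induct)
    case (2 j)
    have "j + 1 + k = (j + k) + 1" by simp
    then show ?case by (simp only: mpow_succ[OF assms] matrix_mul_assoc[symmetric]
        invertible_cancel_left[OF assms])
  qed simp
qed

lemma mpow_commute:
  assumes "invertible M" "N ** M = M ** N"
  shows "N ** mpow M k = mpow M k ** N"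
proof (induction k rule: int_step_induct)
  case (2 k)
  have "N ** mpow M (k + 1) = M ** (N ** mpow M k)"
    by (simp add: mpow_succ[OF assms(1)] matrix_mul_assoc assms(2))
  moreover have "mpow M (k + 1) ** N = M ** (mpow M k ** N)"
    by (simp add: mpow_succ[OF assms(1)] matrix_mul_assoc)
  ultimately show ?case by (simp add: invertible_cancel_left[OF assms(1)])
qed simp

lemma mpow_det:
  assumes "det M = 1"
  shows "det (mpow M k) = 1"
proof -
  have "invertible M" using assms by (simp add: invertible_det_nz)
  then show ?thesis
    by (induction k rule: int_step_induct) (simp_all add: mpow_succ det_mul assms)
qed

subsection \<open>Representations supported on two basis elements\<close>

context free_abelian
begin

text \<open>Independence tests only need directions supported on two basis elements, so a product of two
  integer powers suffices in place of a product over the basis.\<close>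

lemma representation_two:
  fixes M N :: "complex^'m^'m"
  assumes pq: "p \<in> B" "q \<in> B" "p \<noteq> q" and M: "det M = 1" and N: "det N = 1" and MN: "M ** N = N ** M"
  obtains \<rho> :: "('h, 'm) slrep" where "apply_rep \<rho> p = M" "apply_rep \<rho> q = N"
    "\<And>b. b \<in> B \<Longrightarrow> b \<noteq> p \<Longrightarrow> b \<noteq> q \<Longrightarrow> apply_rep \<rho> b = mat 1"
proof -
  have ind: "\<not> zmod.dependent B" and span: "zmod.span B = UNIV" using basis by (simp_all add: zbasis_def)
  define r where "r = zmod.representation B"
  have r_add: "r (x + y) b = r x b + r y b" for x y b
    unfolding r_def by (simp add: zmod.representation_add ind span)
  have r_basis: "r c b = (if b = c then 1 else 0)" if "c \<in> B" for b c
    unfolding r_def using zmod.representation_basis[OF ind that] by simp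
  have inv: "invertible M" "invertible N" using M N by (simp_all add: invertible_det_nz)
  have c1: "N ** mpow M k = mpow M k ** N" for k
    by (rule mpow_commute[OF inv(1)]) (simp add: MN)
  have comm: "mpow M k ** mpow N l = mpow N l ** mpow M k" for k l
    by (rule mpow_commute[OF inv(2)]) (simp add: c1)
  define \<rho> where "\<rho> x = mpow M (r x p) ** mpow N (r x q)" for x
  have "\<rho> (x + y) = \<rho> x ** \<rho> y" for x y
  proof -
    have "\<rho> (x + y) = mpow M (r x p) ** (mpow M (r y p) ** mpow N (r x q)) ** mpow N (r y q)"
      by (simp add: \<rho>_def r_add mpow_add inv matrix_mul_assoc)
    then show ?thesis by (simp only: comm) (simp add: \<rho>_def matrix_mul_assoc)
  qed
  moreover have "det (\<rho> x) = 1" for x by (simp add: \<rho>_def det_mul mpow_det M N)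
  ultimately have "apply_rep (Slrep \<rho>) = \<rho>" by (intro Slrep_inverse) simp
  then show ?thesis
    using pq by (intro that[of "Slrep \<rho>"]) (simp_all add: \<rho>_def r_basis)
qed

end

subsection \<open>Scaling \<open>1 + t X\<close> into the special linear group\<close>

lemma root_dist_one:
  assumes "n > 0" "y > 0"
  shows "\<bar>root n y - 1\<bar> \<le> \<bar>y - 1\<bar>"
proof -
  define r where "r = root n y"
  have r: "r > 0" "r ^ n = y" using assms by (simp_all add: r_def)
  obtain k where n: "n = Suc k" using assms(1) by (cases n) auto
  have "y - 1 = (r - 1) * (\<Sum>i<n. r ^ i)" using r(2) power_diff_1_eq[of r n] by simp
  moreover have "(\<Sum>i<n. r ^ i) \<ge> 1"
    unfolding n sum.lessThan_Suc_shift using r(1) by (simp add: sum_nonneg)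
  ultimately show ?thesis unfolding r_def[symmetric]
    by (simp add: abs_mult mult_le_cancel_left1)
qed

lemma det_scaleR: "det (c *\<^sub>R (A :: real^'m^'m::finite)) = c ^ CARD('m) * det A"
proof -
  have "c *\<^sub>R A = (\<chi> i. c *s (A $ i))" by (simp add: vec_eq_iff)
  then show ?thesis using det_rows_mul[of "\<lambda>_. c" "\<lambda>i. A $ i"] by simp
qed

lemma det_of_real: "det ((\<chi> i j. of_real (A $ i $ j)) :: complex^'m^'m) = of_real (det (A :: real^'m^'m::finite))"
  by (simp add: det_def)

text \<open>The determinant of \<open>1 + t X\<close> is close to \<open>1\<close> for small \<open>t\<close>, and dividing by a root of it stays
  within the algebra generated by \<open>X\<close>, so curves in commuting directions commute. The value \<open>1\<close> is
  a default where the determinant is not positive.\<close>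

definition sl_curve :: "real^'m^'m::finite \<Rightarrow> real \<Rightarrow> real^'m^'m" where
  "sl_curve X t = (let M = mat 1 + t *\<^sub>R X in
     if det M > 0 then root CARD('m) (inverse (det M)) *\<^sub>R M else mat 1)"

lemma det_sl_curve: "det (sl_curve X t) = 1"
  by (simp add: sl_curve_def Let_def det_scaleR)

lemma sl_curve_commute:
  assumes "X ** Y = Y ** (X :: real^'m^'m::finite)"
  shows "sl_curve X t ** sl_curve Y t = sl_curve Y t ** sl_curve X t"
proof -
  have "(a *\<^sub>R mat 1 + b *\<^sub>R X) ** (c *\<^sub>R mat 1 + d *\<^sub>R Y) = (c *\<^sub>R mat 1 + d *\<^sub>R Y) ** (a *\<^sub>R mat 1 + b *\<^sub>R X)" for a b c d
    using assms by (simp add: matrix_mult_bilinear scaleR_add_right add_ac mult_ac)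
  moreover have "\<exists>a b. sl_curve Z t = a *\<^sub>R mat 1 + b *\<^sub>R Z" for Z :: "real^'m^'m"
  proof (cases "det (mat 1 + t *\<^sub>R Z) > 0")
    case True
    let ?r = "root CARD('m) (inverse (det (mat 1 + t *\<^sub>R Z)))"
    show ?thesis
      by (intro exI[of _ ?r] exI[of _ "?r * t"]) (simp add: sl_curve_def Let_def True scaleR_add_right)
  next
    case False
    then show ?thesis by (intro exI[of _ 1] exI[of _ 0]) (simp add: sl_curve_def Let_def)
  qed
  ultimately show ?thesis by metis
qed

text \<open>The sets \<open>?C k\<close> of germs that are divisible by \<open>t\<^sup>k\<close> turn the expansion of \<open>det (1 + S)\<close> into a
  second-order estimate.\<close>

lemma det_one_plus_tendsto:
  fixes X :: "real^'m^'m::finite"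
  assumes "trace X = 0"
  shows "((\<lambda>t. (det (mat 1 + t *\<^sub>R X) - 1) / t) \<longlongrightarrow> 0) (at_right 0)"
proof -
  let ?C = "\<lambda>k. {g :: real \<Rightarrow> real. \<exists>L. ((\<lambda>t. g t / t ^ k) \<longlongrightarrow> L) (at_right 0)}"
  let ?M = "(\<chi> i j. (if i = j then 1 else 0) + (\<lambda>t. t * X $ i $ j)) :: (real \<Rightarrow> real)^'m^'m"
  have tt: "((\<lambda>t::real. t) \<longlongrightarrow> 0) (at_right 0)" by (rule tendsto_ident_at)
  have mult: "f * g \<in> ?C (k + l)" if f: "f \<in> ?C k" and g: "g \<in> ?C l" for f g k l
  proof -
    obtain F G where "((\<lambda>t. f t / t ^ k) \<longlongrightarrow> F) (at_right 0)" "((\<lambda>t. g t / t ^ l) \<longlongrightarrow> G) (at_right 0)"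
      using f g by auto
    from tendsto_mult[OF this] show ?thesis by (auto simp: power_add times_divide_times_eq)
  qed
  have add: "f + g \<in> ?C k" if f: "f \<in> ?C k" and g: "g \<in> ?C k" for f g k
  proof -
    obtain F G where "((\<lambda>t. f t / t ^ k) \<longlongrightarrow> F) (at_right 0)" "((\<lambda>t. g t / t ^ k) \<longlongrightarrow> G) (at_right 0)"
      using f g by auto
    from tendsto_add[OF this] show ?thesis by (auto simp: add_divide_distrib)
  qed
  have neg: "- f \<in> ?C k" if f: "f \<in> ?C k" for f k
    using f by (auto dest: tendsto_minus)
  have zero: "0 \<in> ?C k" for k by auto
  have "det ?M - 1 - (\<Sum>i\<in>UNIV. (\<chi> i j. (\<lambda>t. t * X $ i $ j)) $ i $ i) \<in> ?C 2"
  proof (rule det_one_plus[where A = "?C 0" and I = "?C 1"])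
    show "?C 1 \<subseteq> ?C 0"
    proof clarify
      fix g :: "real \<Rightarrow> real" and L assume "((\<lambda>t. g t / t ^ 1) \<longlongrightarrow> L) (at_right 0)"
      from tendsto_mult[OF this tt] have "((\<lambda>t. g t / t ^ 1 * t) \<longlongrightarrow> 0) (at_right 0)" by simp
      then have "(g \<longlongrightarrow> 0) (at_right 0)"
        by (rule Lim_transform_eventually) (auto simp: eventually_at_filter)
      then show "\<exists>L. ((\<lambda>t. g t / t ^ 0) \<longlongrightarrow> L) (at_right 0)" by auto
    qed
    show "(\<chi> i j. (\<lambda>t. t * X $ i $ j)) $ i $ j \<in> ?C 1" for i j
    proof -
      have "((\<lambda>t. t * X $ i $ j / t ^ 1) \<longlongrightarrow> X $ i $ j) (at_right 0)"
        by (rule Lim_transform_eventually[OF tendsto_const]) (auto simp: eventually_at_filter)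
      then show ?thesis by auto
    qed
    have "((\<lambda>t::real. 1::real) \<longlongrightarrow> 1) (at_right 0)" by (rule tendsto_const)
    then show "1 \<in> ?C 0" by (auto simp: one_fun_def)
    show "f * g \<in> ?C 0" if "f \<in> ?C 0" "g \<in> ?C 0" for f g using mult[OF that] by simp
    show "f * g \<in> ?C 2" if "f \<in> ?C 0" "g \<in> ?C 2" for f g
      using mult[OF that] unfolding add_0 .
    show "f * g \<in> ?C 2" if "f \<in> ?C 1" "g \<in> ?C 1" for f g
      using mult[OF that] unfolding one_add_one .
  qed (simp_all only: vec_lambda_beta add zero neg)
  moreover have "(\<Sum>i\<in>UNIV. (\<chi> i j. (\<lambda>t. t * X $ i $ j)) $ i $ i) = (0 :: real \<Rightarrow> real)"
    using assms by (simp add: fun_eq_iff sum_fun_apply trace_def flip: sum_distrib_left)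
  moreover have "det ?M t = det (mat 1 + t *\<^sub>R X)" for t
  proof -
    have "(of_int (sign p) :: real \<Rightarrow> real) t = of_int (sign p)" for p :: "'m \<Rightarrow> 'm"
      by (cases p rule: sign_cases) simp_all
    then show ?thesis
      by (simp add: det_def sum_fun_apply prod_fun_apply mat_def if_distrib[of "\<lambda>f. f _"] cong: if_cong)
  qed
  ultimately obtain L where "((\<lambda>t. (det (mat 1 + t *\<^sub>R X) - 1) / t\<^sup>2) \<longlongrightarrow> L) (at_right 0)" by auto
  from tendsto_mult[OF this tt] have "((\<lambda>t. (det (mat 1 + t *\<^sub>R X) - 1) / t\<^sup>2 * t) \<longlongrightarrow> 0) (at_right 0)" by simp
  then show ?thesis
    by (rule Lim_transform_eventually) (auto simp: eventually_at_filter power2_eq_square)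
qed

lemma sl_curve_tendsto:
  fixes X :: "real^'m^'m::finite"
  assumes "trace X = 0"
  shows "((\<lambda>t. (sl_curve X t $ i $ j - (if i = j then 1 else 0)) / t) \<longlongrightarrow> X $ i $ j) (at_right 0)"
proof -
  define d where "d t = det (mat 1 + t *\<^sub>R X)" for t
  define c where "c t = root CARD('m) (inverse (d t))" for t
  have tt: "((\<lambda>t::real. t) \<longlongrightarrow> 0) (at_right 0)" by (rule tendsto_ident_at)
  have nz: "\<forall>\<^sub>F t::real in at_right 0. t \<noteq> 0" by (auto simp: eventually_at_filter)
  have d': "((\<lambda>t. (d t - 1) / t) \<longlongrightarrow> 0) (at_right 0)"
    unfolding d_def by (rule det_one_plus_tendsto[OF assms])
  from tendsto_add[OF tendsto_mult[OF this tt] tendsto_const[of 1]]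
  have "((\<lambda>t. (d t - 1) / t * t + 1) \<longlongrightarrow> 1) (at_right 0)" by simp
  then have d: "(d \<longlongrightarrow> 1) (at_right 0)"
    by (rule Lim_transform_eventually) (use nz in eventually_elim, simp)
  then have pos: "\<forall>\<^sub>F t in at_right 0. d t > 0" by (rule order_tendstoD) simp
  have "((\<lambda>t. inverse (d t) * ((d t - 1) / t)) \<longlongrightarrow> inverse 1 * 0) (at_right 0)"
    by (intro tendsto_intros d d') simp
  then have lim: "((\<lambda>t. \<bar>inverse (d t) * ((d t - 1) / t)\<bar>) \<longlongrightarrow> 0) (at_right 0)"
    by (intro tendsto_rabs_zero) simp
  have c': "((\<lambda>t. (c t - 1) / t) \<longlongrightarrow> 0) (at_right 0)"
  proof (rule tendsto_0_le[OF lim, where K = 1])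
    show "\<forall>\<^sub>F t in at_right 0. norm ((c t - 1) / t) \<le> norm \<bar>inverse (d t) * ((d t - 1) / t)\<bar> * 1"
      using pos nz
    proof eventually_elim
      case (elim t)
      have "\<bar>c t - 1\<bar> \<le> \<bar>inverse (d t) - 1\<bar>" unfolding c_def using elim by (intro root_dist_one) auto
      also have "inverse (d t) - 1 = - (inverse (d t) * (d t - 1))" using elim by (simp add: field_simps)
      finally show ?case using elim by (simp add: abs_mult divide_right_mono)
    qed
  qed
  from tendsto_add[OF tendsto_mult[OF c' tt] tendsto_const[of 1]]
  have "((\<lambda>t. (c t - 1) / t * t + 1) \<longlongrightarrow> 1) (at_right 0)" by simp
  then have c: "(c \<longlongrightarrow> 1) (at_right 0)"
    by (rule Lim_transform_eventually) (use nz in eventually_elim, simp)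
  have "((\<lambda>t. (c t - 1) / t * (if i = j then 1 else 0) + c t * X $ i $ j) \<longlongrightarrow> 0 * (if i = j then 1 else 0) + 1 * X $ i $ j) (at_right 0)"
    by (intro tendsto_intros c c')
  then have *: "((\<lambda>t. (c t - 1) / t * (if i = j then 1 else 0) + c t * X $ i $ j) \<longlongrightarrow> X $ i $ j) (at_right 0)" by simp
  show ?thesis
  proof (rule Lim_transform_eventually[OF *])
    show "\<forall>\<^sub>F t in at_right 0. (c t - 1) / t * (if i = j then 1 else 0) + c t * X $ i $ j
      = (sl_curve X t $ i $ j - (if i = j then 1 else 0)) / t"
      using pos nz
    proof eventually_elim
      case (elim t)
      then have "sl_curve X t = c t *\<^sub>R (mat 1 + t *\<^sub>R X)"
        by (simp add: sl_curve_def Let_def c_def d_def)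
      then show ?case using elim by (simp add: mat_def field_simps)
    qed
  qed
qed

subsection \<open>Leading terms along a curve\<close>

definition cmat :: "real^'m^'m \<Rightarrow> complex^'m^'m::finite" where
  "cmat A = (\<chi> i j. of_real (A $ i $ j))"

lemma of_real_of_rat: "complex_of_real (of_rat q) = of_rat q"
  by (cases q) (simp add: of_rat_rat)

lemma cmat_mult: "cmat (A ** B) = cmat A ** cmat B"
  by (simp add: cmat_def matrix_matrix_mult_def vec_eq_iff)

lemma det_cmat: "det (cmat A) = of_real (det A)"
  unfolding cmat_def by (rule det_of_real)

text \<open>The coefficients of \<open>\<rho>(-x)\<close> are polynomials in those of \<open>\<rho>(x)\<close> as \<open>det \<rho>(x) = 1\<close>. Together with
  multiplicativity this bounds all coordinate functions along a curve once the values at basis elements are bounded.\<close>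

lemma acoef_uminus_cramer:
  fixes \<rho> :: "('h::ab_group_add, 'm::finite) slrep"
  shows
  "acoef k j (- x) \<rho> = det (\<chi> i l. if l = k then (if i = j then 1 else 0) else acoef i l x \<rho>)"
proof -
  let ?A = "apply_rep \<rho> x" and ?b = "axis j 1 :: complex^'m"
  have "?A ** apply_rep \<rho> (- x) = mat 1"
    by (simp add: apply_rep_zero flip: apply_rep_add)
  then have "?A *v column j (apply_rep \<rho> (- x)) = ?b"
    by (simp add: vec_eq_iff matrix_matrix_mult_def matrix_vector_mult_def column_def mat_def axis_def)
  then have "column j (apply_rep \<rho> (- x)) $ k = det (\<chi> i l. if l = k then ?b $ i else ?A $ i $ l)"
    by (subst (asm) cramer) (simp_all add: apply_rep_det)
  then show ?thesis by (simp add: column_def acoef_def axis_def cong: if_cong)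
qed

context free_abelian
begin

lemma curve_exists:
  fixes X Y :: "real^'m^'m"
  assumes pq: "p \<in> B" "q \<in> B" "p \<noteq> q" and tr: "trace X = 0" "trace Y = 0" and XY: "X ** Y = Y ** X"
  obtains \<gamma> :: "real \<Rightarrow> ('h, 'm) slrep" where
    "\<And>a b. b \<in> B \<Longrightarrow> ((\<lambda>t. entry a b (\<gamma> t) / of_real t) \<longlongrightarrow>
        of_real ((if b = p then X else if b = q then Y else 0) $ fst a $ snd a)) (at_right 0)"
proof -
  have "\<exists>\<rho> :: ('h, 'm) slrep. apply_rep \<rho> p = cmat (sl_curve X t) \<and> apply_rep \<rho> q = cmat (sl_curve Y t)
      \<and> (\<forall>b\<in>B. b \<noteq> p \<longrightarrow> b \<noteq> q \<longrightarrow> apply_rep \<rho> b = mat 1)" for t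
    by (rule representation_two[OF pq, of "cmat (sl_curve X t)" "cmat (sl_curve Y t)"])
      (auto simp: det_cmat det_sl_curve sl_curve_commute[OF XY] simp flip: cmat_mult)
  then obtain \<gamma> :: "real \<Rightarrow> ('h, 'm) slrep" where
    \<gamma>: "\<And>t. apply_rep (\<gamma> t) p = cmat (sl_curve X t)" "\<And>t. apply_rep (\<gamma> t) q = cmat (sl_curve Y t)"
      "\<And>t b. b \<in> B \<Longrightarrow> b \<noteq> p \<Longrightarrow> b \<noteq> q \<Longrightarrow> apply_rep (\<gamma> t) b = mat 1" by metis
  have lim: "((\<lambda>t. entry a b (\<gamma> t) / of_real t) \<longlongrightarrow> of_real (Z $ fst a $ snd a)) (at_right 0)"
    if "\<And>t. apply_rep (\<gamma> t) b = cmat (sl_curve Z t)" "trace Z = 0" for a b and Z :: "real^'m^'m"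
  proof -
    have "entry a b (\<gamma> t) = of_real (sl_curve Z t $ fst a $ snd a - (if fst a = snd a then 1 else 0))" for t
      by (simp add: entry_def scoef_def acoef_def that(1) cmat_def)
    moreover have "((\<lambda>t. complex_of_real ((sl_curve Z t $ fst a $ snd a - (if fst a = snd a then 1 else 0)) / t))
        \<longlongrightarrow> of_real (Z $ fst a $ snd a)) (at_right 0)"
      by (rule tendsto_of_real[OF sl_curve_tendsto[OF that(2)]])
    ultimately show ?thesis by (simp only: of_real_divide)
  qed
  show ?thesis
  proof (rule that[of \<gamma>])
    fix a b assume b: "b \<in> B"
    consider "b = p" | "b = q" "b \<noteq> p" | "b \<noteq> p" "b \<noteq> q" by blast
    then show "((\<lambda>t. entry a b (\<gamma> t) / of_real t) \<longlongrightarrow>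
        of_real ((if b = p then X else if b = q then Y else 0) $ fst a $ snd a)) (at_right 0)"
    proof cases
      case 1 then show ?thesis using lim[OF \<gamma>(1) tr(1)] by simp
    next
      case 2 then show ?thesis using lim[OF \<gamma>(2) tr(2)] by simp
    next
      case 3
      then have "entry a b (\<gamma> t) = 0" for t
        using \<gamma>(3)[OF b] by (simp add: entry_def scoef_def acoef_def mat_def)
      then show ?thesis using 3 by simp
    qed
  qed
qed

context
  fixes \<gamma> :: "real \<Rightarrow> ('h, 'm) slrep" and A :: "'h \<Rightarrow> real^'m^'m"
  assumes \<gamma>: "\<And>a b. b \<in> B \<Longrightarrow>
    ((\<lambda>t. entry a b (\<gamma> t) / of_real t) \<longlongrightarrow> of_real (A b $ fst a $ snd a)) (at_right 0)"
begin

text \<open>Functions that vanish at least to order \<open>k\<close> along \<open>\<gamma>\<close> for \<open>t \<rightarrow> 0+\<close>.\<close>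

definition order_ge :: "nat \<Rightarrow> (('h, 'm) slrep \<Rightarrow> complex) set" where
  "order_ge k = {f. \<exists>L. ((\<lambda>t. f (\<gamma> t) / of_real t ^ k) \<longlongrightarrow> L) (at_right 0)}"

lemma order_ge_mult: "f \<in> order_ge k \<Longrightarrow> g \<in> order_ge l \<Longrightarrow> f * g \<in> order_ge (k + l)"
proof -
  assume "f \<in> order_ge k" "g \<in> order_ge l"
  then obtain F G where "((\<lambda>t. f (\<gamma> t) / of_real t ^ k) \<longlongrightarrow> F) (at_right 0)"
    "((\<lambda>t. g (\<gamma> t) / of_real t ^ l) \<longlongrightarrow> G) (at_right 0)" by (auto simp: order_ge_def)
  from tendsto_mult[OF this] show ?thesis by (auto simp: order_ge_def power_add times_divide_times_eq)
qed

lemma order_ge_subspace: "ratvec.subspace (order_ge k)"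
proof (rule ratvec.subspaceI)
  show "0 \<in> order_ge k" by (auto simp: order_ge_def)
next
  fix f g assume "f \<in> order_ge k" "g \<in> order_ge k"
  then obtain F G where "((\<lambda>t. f (\<gamma> t) / of_real t ^ k) \<longlongrightarrow> F) (at_right 0)"
    "((\<lambda>t. g (\<gamma> t) / of_real t ^ k) \<longlongrightarrow> G) (at_right 0)" by (auto simp: order_ge_def)
  from tendsto_add[OF this] show "f + g \<in> order_ge k" by (auto simp: order_ge_def add_divide_distrib)
next
  fix q f assume "f \<in> order_ge k"
  then obtain F where "((\<lambda>t. f (\<gamma> t) / of_real t ^ k) \<longlongrightarrow> F) (at_right 0)" by (auto simp: order_ge_def)
  from tendsto_mult[OF tendsto_const[of "of_rat q"] this] show "q *\<^sub>Q f \<in> order_ge k"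
    by (auto simp: order_ge_def scaleQ_fun_def scaleQ_complex_def)
qed

lemma order_ge_one: "1 \<in> order_ge 0"
  by (auto simp: order_ge_def)

lemma order_ge_0_sum_prod:
  "(\<And>k. k \<in> X \<Longrightarrow> f k \<in> order_ge 0) \<Longrightarrow> sum f X \<in> order_ge 0"
  "(\<And>k. k \<in> X \<Longrightarrow> f k \<in> order_ge 0) \<Longrightarrow> prod f X \<in> order_ge 0"
proof -
  show "(\<And>k. k \<in> X \<Longrightarrow> f k \<in> order_ge 0) \<Longrightarrow> sum f X \<in> order_ge 0"
    by (rule ratvec.subspace_sum[OF order_ge_subspace])
  show "(\<And>k. k \<in> X \<Longrightarrow> f k \<in> order_ge 0) \<Longrightarrow> prod f X \<in> order_ge 0"
    using order_ge_mult[of _ 0 _ 0]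
    by (induction X rule: infinite_finite_induct) (simp_all add: order_ge_one)
qed

lemma tendsto_of_real_zero: "((\<lambda>t::real. of_real t :: complex) \<longlongrightarrow> 0) (at_right 0)"
  using tendsto_of_real[OF tendsto_ident_at[of 0 "{0<..}"]] by simp

lemma acoef_order: "acoef i j x \<in> order_ge 0"
proof -
  have "\<forall>i j. acoef i j x \<in> order_ge 0"
  proof (rule zspan_induct_additive[of x B])
    show "x \<in> zmod.span B" using basis by (simp add: zbasis_def)
    show "\<forall>i j. acoef i j 0 \<in> order_ge 0"
      by (auto simp: acoef_def order_ge_def apply_rep_zero)
    show "\<forall>i j. acoef i j b \<in> order_ge 0" if "b \<in> B" for b
    proof (intro allI)
      fix i j :: 'm
      from tendsto_mult[OF \<gamma>[OF that, of "(i, j)"] tendsto_of_real_zero]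
      have "((\<lambda>t. entry (i, j) b (\<gamma> t) / of_real t * of_real t) \<longlongrightarrow> 0) (at_right 0)" by simp
      then have "((\<lambda>t. entry (i, j) b (\<gamma> t)) \<longlongrightarrow> 0) (at_right 0)"
        by (rule Lim_transform_eventually) (auto simp: eventually_at_filter)
      from tendsto_add[OF this tendsto_const[of "if i = j then 1 else 0"]]
      show "acoef i j b \<in> order_ge 0"
        by (auto simp: order_ge_def entry_def scoef_def if_distrib[of "\<lambda>f. f _"] cong: if_cong)
    qed
    show "\<forall>i j. acoef i j (y + y') \<in> order_ge 0"
      if "\<forall>i j. acoef i j y \<in> order_ge 0" "\<forall>i j. acoef i j y' \<in> order_ge 0" for y y'
    proof (intro allI)
      fix i j :: 'm
      have "acoef i j (y + y') = (\<Sum>k\<in>UNIV. acoef i k y * acoef k j y')"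
        by (rule ext) (simp add: acoef_def apply_rep_add matrix_matrix_mult_def sum_fun_apply)
      then show "acoef i j (y + y') \<in> order_ge 0"
        using that by (auto intro!: order_ge_0_sum_prod(1) order_ge_mult[of _ 0 _ 0, simplified])
    qed
    show "\<forall>i j. acoef i j (- y) \<in> order_ge 0" if "\<forall>i j. acoef i j y \<in> order_ge 0" for y
    proof (intro allI)
      fix k j :: 'm
      let ?m = "\<lambda>i l. if l = k then (if i = j then 1 else 0) else acoef i l y"
      have eq: "acoef k j (- y) = (\<Sum>p | p permutes UNIV. of_int (sign p) * (\<Prod>i\<in>UNIV. ?m i (p i)))"
      proof
        fix \<rho>
        have "(of_int (sign p) :: ('h, 'm) slrep \<Rightarrow> complex) \<rho> = of_int (sign p)" for p :: "'m \<Rightarrow> 'm"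
          by (cases p rule: sign_cases) simp_all
        then show "acoef k j (- y) \<rho> = (\<Sum>p | p permutes UNIV. of_int (sign p) * (\<Prod>i\<in>UNIV. ?m i (p i))) \<rho>"
          by (simp add: acoef_uminus_cramer det_def sum_fun_apply prod_fun_apply
              if_distrib[of "\<lambda>f. f _"] cong: if_cong)
      qed
      have sgn: "of_int (sign p) \<in> order_ge 0" for p :: "'m \<Rightarrow> 'm"
        using ratvec.subspace_neg[OF order_ge_subspace order_ge_one] order_ge_one
        by (cases p rule: sign_cases) simp_all
      have m: "?m i l \<in> order_ge 0" for i l
        using that order_ge_one ratvec.subspace_0[OF order_ge_subspace] by auto
      show "acoef k j (- y) \<in> order_ge 0"
        unfolding eq by (intro order_ge_0_sum_prod order_ge_mult[of _ 0 _ 0, simplified] sgn m)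
    qed
  qed
  then show ?thesis by blast
qed

lemma J_order: "J k \<subseteq> order_ge k"
proof -
  have R0: "R \<subseteq> order_ge 0"
    unfolding coord_alg_def
  proof (rule hull_minimal)
    show "subalgebra (order_ge 0)"
      using order_ge_mult[of _ 0 _ 0] by (simp add: subalgebra_def order_ge_subspace order_ge_one)
  qed (auto simp: acoef_order)
  have J1: "J_ideal B \<subseteq> order_ge (Suc 0)"
    unfolding J_ideal_def
  proof (rule ideal_hull_subset_subspace[OF coord_alg_subalgebra order_ge_subspace])
    fix a f :: "('h, 'm) slrep \<Rightarrow> complex"
    assume a: "a \<in> R" and "f \<in> {scoef i j x |i j x. x \<in> B}"
    then obtain i j x where f: "f = entry (i, j) x" and x: "x \<in> B" by (auto simp: entry_def)
    have "f \<in> order_ge (Suc 0)" unfolding f order_ge_def using \<gamma>[OF x, of "(i, j)"] by auto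
    then show "a * f \<in> order_ge (Suc 0)" using order_ge_mult[of a 0 f "Suc 0"] R0 a by auto
  qed (use scoef_in_coord_alg in blast)
  show ?thesis
  proof (induction k)
    case 0
    then show ?case using R0 by simp
  next
    case (Suc k)
    show ?case
      unfolding ideal_power.simps(2)
    proof (rule ideal_hull_subset_subspace[OF coord_alg_subalgebra order_ge_subspace])
      show "{f * g |f g. f \<in> J k \<and> g \<in> J_ideal B} \<subseteq> R"
        using subalgebraD(3)[OF coord_alg_subalgebra] idealD(1)[OF J_is_ideal[of k]]
          idealD(1)[OF J_ideal_is_ideal[of B]] by blast
      fix a h :: "('h, 'm) slrep \<Rightarrow> complex"
      assume a: "a \<in> R" and "h \<in> {f * g |f g. f \<in> J k \<and> g \<in> J_ideal B}"
      then obtain f g where h: "h = f * g" "f \<in> J k" "g \<in> J_ideal B" by blast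
      have "f * g \<in> order_ge (k + Suc 0)" using h Suc J1 by (intro order_ge_mult) auto
      from order_ge_mult[OF subsetD[OF R0 a] this] have "a * h \<in> order_ge (0 + (k + Suc 0))"
        unfolding h(1) .
      then show "a * h \<in> order_ge (Suc k)" by simp
    qed
  qed
qed

text \<open>Divide by \<open>t\<^sup>2\<close>: an element of \<open>J\<^sup>3\<close> tends to zero, a product of two entries to the product
  of the corresponding entries of the tangent directions.\<close>

lemma quadratic_leading_term:
  fixes K :: "'h \<Rightarrow> 'h \<Rightarrow> 'm \<times> 'm \<Rightarrow> 'm \<times> 'm \<Rightarrow> rat"
  assumes "(\<Sum>p\<in>B. \<Sum>q\<in>B. \<Sum>a\<in>UNIV. \<Sum>b\<in>UNIV. K p q a b *\<^sub>Q (entry a p * entry b q)) \<in> J3"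
  shows "(\<Sum>p\<in>B. \<Sum>q\<in>B. bform (\<lambda>a b. of_rat (K p q a b)) (A p) (A q)) = 0"
proof -
  let ?F = "\<Sum>p\<in>B. \<Sum>q\<in>B. \<Sum>a\<in>UNIV. \<Sum>b\<in>UNIV. K p q a b *\<^sub>Q (entry a p * entry b q)"
  let ?L = "\<Sum>p\<in>B. \<Sum>q\<in>B. \<Sum>a\<in>UNIV. \<Sum>b\<in>UNIV. of_rat (K p q a b) *
      (of_real (A p $ fst a $ snd a) * of_real (A q $ fst b $ snd b)) :: complex"
  obtain L where "((\<lambda>t. ?F (\<gamma> t) / of_real t ^ 3) \<longlongrightarrow> L) (at_right 0)"
    using subsetD[OF J_order assms] by (auto simp: order_ge_def eval_nat_numeral)
  from tendsto_mult[OF this tendsto_of_real_zero]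
  have "((\<lambda>t. ?F (\<gamma> t) / of_real t ^ 3 * of_real t) \<longlongrightarrow> 0) (at_right 0)" by simp
  then have zero: "((\<lambda>t. ?F (\<gamma> t) / of_real t ^ 2) \<longlongrightarrow> 0) (at_right 0)"
    by (rule Lim_transform_eventually) (auto simp: eventually_at_filter eval_nat_numeral)
  have "((\<lambda>t. \<Sum>p\<in>B. \<Sum>q\<in>B. \<Sum>a\<in>UNIV. \<Sum>b\<in>UNIV. of_rat (K p q a b) *
      (entry a p (\<gamma> t) / of_real t * (entry b q (\<gamma> t) / of_real t))) \<longlongrightarrow> ?L) (at_right 0)"
    by (intro tendsto_sum tendsto_mult tendsto_const \<gamma>)
  also have "(\<lambda>t. \<Sum>p\<in>B. \<Sum>q\<in>B. \<Sum>a\<in>UNIV. \<Sum>b\<in>UNIV. of_rat (K p q a b) *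
      (entry a p (\<gamma> t) / of_real t * (entry b q (\<gamma> t) / of_real t))) = (\<lambda>t. ?F (\<gamma> t) / of_real t ^ 2)"
    by (rule ext) (simp add: sum_fun_apply sum_divide_distrib scaleQ_fun_def scaleQ_complex_def
        power2_eq_square mult.assoc)
  finally have "?L = 0" using zero tendsto_unique[of "at_right (0::real)"] by force
  moreover have "?L = complex_of_real (\<Sum>p\<in>B. \<Sum>q\<in>B. bform (\<lambda>a b. of_rat (K p q a b)) (A p) (A q))"
    by (simp add: bform_def mult.assoc of_real_of_rat)
  ultimately show ?thesis by (simp only: of_real_eq_0_iff)
qed

end

text \<open>Among the commuting families of directions, those supported on \<open>{p, q}\<close> isolate the coefficients
  at \<open>p\<close> and \<open>q\<close>; setting one direction to zero first removes the diagonal terms.\<close>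

lemma quadratic_in_J3:
  fixes K :: "'h \<Rightarrow> 'h \<Rightarrow> 'm \<times> 'm \<Rightarrow> 'm \<times> 'm \<Rightarrow> rat"
  assumes F: "(\<Sum>p\<in>B. \<Sum>q\<in>B. \<Sum>a\<in>UNIV. \<Sum>b\<in>UNIV. K p q a b *\<^sub>Q (entry a p * entry b q)) \<in> J3"
    and pq: "p \<in> B" "q \<in> B" "p \<noteq> q" and tr: "trace X = 0" "trace Y = 0"
  shows "bform (\<lambda>a b. of_rat (K p p a b)) X X = 0"
    and "X ** Y = Y ** X \<Longrightarrow>
      bform (\<lambda>a b. of_rat (K p q a b)) X Y + bform (\<lambda>a b. of_rat (K q p a b)) Y X = 0"
proof -
  let ?b = "\<lambda>p q. bform (\<lambda>a b. of_rat (K p q a b))"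
  have *: "?b p p X X + ?b p q X Y + (?b q p Y X + ?b q q Y Y) = 0"
    if tr: "trace X = 0" "trace Y = 0" and XY: "X ** Y = Y ** X" for X Y
  proof -
    let ?A = "\<lambda>b. if b = p then X else if b = q then Y else 0"
    obtain \<gamma> :: "real \<Rightarrow> ('h, 'm) slrep" where \<gamma>: "\<And>a b. b \<in> B \<Longrightarrow>
        ((\<lambda>t. entry a b (\<gamma> t) / of_real t) \<longlongrightarrow> of_real (?A b $ fst a $ snd a)) (at_right 0)"
      using curve_exists[OF pq tr XY] by blast
    have "(\<Sum>r\<in>B. \<Sum>s\<in>B. ?b r s (?A r) (?A s)) = 0"
      by (rule quadratic_leading_term[OF \<gamma> F])
    also have "(\<Sum>r\<in>B. \<Sum>s\<in>B. ?b r s (?A r) (?A s)) = (\<Sum>r\<in>B. \<Sum>s\<in>{p, q}. ?b r s (?A r) (?A s))"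
      by (intro sum.cong refl sum.mono_neutral_right) (use pq finite_basis in \<open>auto simp: bform_zero\<close>)
    also have "\<dots> = (\<Sum>r\<in>{p, q}. \<Sum>s\<in>{p, q}. ?b r s (?A r) (?A s))"
      by (intro sum.mono_neutral_right) (use pq finite_basis in \<open>auto simp: bform_zero\<close>)
    finally show ?thesis using pq(3) by auto
  qed
  have pp: "?b p p X X = 0" if "trace X = 0" for X
    using *[OF that, of 0] by (simp add: bform_zero trace_def matrix_mult_bilinear)
  have qq: "?b q q Y Y = 0" if "trace Y = 0" for Y
    using *[OF _ that, of 0] by (simp add: bform_zero trace_def matrix_mult_bilinear)
  show "?b p p X X = 0" by (rule pp[OF tr(1)])
  show "X ** Y = Y ** X \<Longrightarrow> ?b p q X Y + ?b q p Y X = 0"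
    using *[OF tr] pp[OF tr(1)] qq[OF tr(2)] by simp
qed

end

section \<open>Independence\<close>

lemma linear_mod_sum2:
  assumes "ratvec.subspace K" "linear_mod K F" "finite X" "finite Y"
  shows "F (\<Sum>p\<in>X. \<Sum>q\<in>Y. c p q *\<^sub>Q v p q) - (\<Sum>p\<in>X. \<Sum>q\<in>Y. c p q *\<^sub>Q F (v p q)) \<in> K"
  using linear_mod_sum[OF assms(1,2), of "\<lambda>(p, q). c p q" "\<lambda>(p, q). v p q" "X \<times> Y"] assms(3,4)
  by (simp add: sum.cartesian_product case_prod_unfold)

lemma bform_swap: "bform C Y X = bform (\<lambda>a b. C b a) X Y"
  unfolding bform_def by (subst sum.swap) (simp add: mult_ac)

lemma bform_add_coeff: "bform C X Y + bform D X Y = bform (\<lambda>a b. C a b + D a b) X Y"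
  by (simp add: bform_def sum.distrib algebra_simps)

context free_abelian
begin

lemma sum_swap_sym:
  fixes c :: "'h \<Rightarrow> 'h \<Rightarrow> rat"
  assumes "\<And>p q. c p q = e * c q p" "e * e = 1"
  shows "(\<Sum>p\<in>B. \<Sum>q\<in>B. c p q *\<^sub>Q (f p * g q + e *\<^sub>Q (g p * f q)))
    = (\<Sum>p\<in>B. \<Sum>q\<in>B. (2 * c p q) *\<^sub>Q (f p * (g q :: 'x \<Rightarrow> complex)))"
proof -
  have ee: "e * (e * x) = x" for x using assms(2) by (simp flip: mult.assoc)
  have "(\<Sum>p\<in>B. \<Sum>q\<in>B. c p q *\<^sub>Q e *\<^sub>Q (g p * f q)) = (\<Sum>p\<in>B. \<Sum>q\<in>B. c q p *\<^sub>Q (g p * f q))"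
    by (intro sum.cong refl, subst assms(1)) (simp add: scaleQ_scaleQ mult.commute[of _ e] ee)
  also have "\<dots> = (\<Sum>p\<in>B. \<Sum>q\<in>B. c p q *\<^sub>Q (f p * g q))"
    by (subst sum.swap) (simp add: mult.commute[of "g _"])
  finally have 1: "(\<Sum>p\<in>B. \<Sum>q\<in>B. c p q *\<^sub>Q e *\<^sub>Q (g p * f q)) = (\<Sum>p\<in>B. \<Sum>q\<in>B. c p q *\<^sub>Q (f p * g q))" .
  have 2: "(2 * q) *\<^sub>Q x = q *\<^sub>Q x + q *\<^sub>Q x" for q and x :: "'x \<Rightarrow> complex"
    unfolding mult_2 by (rule scaleQ_add_left)
  show ?thesis unfolding 2 scaleQ_add_right sum.distrib 1 ..
qed

lemma sym_entries_coords:
  assumes "u = (\<Sum>p\<in>B. \<Sum>q\<in>B. c p q *\<^sub>Q symprod (tens p 1) (tens q 1))" "\<And>p q. c p q = c q p"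
  shows "sym_entries a b u - (\<Sum>p\<in>B. \<Sum>q\<in>B. (2 * c p q) *\<^sub>Q (entry a p * entry b q)) \<in> J3"
proof -
  have "(\<Sum>p\<in>B. \<Sum>q\<in>B. c p q *\<^sub>Q sym_entries a b (symprod (tens p 1) (tens q 1)))
    - (\<Sum>p\<in>B. \<Sum>q\<in>B. c p q *\<^sub>Q (entry a p * entry b q + 1 *\<^sub>Q (entry b p * entry a q))) \<in> J3"
    unfolding sum_subtractf[symmetric] ratvec.scale_right_diff_distrib[symmetric] scaleQ_one
    by (intro ratvec.subspace_sum[OF J_subspace] ratvec.subspace_scale[OF J_subspace] sym_entries_tens)
  then show ?thesis
    unfolding sum_swap_sym[of c 1, simplified, OF assms(2)] scaleQ_one
    using linear_mod_sum2[OF J_subspace sym_entries_linear finite_basis finite_basis, of a b c "\<lambda>p q. symprod (tens p 1) (tens q 1)"]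
    unfolding assms(1)[symmetric] by (rule J_cong_trans[rotated])
qed

lemma alt_entries_coords:
  assumes "u = (\<Sum>p\<in>B. \<Sum>q\<in>B. c p q *\<^sub>Q wedge (tens p 1) (tens q 1))" "\<And>p q. c p q = - 1 * c q p"
  shows "alt_entries a b u - (\<Sum>p\<in>B. \<Sum>q\<in>B. (2 * c p q) *\<^sub>Q (entry a p * entry b q)) \<in> J3"
proof -
  have m1: "- 1 *\<^sub>Q x = - x" for x :: "('h, 'm) slrep \<Rightarrow> complex" by simp
  have "(\<Sum>p\<in>B. \<Sum>q\<in>B. c p q *\<^sub>Q alt_entries a b (wedge (tens p 1) (tens q 1)))
    - (\<Sum>p\<in>B. \<Sum>q\<in>B. c p q *\<^sub>Q (entry a p * entry b q + - 1 *\<^sub>Q (entry b p * entry a q))) \<in> J3"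
    unfolding sum_subtractf[symmetric] ratvec.scale_right_diff_distrib[symmetric] m1 add_uminus_conv_diff
    by (intro ratvec.subspace_sum[OF J_subspace] ratvec.subspace_scale[OF J_subspace] alt_entries_tens)
  moreover have "(\<Sum>p\<in>B. \<Sum>q\<in>B. c p q *\<^sub>Q (entry a p * entry b q + - 1 *\<^sub>Q (entry b p * entry a q)))
      = (\<Sum>p\<in>B. \<Sum>q\<in>B. (2 * c p q) *\<^sub>Q (entry a p * entry b q))"
    by (rule sum_swap_sym[OF assms(2)]) simp
  ultimately show ?thesis
    using J_cong_trans[OF linear_mod_sum2[OF J_subspace alt_entries_linear finite_basis finite_basis, of a b c "\<lambda>p q. wedge (tens p 1) (tens q 1)"]]
    unfolding assms(1)[symmetric] by simp
qed

text \<open>In coordinates, an element of the kernel is a quadratic expression in the entries that lies in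
  \<open>J\<^sup>3\<close>, with coefficients \<open>2 U\<close> symmetric and \<open>2 V\<close> antisymmetric in the basis elements \<open>p, q\<close>. Testing
  on equal directions \<open>X = Y\<close> sees the symmetric part only and shows \<open>U = 0\<close>; then commuting
  directions and the vanishing of \<open>V\<close> at the eliminated pairs show \<open>V = 0\<close>.\<close>

lemma psi_injective:
  assumes B2: "card B \<ge> 2" and w: "psi w \<in> J3"
  shows "(\<forall>c\<in>sym_index z. fst w c = 0) \<and> (\<forall>c\<in>alt_index z. snd w c = 0)"
proof -
  have "\<exists>d. fst w c = (\<Sum>p\<in>B. \<Sum>q\<in>B. d p q *\<^sub>Q symprod (tens p 1) (tens q 1)) \<and> (\<forall>p q. d p q = 1 * d q p)" for c
  proof -
    have flip: "symprod u v = 1 *\<^sub>Q symprod v u" for u v :: "'h hq" unfolding scaleQ_one by (rule sym2_bilin(5))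
    show ?thesis
    proof (rule square_coords[OF basis finite_basis sym2_bilin(1,2,3,4) flip _ sym2_span[of "fst w c"]])
      fix d assume "fst w c = (\<Sum>p\<in>B. \<Sum>q\<in>B. d p q *\<^sub>Q symprod (tens p 1) (tens q 1))"
        "\<And>p q. d p q = 1 * d q p"
      then show ?thesis by (intro exI[of _ d] conjI allI)
    qed simp
  qed
  then have "\<exists>U. \<forall>c. fst w c = (\<Sum>p\<in>B. \<Sum>q\<in>B. U c p q *\<^sub>Q symprod (tens p 1) (tens q 1)) \<and>
      (\<forall>p q. U c p q = 1 * U c q p)" by (intro choice allI)
  then obtain U where U: "\<And>c. fst w c = (\<Sum>p\<in>B. \<Sum>q\<in>B. U c p q *\<^sub>Q symprod (tens p 1) (tens q 1))"
    and U_sym: "\<And>c p q. U c p q = U c q p" unfolding mult_1 by blast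
  have "\<exists>d. snd w c = (\<Sum>p\<in>B. \<Sum>q\<in>B. d p q *\<^sub>Q wedge (tens p 1) (tens q 1)) \<and> (\<forall>p q. d p q = - 1 * d q p)" for c
  proof -
    have flip: "wedge u v = - 1 *\<^sub>Q wedge v u" for u v :: "'h hq" using wedge_anticomm[of u v] by simp
    show ?thesis
    proof (rule square_coords[OF basis finite_basis ext2_bilin(1,2,3,4) flip _ ext2_span[of "snd w c"]])
      fix d assume "snd w c = (\<Sum>p\<in>B. \<Sum>q\<in>B. d p q *\<^sub>Q wedge (tens p 1) (tens q 1))"
        "\<And>p q. d p q = - 1 * d q p"
      then show ?thesis by (intro exI[of _ d] conjI allI)
    qed simp
  qed
  then have "\<exists>V. \<forall>c. snd w c = (\<Sum>p\<in>B. \<Sum>q\<in>B. V c p q *\<^sub>Q wedge (tens p 1) (tens q 1)) \<and>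
      (\<forall>p q. V c p q = - 1 * V c q p)" by (intro choice allI)
  then obtain V where V: "\<And>c. snd w c = (\<Sum>p\<in>B. \<Sum>q\<in>B. V c p q *\<^sub>Q wedge (tens p 1) (tens q 1))"
    and V_alt: "\<And>c p q. V c p q = - 1 * V c q p" by blast
  let ?S = "sym_index z" and ?A = "alt_index z"
  define U' where "U' p q a b = (if (a, b) \<in> ?S then U (a, b) p q else 0)" for p q a b
  define V' where "V' p q a b = (if (a, b) \<in> ?A then V (a, b) p q else 0)" for p q a b
  define K where "K p q a b = 2 * U' p q a b + 2 * V' p q a b" for p q a b
  have U'_sym: "U' p q a b = U' q p a b" for p q a b using U_sym by (simp add: U'_def)
  have V'_alt: "V' p q a b = - V' q p a b" for p q a b using V_alt[of _ p q] by (simp add: V'_def)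
  have F: "(\<Sum>p\<in>B. \<Sum>q\<in>B. \<Sum>a\<in>UNIV. \<Sum>b\<in>UNIV. K p q a b *\<^sub>Q (entry a p * entry b q)) \<in> J3"
  proof -
    let ?s = "\<lambda>D c. (\<Sum>p\<in>B. \<Sum>q\<in>B. (2 * D c p q) *\<^sub>Q (entry (fst c) p * entry (snd c) q))"
    have "psi w - ((\<Sum>c\<in>?S. ?s U c) + (\<Sum>c\<in>?A. ?s V c)) \<in> J3"
      unfolding psi_def
      by (rule J_cong_add; unfold sum_subtractf[symmetric]; intro ratvec.subspace_sum[OF J_subspace])
        (rule sym_entries_coords[OF U U_sym] alt_entries_coords[OF V V_alt])+
    from ratvec.subspace_diff[OF J_subspace w this]
    have *: "(\<Sum>c\<in>?S. ?s U c) + (\<Sum>c\<in>?A. ?s V c) \<in> J3" by simp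
    have ext: "(\<Sum>c\<in>X. ?s D c) = (\<Sum>p\<in>B. \<Sum>q\<in>B. \<Sum>a\<in>UNIV. \<Sum>b\<in>UNIV.
        (2 * (if (a, b) \<in> X then D (a, b) p q else 0)) *\<^sub>Q (entry a p * entry b q))" for X and D :: "('m \<times> 'm) \<times> ('m \<times> 'm) \<Rightarrow> 'h \<Rightarrow> 'h \<Rightarrow> rat"
    proof -
      have "(\<Sum>c\<in>X. ?s D c) = (\<Sum>c\<in>UNIV. if c \<in> X then ?s D c else 0)"
        by (simp add: sum.If_cases)
      also have "\<dots> = (\<Sum>c\<in>UNIV. \<Sum>p\<in>B. \<Sum>q\<in>B. (2 * (if c \<in> X then D c p q else 0)) *\<^sub>Q (entry (fst c) p * entry (snd c) q))"
        by (intro sum.cong refl) simp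
      also have "\<dots> = (\<Sum>p\<in>B. \<Sum>q\<in>B. \<Sum>c\<in>UNIV. (2 * (if c \<in> X then D c p q else 0)) *\<^sub>Q (entry (fst c) p * entry (snd c) q))"
        by (subst sum.swap, intro sum.cong refl, subst sum.swap, rule refl)
      finally show ?thesis
        by (simp add: sum.cartesian_product case_prod_unfold cong: if_cong)
    qed
    show ?thesis
      using * unfolding ext K_def scaleQ_add_left sum.distrib U'_def V'_def .
  qed
  have C0: "U' p q (z, z) b = 0" "U' p q a (z, z) = 0" "V' p q (z, z) b = 0" "V' p q a (z, z) = 0" for p q a b
    by (simp_all add: U'_def V'_def sym_index_def alt_index_def)
  have V'_elim: "V' p q a b = 0" "V' p q b a = 0" if "{a, b} \<in> elim_pairs z" for p q a b
    using that by (simp_all add: V'_def alt_index_def insert_commute)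
  have V'_one: "V' p q b a = 0" if "(a, b) \<in> ?A" for p q a b
    using that by (auto simp: V'_def alt_index_def)
  have pp: "bform (\<lambda>a b. of_rat (K p p a b)) X X = 0" if "p \<in> B" "trace X = 0" for p X
  proof -
    have "B \<noteq> {p}" using B2 by auto
    then obtain q where "q \<in> B" "p \<noteq> q" using \<open>p \<in> B\<close> by blast
    then show ?thesis using quadratic_in_J3(1)[OF F that(1) _ _ that(2) that(2)] by blast
  qed
  have V'_same: "V' p p a b = 0" for p a b using V'_alt[of p p a b] by simp
  \<comment> \<open>The terms at \<open>(p, q)\<close> and \<open>(q, p)\<close> cannot be told apart by evaluation; \<open>M\<close> is what
    they contribute together to the bilinear form in the directions at \<open>p\<close> and \<open>q\<close>.\<close>
  define M where "M p q a b = real_of_rat (K p q a b + K q p b a)" for p q a b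
  have M0: "M p q (z, z) b = 0" "M p q a (z, z) = 0" for p q a b by (simp_all add: M_def K_def C0)
  have M_van: "bform (M p q) X Y = 0"
    if "p \<in> B" "q \<in> B" "p \<noteq> q" "trace X = 0" "trace Y = 0" "X ** Y = Y ** X" for p q X Y
  proof -
    have "bform (\<lambda>a b. of_rat (K p q a b)) X Y + bform (\<lambda>a b. of_rat (K q p a b)) Y X = 0"
      by (rule quadratic_in_J3(2)[OF F that])
    then show ?thesis
      unfolding bform_swap[of _ Y X] bform_add_coeff by (simp add: M_def[abs_def] of_rat_add)
  qed
  have U'_zero: "U' p q a b + U' p q b a = 0" if "p \<in> B" "q \<in> B" for p q a b
  proof (cases "p = q")
    case True
    have "real_of_rat (K p p a b) + real_of_rat (K p p b a) = 0"
      by (rule symmetric_part_zero[of "\<lambda>a b. real_of_rat (K p p a b)" z])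
        (use pp[OF that(1)] in \<open>simp_all add: K_def C0\<close>)
    then have "K p p a b + K p p b a = 0" by (simp flip: of_rat_add)
    then show ?thesis using True by (simp add: K_def V'_same)
  next
    case False
    have "M p q a b + M p q b a = 0"
      by (rule symmetric_part_zero[of "M p q" z]) (use M_van[OF that False] in \<open>simp_all add: M0\<close>)
    then have "K p q a b + K q p b a + (K p q b a + K q p a b) = 0"
      by (simp add: M_def flip: of_rat_add)
    then show ?thesis
      using U'_sym[of q p a b] U'_sym[of q p b a] V'_alt[of q p a b] V'_alt[of q p b a] by (simp add: K_def)
  qed
  have U'0: "U' p q a b = 0" if "p \<in> B" "q \<in> B" "(a, b) \<in> ?S" for p q a b
  proof (cases "a = b")
    case True
    then show ?thesis using U'_zero[OF that(1,2), of a a] by simp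
  next
    case False
    then have "(b, a) \<notin> ?S" using that(3) by (auto simp: sym_index_def)
    then show ?thesis using U'_zero[OF that(1,2), of a b] by (simp add: U'_def)
  qed
  then have U'00: "U' p q a b = 0" if "p \<in> B" "q \<in> B" for p q a b using that by (cases "(a, b) \<in> ?S") (auto simp: U'_def)
  have V'0: "V' p q a b = 0" if "p \<in> B" "q \<in> B" "(a, b) \<in> ?A" for p q a b
  proof (cases "p = q")
    case False
    have M: "M p q a b = 2 * (real_of_rat (V' p q a b) - real_of_rat (V' p q b a))" for a b
      using V'_alt[of q p b a] that by (simp add: M_def K_def U'00 of_rat_diff of_rat_mult)
    have el: "M p q a b = 0" if "{a, b} \<in> elim_pairs z" for a b
      using V'_elim[OF that] by (simp add: M)
    have "M p q a b = 0"
    proof (rule alternating_form_zero[of "M p q" z])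
      show "M p q a b = - M p q b a" for a b by (simp add: M)
      show "M p q (i, z) (z, l) = 0" if "i \<noteq> z" "l \<noteq> z" for i l
        by (rule el, unfold elim_pairs_iff, rule exI[of _ i], rule exI[of _ l]) (use that in \<open>simp add: elim_pair_def\<close>)
      show "M p q (l, l) (z, l) = 0" if "l \<noteq> z" for l
        by (rule el, unfold elim_pairs_iff, rule exI[of _ z], rule exI[of _ l]) (use that in \<open>simp add: elim_pair_def\<close>)
      show "M p q (l, l) (l, z) = 0" if "l \<noteq> z" for l
        by (rule el, unfold elim_pairs_iff, rule exI[of _ l], rule exI[of _ z]) (use that in \<open>simp add: elim_pair_def\<close>)
    qed (use M_van[OF that(1,2) False] in \<open>simp_all add: M0\<close>)
    then show ?thesis using V'_one[OF that(3)] by (simp add: M)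
  qed (simp add: V'_same)
  have "fst w c = 0" if "c \<in> ?S" for c
    unfolding U[of c] using U'0[of _ _ "fst c" "snd c"] that by (auto simp: U'_def intro!: sum.neutral)
  moreover have "snd w c = 0" if "c \<in> ?A" for c
    unfolding V[of c] using V'0[of _ _ "fst c" "snd c"] that by (auto simp: V'_def intro!: sum.neutral)
  ultimately show ?thesis by blast
qed

lemma fun_act_psi:
  "fun_act (psi w) \<sigma> - psi ((\<lambda>c. sym2_act (fst w c) \<sigma>), (\<lambda>c. ext2_act (snd w c) \<sigma>)) \<in> J3"
proof -
  have s: "fun_act (sum f X) \<sigma> = (\<Sum>k\<in>X. fun_act (f k) \<sigma>)" for f :: "'k \<Rightarrow> ('h, 'm) slrep \<Rightarrow> complex" and X
    by (rule ext) (simp add: fun_act_def sum_fun_apply)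
  show ?thesis
    unfolding psi_def fun_act_algebra_hom s
    by (rule J_cong_add; unfold sum_subtractf[symmetric]; intro ratvec.subspace_sum[OF J_subspace])
      (auto intro: fun_act_sym_entries fun_act_alt_entries)
qed

end

section \<open>The isomorphism\<close>

lemma coset_cong:
  fixes I :: "('x \<Rightarrow> complex) set"
  assumes "ratvec.subspace I" "f - g \<in> I"
  shows "coset I f = coset I g"
proof -
  have *: "coset I f \<subseteq> coset I g" if "f - g \<in> I" for f g
  proof
    fix h assume "h \<in> coset I f"
    then obtain k where "h = f + k" "k \<in> I" by (auto simp: coset_def)
    then have "h = g + ((f - g) + k)" "(f - g) + k \<in> I"
      using that ratvec.subspace_add[OF assms(1)] by auto
    then show "h \<in> coset I g" unfolding coset_def by blast
  qed
  show ?thesis using *[OF assms(2)] *[OF subspace_cong_sym[OF assms]] by blast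
qed

text \<open>The isomorphism sends a coset to the unique \<open>w\<close> whose image lies in it.\<close>

lemma (in free_abelian) gr2_iso_of_map:
  fixes F :: "'w::rat_vector \<Rightarrow> ('h, 'm) slrep \<Rightarrow> complex"
  assumes W: "ratvec.subspace W" and lin: "linear_mod J3 F" and J2: "\<And>w. F w \<in> J2"
    and inj: "\<And>w. w \<in> W \<Longrightarrow> F w \<in> J3 \<Longrightarrow> w = 0"
    and surj: "\<And>f. f \<in> J2 \<Longrightarrow> \<exists>w\<in>W. f - F w \<in> J3"
    and act: "\<And>w \<sigma>. w \<in> W \<Longrightarrow> act w \<sigma> \<in> W" "\<And>w \<sigma>. w \<in> W \<Longrightarrow> fun_act (F w) \<sigma> - F (act w \<sigma>) \<in> J3"
  shows "\<exists>\<phi> :: (('h, 'm) slrep \<Rightarrow> complex) set \<Rightarrow> 'w. gr_iso 2 B \<phi> W act"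
proof -
  let ?I = "J3"
  define \<phi> where "\<phi> C = (THE w. w \<in> W \<and> (\<exists>f\<in>C. f - F w \<in> ?I))" for C
  have uniq: "v = w" if "v \<in> W" "w \<in> W" "F v - F w \<in> ?I" for v w
  proof -
    have "F v - (F w + F (v - w)) \<in> ?I" using linear_modD(1)[OF lin, of w "v - w"] by simp
    from ratvec.subspace_diff[OF J_subspace that(3) this] have "F (v - w) \<in> ?I" by simp
    then have "v - w = 0" using that W by (intro inj ratvec.subspace_diff)
    then show ?thesis by simp
  qed
  have \<phi>: "\<phi> (coset ?I f) = w" if "w \<in> W" "f - F w \<in> ?I" for f w
    unfolding \<phi>_def
  proof (rule the_equality)
    have "f \<in> coset ?I f" using ratvec.subspace_0[OF J_subspace] by (auto simp: coset_def intro!: exI[of _ 0])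
    then show "w \<in> W \<and> (\<exists>f\<in>coset ?I f. f - F w \<in> ?I)" using that by blast
  next
    fix v assume "v \<in> W \<and> (\<exists>f\<in>coset ?I f. f - F v \<in> ?I)"
    then obtain g where v: "v \<in> W" and g: "g \<in> ?I" "f + g - F v \<in> ?I" by (auto simp: coset_def)
    have "F v - F w = (f - F w) + g - (f + g - F v)" by simp
    also have "\<dots> \<in> ?I"
      by (rule ratvec.subspace_diff[OF J_subspace ratvec.subspace_add[OF J_subspace that(2) g(1)] g(2)])
    finally show "v = w" using uniq v that(1) by blast
  qed
  let ?gr = "coset ?I ` J2"
  have "bij_betw \<phi> ?gr W"
  proof (rule bij_betw_imageI)
    show "inj_on \<phi> ?gr"
    proof (rule inj_onI)
      fix C D assume "C \<in> ?gr" "D \<in> ?gr" and eq: "\<phi> C = \<phi> D"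
      then obtain f g where f: "f \<in> J2" "C = coset ?I f" and g: "g \<in> J2" "D = coset ?I g"
        by blast
      obtain v w where v: "v \<in> W" "f - F v \<in> ?I" and w: "w \<in> W" "g - F w \<in> ?I" using surj f(1) g(1) by blast
      have "v = w" using eq \<phi>[OF v] \<phi>[OF w] f g by simp
      then have "f - g \<in> ?I" using v(2) w(2) by (blast intro: J_cong_trans J_cong_sym)
      then show "C = D" unfolding f g by (rule coset_cong[OF J_subspace])
    qed
    show "\<phi> ` ?gr = W"
    proof
      show "\<phi> ` ?gr \<subseteq> W"
      proof (rule image_subsetI)
        fix C assume "C \<in> ?gr"
        then obtain f where "f \<in> J2" "C = coset ?I f" by blast
        then show "\<phi> C \<in> W" using surj[of f] \<phi> by metis
      qed
      show "W \<subseteq> \<phi> ` ?gr"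
      proof
        fix w assume "w \<in> W"
        then have "\<phi> (coset ?I (F w)) = w" using ratvec.subspace_0[OF J_subspace] by (intro \<phi>) simp_all
        then show "w \<in> \<phi> ` ?gr" using J2 by (metis imageI)
      qed
    qed
  qed
  moreover have "\<phi> (coset ?I (f + g)) = \<phi> (coset ?I f) + \<phi> (coset ?I g)"
    if fg: "f \<in> J2" "g \<in> J2" for f g
  proof -
    obtain v w where v: "v \<in> W" "f - F v \<in> ?I" and w: "w \<in> W" "g - F w \<in> ?I" using surj fg by blast
    have "f + g - F (v + w) \<in> ?I"
      by (rule J_cong_trans[OF J_cong_add[OF v(2) w(2)] J_cong_sym[OF linear_modD(1)[OF lin]]])
    then show ?thesis using \<phi>[OF v] \<phi>[OF w] \<phi>[OF ratvec.subspace_add[OF W v(1) w(1)]] by simp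
  qed
  moreover have "\<phi> (coset ?I (q *\<^sub>Q f)) = q *\<^sub>Q \<phi> (coset ?I f)" if f: "f \<in> J2" for f q
  proof -
    obtain v where v: "v \<in> W" "f - F v \<in> ?I" using surj f by blast
    have "q *\<^sub>Q f - F (q *\<^sub>Q v) \<in> ?I"
      by (rule J_cong_trans[OF J_cong_scale[OF v(2)] J_cong_sym[OF linear_modD(2)[OF lin]]])
    then show ?thesis using \<phi>[OF v] \<phi>[OF ratvec.subspace_scale[OF W v(1)]] by simp
  qed
  moreover have "\<phi> (coset ?I (fun_act f \<sigma>)) = act (\<phi> (coset ?I f)) \<sigma>" if f: "f \<in> J2" for f \<sigma>
  proof -
    obtain v where v: "v \<in> W" "f - F v \<in> ?I" using surj f by blast
    have "fun_act f \<sigma> - fun_act (F v) \<sigma> \<in> ?I" using fun_act_J[OF v(2)] by (simp add: fun_act_diff)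
    then have "fun_act f \<sigma> - F (act v \<sigma>) \<in> ?I" using act(2)[OF v(1)] by (rule J_cong_trans)
    then show ?thesis using \<phi>[OF v] \<phi>[OF act(1)[OF v(1)]] by simp
  qed
  ultimately have "gr_iso 2 B \<phi> W act"
    unfolding gr_iso_def gr_def Let_def numeral_2_eq_2 by (intro conjI ballI allI)
  then show ?thesis by (intro exI[of _ \<phi>])
qed

lemma square_act_zero: "sym2_act 0 \<sigma> = 0" "ext2_act 0 \<sigma> = 0"
  using square_act_linear(2)[of 0 0 \<sigma>] square_act_linear(4)[of 0 0 \<sigma>] by simp_all

theorem proposition7p3:
  fixes B :: "'h::ab_group_add set" and n m :: nat
  assumes "zbasis B" and "card B = n" and "n \<ge> 2"
    and "CARD('m::finite) = m" and "m \<ge> 2"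
  shows "\<exists>\<phi> :: (('h, 'm) slrep \<Rightarrow> complex) set \<Rightarrow> (nat \<Rightarrow> 'h hq sym2) \<times> (nat \<Rightarrow> 'h hq ext2).
    gr_iso 2 B \<phi>
      (direct_sum (m\<^sup>2 * (m\<^sup>2 - 1) div 2) ((m\<^sup>2 - 1) * (m\<^sup>2 - 4) div 2))
      sum_act"
proof -
  define k where "k = m\<^sup>2 * (m\<^sup>2 - 1) div 2"
  define l where "l = (m\<^sup>2 - 1) * (m\<^sup>2 - 4) div 2"
  define z :: 'm where "z = undefined"
  have "finite B" using assms(2,3) by (intro card_ge_0_finite) simp
  then interpret free_abelian B z by unfold_locales (use assms(1) in auto)
  obtain e where e: "bij_betw e {..<k} (sym_index z)"
    using ex_bij_betw_nat_finite[of "sym_index z"] card_sym_index[of z] assms(4)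
    by (auto simp: k_def atLeast0LessThan)
  obtain f where f: "bij_betw f {..<l} (alt_index z)"
    using ex_bij_betw_nat_finite[of "alt_index z"] card_alt_index[of z] assms(4,5)
    by (auto simp: l_def atLeast0LessThan)
  define e' f' where "e' = inv_into {..<k} e" and "f' = inv_into {..<l} f"
  have e': "\<And>i. i < k \<Longrightarrow> e' (e i) = i" "\<And>c. c \<in> sym_index z \<Longrightarrow> e (e' c) = c \<and> e' c < k" "\<And>i. i < k \<Longrightarrow> e i \<in> sym_index z"
    using bij_betw_inv_into_left[OF e] bij_betw_inv_into_right[OF e] bij_betwE[OF bij_betw_inv_into[OF e]] bij_betwE[OF e]
    by (auto simp: e'_def)
  have f': "\<And>i. i < l \<Longrightarrow> f' (f i) = i" "\<And>c. c \<in> alt_index z \<Longrightarrow> f (f' c) = c \<and> f' c < l" "\<And>i. i < l \<Longrightarrow> f i \<in> alt_index z"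
    using bij_betw_inv_into_left[OF f] bij_betw_inv_into_right[OF f] bij_betwE[OF bij_betw_inv_into[OF f]] bij_betwE[OF f]
    by (auto simp: f'_def)
  define F where "F w = psi ((\<lambda>c. fst w (e' c)), (\<lambda>c. snd w (f' c)))" for w :: "(nat \<Rightarrow> 'h hq sym2) \<times> (nat \<Rightarrow> 'h hq ext2)"
  let ?W = "direct_sum k l :: ((nat \<Rightarrow> 'h hq sym2) \<times> (nat \<Rightarrow> 'h hq ext2)) set"
  have "\<exists>\<phi> :: (('h, 'm) slrep \<Rightarrow> complex) set \<Rightarrow> _. gr_iso 2 B \<phi> ?W sum_act"
  proof (rule gr2_iso_of_map[where F = F])
    show "ratvec.subspace ?W"
      by (rule ratvec.subspaceI) (auto simp: direct_sum_def scaleQ_prod_def scaleQ_fun_def zero_prod_def)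
    show "linear_mod J3 F"
      unfolding F_def[abs_def]
      by (rule linear_mod_compose[OF psi_linear]) (simp_all add: fun_eq_iff scaleQ_prod_def scaleQ_fun_def plus_prod_def)
    show "F w \<in> J2" for w unfolding F_def by (rule psi_in_J2)
    show "w = 0" if "w \<in> ?W" "F w \<in> J3" for w
    proof -
      have zero: "(\<forall>c\<in>sym_index z. fst w (e' c) = 0) \<and> (\<forall>c\<in>alt_index z. snd w (f' c) = 0)"
        using psi_injective[OF _ that(2)[unfolded F_def]] assms(2,3) by simp
      then have "fst w i = 0" if "i < k" for i
        using e'(1)[OF that] e'(3)[OF that] by (metis (no_types))
      moreover have "snd w i = 0" if "i < l" for i
        using zero f'(1)[OF that] f'(3)[OF that] by (metis (no_types))
      ultimately have "fst w i = 0 \<and> snd w i = 0" for i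
        using \<open>w \<in> ?W\<close> by (cases "i < k"; cases "i < l") (simp_all add: direct_sum_def mem_Times_iff)
      then show ?thesis by (simp add: prod_eq_iff fun_eq_iff)
    qed
    show "\<exists>w\<in>?W. g - F w \<in> J3" if g: "g \<in> J2" for g
    proof -
      obtain w where w: "g - psi w \<in> J3"
        using subsetD[OF J2_subset_psi_range g] unfolding psi_range_def by blast
      define w' where "w' = ((\<lambda>i. if i < k then fst w (e i) else 0), (\<lambda>i. if i < l then snd w (f i) else 0))"
      have "fst w' (e' c) = fst w c" if "c \<in> sym_index z" for c using e'(2)[OF that] by (simp add: w'_def)
      moreover have "snd w' (f' c) = snd w c" if "c \<in> alt_index z" for c using f'(2)[OF that] by (simp add: w'_def)
      ultimately have "F w' = psi w" unfolding F_def psi_def by simp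
      moreover have "w' \<in> ?W" by (simp add: direct_sum_def w'_def)
      ultimately show ?thesis using w by (intro bexI[of _ w']) simp_all
    qed
    show "sum_act w \<sigma> \<in> ?W" if "w \<in> ?W" for w \<sigma>
      using that by (auto simp: direct_sum_def sum_act_def square_act_zero)
    show "fun_act (F w) \<sigma> - F (sum_act w \<sigma>) \<in> J3" if "w \<in> ?W" for w \<sigma>
      using fun_act_psi[of "((\<lambda>c. fst w (e' c)), (\<lambda>c. snd w (f' c)))" \<sigma>]
      by (simp add: F_def sum_act_def)
  qed
  then show ?thesis unfolding k_def l_def .
qed

end
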